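(* Let $\lambda$ be a primitive $n$-th root of unity, $\varepsilon\in\{\pm1\}$, and let $\rho:\Gamma\to\mathrm{GL}_3(\mathbf C)$ be the representation with $$\rho(\bar S)=\varepsilon\begin{pmatrix}0&0&\lambda\\0&1&0\\\bar\lambda&0&0\end{pmatrix},\qquad \rho(\bar T)=\varepsilon\begin{pmatrix}\lambda&0&0\\0&0&1\\0&\bar\lambda&0\end{pmatrix}.$$ Let $k$ be an integer and let $F\in\mathcal H(k,\rho)$ be nonzero with algebraic Fourier coefficients. If $p$ is a prime dividing $n$ such that $p\ge5$, or $p=3$ and $9\mid n$, or $p=2$ and $16\mid n$, then for each component of $F$ the powers of $p$ dividing the denominators of its Fourier coefficients are unbounded.
   Context: $\Gamma=\mathrm{PSL}_2(\mathbf Z)$, $\bar S,\bar T$ the images of $S=\begin{pmatrix}0&-1\\1&0\end{pmatrix}$, $T=\begin{pmatrix}1&1\\0&1\end{pmatrix}$; the displayed matrices define a representation of $\Gamma$ (it is the representation induced from the character $\chi$ of $\bar\Gamma_0(2)$ with $\chi(\bar U)=\lambda$, $\chi(\bar V)=\varepsilon$, $U=\begin{pmatrix}1&0\\2&1\end{pmatrix}$, $V=TU^{-1}$). $\mathcal H(k,\rho)$ is the space of holomorphic $F:\mathcal H\to\mathbf C^3$ with $(F|_k\gamma)(\tau):=(c\tau+d)^{-k}F(\gamma\tau)=\rho(\gamma)F(\tau)$ for all $\gamma\in\Gamma$, each component having a Fourier expansion $\sum_{m\ge0}c_mq^{m/(2n)}$, $q=e^{2\pi i\tau}$. "Powers of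 $p$ dividing the denominators are unbounded" means: for every $N\ge0$ some coefficient $c_m$ has $p^Nc_m$ non-integral at some prime above $p$. *)

theory Defs
  imports
    "HOL-Complex_Analysis.Complex_Analysis"
    "HOL-Computational_Algebra.Computational_Algebra"
    "HOL-Algebra.Ideal"
begin

section \<open>The modular group and its representations\<close>

definition SL2Z :: "(int^2^2) monoid" where
  "SL2Z = \<lparr>carrier = {A. det A = 1}, mult = (**), one = mat 1\<rparr>"

text \<open>Elements of \<open>PSL2Z\<close> are the cosets \<open>{A, - A}\<close>.\<close>

definition PSL2Z :: "(int^2^2) set monoid" where
  "PSL2Z = SL2Z Mod {mat 1, - mat 1}"

definition to_PSL2Z :: "int^2^2 \<Rightarrow> (int^2^2) set" where
  "to_PSL2Z A = {mat 1, - mat 1} #>\<^bsub>SL2Z\<^esub> A"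

definition matS :: "int^2^2" where
  "matS = vector [vector [0, -1], vector [1, 0]]"

definition matT :: "int^2^2" where
  "matT = vector [vector [1, 1], vector [0, 1]]"

definition GL3C :: "(complex^3^3) monoid" where
  "GL3C = \<lparr>carrier = {M. invertible M}, mult = (**), one = mat 1\<rparr>"

lemma group_SL2Z: "group SL2Z"
proof (rule groupI)
  fix A assume "A \<in> carrier SL2Z"
  then have d: "A$1$1 * A$2$2 - A$1$2 * A$2$1 = 1"
    by (simp add: SL2Z_def det_2)
  define B :: "int^2^2" where
    "B = vector [vector [A$2$2, - A$1$2], vector [- A$2$1, A$1$1]]"
  have "det B = 1" "B ** A = mat 1"
    using d by (simp_all add: B_def det_2 matrix_matrix_mult_def mat_def vec_eq_iff
        forall_2 sum_2 vector_2 algebra_simps)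
  then show "\<exists>B\<in>carrier SL2Z. B \<otimes>\<^bsub>SL2Z\<^esub> A = \<one>\<^bsub>SL2Z\<^esub>"
    by (auto simp: SL2Z_def)
qed (auto simp: SL2Z_def det_mul matrix_mul_assoc)

lemma minus_matrix_mult_left: "(- A) ** B = - (A ** (B :: 'a::comm_ring_1^'n^'m))"
  by (simp add: matrix_matrix_mult_def vec_eq_iff sum_negf)

lemma minus_matrix_mult_right: "A ** (- B) = - (A ** (B :: 'a::comm_ring_1^'n^'m))"
  by (simp add: matrix_matrix_mult_def vec_eq_iff sum_negf)

lemma normal_SL2Z: "{mat 1, - mat 1} \<lhd> SL2Z"
proof -
  interpret group SL2Z by (rule group_SL2Z)
  have det_minus: "det (- mat 1 :: int^2^2) = 1"
    by (simp add: det_2 mat_def)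
  have "subgroup {mat 1, - mat 1} SL2Z"
  proof (rule subgroupI)
    fix A assume A: "A \<in> {mat 1, - mat 1 :: int^2^2}"
    then have "A \<otimes>\<^bsub>SL2Z\<^esub> A = \<one>\<^bsub>SL2Z\<^esub>" "A \<in> carrier SL2Z"
      using det_minus
      by (auto simp: SL2Z_def minus_matrix_mult_left minus_matrix_mult_right)
    then show "inv\<^bsub>SL2Z\<^esub> A \<in> {mat 1, - mat 1}"
      using A inv_equality by force
  qed (use det_minus in \<open>auto simp: SL2Z_def minus_matrix_mult_left minus_matrix_mult_right\<close>)
  moreover have "A \<otimes>\<^bsub>SL2Z\<^esub> h \<otimes>\<^bsub>SL2Z\<^esub> inv\<^bsub>SL2Z\<^esub> A \<in> {mat 1, - mat 1}"
    if A: "A \<in> carrier SL2Z" and h: "h \<in> {mat 1, - mat 1}" for A h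
  proof -
    have "A ** inv\<^bsub>SL2Z\<^esub> A = mat 1"
      using r_inv[OF A] by (simp add: SL2Z_def)
    then show ?thesis
      using h by (auto simp: SL2Z_def minus_matrix_mult_left minus_matrix_mult_right)
  qed
  ultimately show ?thesis
    by (simp add: normal_inv_iff)
qed

lemma group_PSL2Z: "group PSL2Z"
  unfolding PSL2Z_def by (rule normal.factorgroup_is_group[OF normal_SL2Z])

lemma group_GL3C: "group GL3C"
proof (rule groupI)
  fix M assume "M \<in> carrier GL3C"
  then obtain N where "M ** N = mat 1" "N ** M = mat 1"
    by (auto simp: GL3C_def invertible_def)
  then show "\<exists>N\<in>carrier GL3C. N \<otimes>\<^bsub>GL3C\<^esub> M = \<one>\<^bsub>GL3C\<^esub>"
    by (auto simp: GL3C_def invertible_def)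
qed (auto simp: GL3C_def invertible_mult matrix_mul_assoc invertible_def[of "mat 1"])

definition primitive_root_of_unity :: "nat \<Rightarrow> complex \<Rightarrow> bool" where
  "primitive_root_of_unity n z \<longleftrightarrow> n > 0 \<and> z ^ n = 1 \<and> (\<forall>m. 0 < m \<and> m < n \<longrightarrow> z ^ m \<noteq> 1)"


section \<open>Vector-valued modular forms\<close>

definition upper_half_plane :: "complex set" where
  "upper_half_plane = {\<tau>. Im \<tau> > 0}"

definition slash :: "int \<Rightarrow> int^2^2 \<Rightarrow> (complex \<Rightarrow> complex^'d) \<Rightarrow> complex \<Rightarrow> complex^'d" where
  "slash k A F \<tau> = (of_int (A$2$1) * \<tau> + of_int (A$2$2)) powi (- k) *s
     F (moebius (of_int (A$1$1)) (of_int (A$1$2)) (of_int (A$2$1)) (of_int (A$2$2)) \<tau>)"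

text \<open>\<open>f(\<tau>) = (\<Sum>m. c m * q^(m/h))\<close> with \<open>q = exp (2 \<pi> i \<tau>)\<close>.\<close>

definition has_fourier_expansion ::
    "nat \<Rightarrow> (complex \<Rightarrow> complex) \<Rightarrow> (nat \<Rightarrow> complex) \<Rightarrow> bool" where
  "has_fourier_expansion h f c \<longleftrightarrow>
     (\<forall>\<tau>\<in>upper_half_plane.
        (\<lambda>m. c m * exp (2 * of_real pi * \<i> * \<tau> * of_nat m / of_nat h)) sums f \<tau>)"

text \<open>
  The transformation law is imposed for both representatives \<open>A\<close> of each element \<open>\<gamma>\<close> of
  \<open>PSL2Z\<close>; for odd \<open>k\<close> this forces \<open>F\<close> to vanish on the upper half plane. Functions are total,
  but their values outside the upper half plane are irrelevant.
\<close>

definition vv_modular_forms ::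
    "nat \<Rightarrow> int \<Rightarrow> ((int^2^2) set \<Rightarrow> complex^3^3) \<Rightarrow> (complex \<Rightarrow> complex^3) set" where
  "vv_modular_forms n k \<rho> = {F.
     (\<forall>i. (\<lambda>\<tau>. F \<tau> $ i) holomorphic_on upper_half_plane) \<and>
     (\<forall>\<gamma>\<in>carrier PSL2Z. \<forall>A\<in>\<gamma>. \<forall>\<tau>\<in>upper_half_plane. slash k A F \<tau> = \<rho> \<gamma> *v F \<tau>) \<and>
     (\<forall>i. \<exists>c. has_fourier_expansion (2 * n) (\<lambda>\<tau>. F \<tau> $ i) c)}"


section \<open>Denominators of algebraic numbers\<close>

definition algebraic_integers :: "complex ring" where
  "algebraic_integers =
     \<lparr>carrier = {x. algebraic_int x}, monoid.mult = (*), one = 1, ring.zero = 0, add = (+)\<rparr>"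

text \<open>
  Primes above \<open>p\<close> are taken in the ring of all algebraic integers, so that no number field has
  to be chosen: by lying-over, the primes above \<open>p\<close> of a number field \<open>K\<close> are the intersections
  of these with \<open>K\<close>, and integrality of an element of \<open>K\<close> may be tested at either.
\<close>

definition prime_above :: "nat \<Rightarrow> complex set \<Rightarrow> bool" where
  "prime_above p P \<longleftrightarrow>
     primeideal P algebraic_integers \<and> {a :: int. of_int a \<in> P} = {a. int p dvd a}"

text \<open>\<open>x\<close> lies in the localisation at \<open>P\<close> of the ring of algebraic integers.\<close>

definition integral_at :: "complex set \<Rightarrow> complex \<Rightarrow> bool" where
  "integral_at P x \<longleftrightarrow> (\<exists>s. algebraic_int s \<and> s \<notin> P \<and> algebraic_int (s * x))"

definition unbounded_denominators :: "nat \<Rightarrow> (nat \<Rightarrow> complex) \<Rightarrow> bool" where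
  "unbounded_denominators p c \<longleftrightarrow>
     (\<forall>N. \<exists>m P. prime_above p P \<and> \<not> integral_at P (of_nat p ^ N * c m))"

end

theory Submission
  imports Defs "Jordan_Normal_Form.Char_Poly"
begin

text \<open>
  Up to a sign character, the first component \<open>F\<^sub>1\<close> is a scalar form on \<open>\<Gamma>\<^sub>0(2)\<close> that
  transforms like a fractional power of the Hauptmodul \<open>J = (\<eta>(2\<tau>)/\<eta>(\<tau>))\<^sup>2\<^sup>4\<close>,
  which is nowhere zero and integral. Hence \<open>F\<^sub>1 = J\<^sup>j\<^sup>/\<^sup>n g\<close> with \<open>g\<close> of quadratic character. After
  multiplication by powers of theta constants, \<open>g\<close> becomes an invariant function of weight \<open>0\<close>
  with poles only at the cusps, hence a polynomial in \<open>J\<close>, and so it has bounded denominators. If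
  \<open>F\<^sub>1\<close> had bounded denominators at \<open>p\<close> too, the root \<open>h = \<Prod>(1 + q\<^sup>m)\<^sup>2\<^sup>4\<^sup>j\<^sup>/\<^sup>n\<close> of an integral
  series would be a quotient of series with bounded denominators. Comparing the leading
  coefficients of \<open>d (h - 1)\<^sup>i\<close> for a common denominator \<open>d\<close> of all powers of \<open>h\<close> shows that then
  \<open>24 j / n\<close> is \<open>p\<close>-integral, which the hypothesis on \<open>p\<close> excludes. The other two components are
  treated in the same way at the cusp \<open>0\<close>.

  The transformation of \<open>\<eta>\<close> comes from Jacobi's product: by Liouville's theorem
  the products for \<open>\<tau>\<close> and \<open>-1/\<tau>\<close> are proportional up to a Gaussian factor, and the cube of the
  constant is the product of its values at the three half periods, where Euler's identity applies.
\<close>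

hide_const (open) Matrix.mat Matrix.vec Determinant.det 
no_notation Matrix.vec_index (infixl "$" 100)

section \<open>Algebraic integers\<close>

text \<open>The group Gamma_0(2) never appears. Its three cosets index the components, and every
  auxiliary function comes as a triple that S and T permute as \<rho> does, so only two generators
  are ever checked: index 1 sits at infinity, index 3 at the cusp 0, and index 2 is index 3 moved by
  T. The exponent j/n arises because the logarithm of the Hauptmodul grows by 2 pi i under T while
  the first component is multiplied by \<epsilon> times exp(2 pi i j/n). The obstacle is that the
  polynomial in the Hauptmodul comes out of a maximum principle, so its coefficients are arbitrary
  complex numbers. They are recovered afterwards: the root \<open>h\<close> has rational
  coefficients, so dividing the expansion of the form by \<open>h\<close> gives a triangular system
  for them over the ring where \<open>p\<close> is inverted. The valuation at a prime of all
  algebraic integers is not discrete; what replaces discreteness is that no nonzero number is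
  divisible by all powers of \<open>p\<close>. The bounds on \<open>n\<close> reflect 24 = 8 * 3:
  that \<open>p\<close> survives in the denominator of 24 j/n means one more factor \<open>p\<close>
  in \<open>n\<close> than in 24.\<close>

definition int_span :: "complex set \<Rightarrow> complex set" where
  "int_span B = range (\<lambda>c :: complex \<Rightarrow> int. \<Sum>b\<in>B. of_int (c b) * b)"

lemma int_span_0: "0 \<in> int_span B"
  unfolding int_span_def by (rule image_eqI[of _ _ "\<lambda>_. 0"]) auto

lemma int_span_add: "x \<in> int_span B \<Longrightarrow> y \<in> int_span B \<Longrightarrow> x + y \<in> int_span B"
  unfolding int_span_def
proof clarify
  fix c d :: "complex \<Rightarrow> int"
  show "(\<Sum>b\<in>B. of_int (c b) * b) + (\<Sum>b\<in>B. of_int (d b) * b) \<in> range (\<lambda>c. \<Sum>b\<in>B. of_int (c b) * b)"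
    by (rule image_eqI[of _ _ "\<lambda>b. c b + d b"]) (auto simp: algebra_simps sum.distrib)
qed

lemma int_span_of_int_mult: "x \<in> int_span B \<Longrightarrow> of_int k * x \<in> int_span B"
  unfolding int_span_def
proof clarify
  fix c :: "complex \<Rightarrow> int"
  show "of_int k * (\<Sum>b\<in>B. of_int (c b) * b) \<in> range (\<lambda>c. \<Sum>b\<in>B. of_int (c b) * b)"
    by (rule image_eqI[of _ _ "\<lambda>b. k * c b"]) (auto simp: algebra_simps sum_distrib_left)
qed

lemma int_span_minus: "x \<in> int_span B \<Longrightarrow> - x \<in> int_span B"
  using int_span_of_int_mult[of x B "-1"] by simp

lemma int_span_sum: "(\<And>i. i \<in> I \<Longrightarrow> f i \<in> int_span B) \<Longrightarrow> sum f I \<in> int_span B"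
  by (induction I rule: infinite_finite_induct) (auto intro: int_span_0 int_span_add)

lemma int_span_superset: "finite B \<Longrightarrow> b \<in> B \<Longrightarrow> b \<in> int_span B"
  unfolding int_span_def
  by (rule image_eqI[of _ _ "\<lambda>x. if x = b then 1 else 0"])
     (auto simp: if_distrib[of of_int] if_distrib[of "\<lambda>x. x * _"] sum.delta cong: if_cong)

lemma int_span_mult_closed:
  assumes "\<And>b. b \<in> B \<Longrightarrow> x * b \<in> int_span B" "y \<in> int_span B"
  shows "x * y \<in> int_span B"
proof -
  obtain c where y: "y = (\<Sum>b\<in>B. of_int (c b) * b)"
    using assms(2) by (auto simp: int_span_def)
  have "x * y = (\<Sum>b\<in>B. of_int (c b) * (x * b))"
    by (simp add: y sum_distrib_left mult_ac)
  then show ?thesis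
    using assms(1) by (auto intro!: int_span_sum int_span_of_int_mult)
qed

text \<open>Determinant trick: the integer matrix of multiplication by \<open>x\<close> on the
  generators has the list of generators as an eigenvector, so \<open>x\<close> is a root of its
  monic characteristic polynomial. The element \<open>b0\<close> guarantees that this vector is not
  zero.\<close>

lemma algebraic_int_if_int_span_stable:
  fixes x :: complex
  assumes fin: "finite B" and b0: "b0 \<in> B" "b0 \<noteq> 0"
    and stable: "\<And>b. b \<in> B \<Longrightarrow> x * b \<in> int_span B"
  shows "algebraic_int x"
proof -
  have "\<forall>b\<in>B. \<exists>c::complex \<Rightarrow> int. x * b = (\<Sum>b'\<in>B. of_int (c b') * b')"
    using stable by (auto simp: int_span_def)
  then obtain c :: "complex \<Rightarrow> complex \<Rightarrow> int"
    where c: "\<And>b. b \<in> B \<Longrightarrow> x * b = (\<Sum>b'\<in>B. of_int (c b b') * b')"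
    by metis
  obtain bs where bs: "set bs = B" "distinct bs"
    using finite_distinct_list[OF fin] by blast
  define n where "n = length bs"
  define A :: "int Matrix.mat" where "A = Matrix.mat n n (\<lambda>(i, j). c (bs ! i) (bs ! j))"
  define v :: "complex Matrix.vec" where "v = Matrix.vec n (\<lambda>i. bs ! i)"
  have A: "A \<in> carrier_mat n n"
    by (simp add: A_def)
  have sum_bs: "(\<Sum>b\<in>B. g b) = (\<Sum>j<n. g (bs ! j))" for g :: "complex \<Rightarrow> complex"
    using bs by (metis n_def sum.reindex_bij_betw bij_betw_nth)
  have "eigenvector (map_mat of_int A) v x"
    unfolding eigenvector_def
  proof (intro conjI)
    show "v \<in> carrier_vec (dim_row (map_mat of_int A))"
      by (simp add: v_def A_def)
    obtain i where i: "i < n" "bs ! i = b0"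
      using b0 bs by (metis in_set_conv_nth n_def)
    have "vec_index v i \<noteq> 0"
      using i b0 by (simp add: v_def)
    then show "v \<noteq> 0\<^sub>v (dim_row (map_mat of_int A))"
      using i by (auto simp: A_def)
    show "map_mat of_int A *\<^sub>v v = x \<cdot>\<^sub>v v"
    proof (rule eq_vecI)
      fix i assume "i < dim_vec (x \<cdot>\<^sub>v v)"
      then have i: "i < n" by (simp add: v_def)
      then have "bs ! i \<in> B"
        using bs by (auto simp: n_def)
      from c[OF this] i show "vec_index (map_mat of_int A *\<^sub>v v) i = vec_index (x \<cdot>\<^sub>v v) i"
        by (simp add: v_def A_def scalar_prod_def sum_bs atLeast0LessThan)
    qed (simp add: v_def A_def)
  qed
  then have "eigenvalue (map_mat of_int A) x"
    by (auto simp: eigenvalue_def)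
  then have "poly (char_poly (map_mat of_int A)) x = 0"
    using A by (subst (asm) eigenvalue_root_char_poly[of _ n]) auto
  then have "poly (map_poly of_int (char_poly A)) x = 0"
    by (simp add: of_int_hom.char_poly_hom[OF A])
  moreover have "lead_coeff (char_poly A) = 1"
    using degree_monic_char_poly[OF A] by simp
  ultimately show ?thesis
    unfolding algebraic_int_altdef_ipoly by blast
qed

text \<open>A monic equation of degree \<open>m\<close> rewrites the m-th power of \<open>x\<close>
  by lower ones. The extra factor \<open>y\<close> and the arbitrary \<open>B\<close> allow the
  rewriting inside mixed monomials in two algebraic integers.\<close>

lemma algebraic_int_power_int_span:
  fixes x :: complex
  assumes "algebraic_int x"
  obtains m where "m > 0" "\<And>B y. (\<And>i. i < m \<Longrightarrow> x ^ i * y \<in> int_span B) \<Longrightarrow> x ^ m * y \<in> int_span B"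
proof -
  obtain q where q: "poly (map_poly of_int q) x = 0" "lead_coeff q = 1"
    using assms unfolding algebraic_int_altdef_ipoly by blast
  define m where "m = degree q"
  have "m > 0"
  proof (rule ccontr)
    assume "\<not> m > 0"
    then obtain a where "q = [:a:]"
      unfolding m_def by (auto elim: degree_eq_zeroE)
    with q show False by auto
  qed
  moreover have "x ^ m * y \<in> int_span B" if "\<And>i. i < m \<Longrightarrow> x ^ i * y \<in> int_span B" for B y
  proof -
    have "0 = (\<Sum>i\<le>m. of_int (coeff q i) * x ^ i)"
      using q(1) by (simp add: poly_altdef m_def degree_map_poly coeff_map_poly)
    also have "\<dots> = x ^ m + (\<Sum>i<m. of_int (coeff q i) * x ^ i)"
      using q(2) by (simp add: m_def flip: lessThan_Suc_atMost)
    finally have "x ^ m = - (\<Sum>i<m. of_int (coeff q i) * x ^ i)"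
      by (simp add: eq_neg_iff_add_eq_0)
    then have "x ^ m * y = - (\<Sum>i<m. of_int (coeff q i) * (x ^ i * y))"
      by (simp add: sum_distrib_left sum_distrib_right mult_ac)
    then show ?thesis
      using that by (auto intro!: int_span_minus int_span_sum int_span_of_int_mult)
  qed
  ultimately show ?thesis using that by blast
qed

text \<open>The monomials in \<open>x\<close> and \<open>y\<close> below the degrees of their monic
  equations span a module stable under both, hence under sum and product. Closure of the algebraic
  integers under the ring operations rests on this one module.\<close>

lemma algebraic_ints_common_int_span:
  fixes x y :: complex
  assumes "algebraic_int x" "algebraic_int y"
  obtains B where "finite B" "1 \<in> B" "\<And>b. b \<in> B \<Longrightarrow> x * b \<in> int_span B" "\<And>b. b \<in> B \<Longrightarrow> y * b \<in> int_span B"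
proof -
  obtain m where m: "m > 0" "\<And>B y. (\<And>i. i < m \<Longrightarrow> x ^ i * y \<in> int_span B) \<Longrightarrow> x ^ m * y \<in> int_span B"
    using algebraic_int_power_int_span[OF assms(1)] by blast
  obtain n where n: "n > 0" "\<And>B x. (\<And>i. i < n \<Longrightarrow> y ^ i * x \<in> int_span B) \<Longrightarrow> y ^ n * x \<in> int_span B"
    using algebraic_int_power_int_span[OF assms(2)] by blast
  define B where "B = (\<lambda>(i, j). x ^ i * y ^ j) ` ({..<m} \<times> {..<n})"
  have fin: "finite B" by (simp add: B_def)
  have BI: "x ^ i * y ^ j \<in> int_span B" if "i < m" "j < n" for i j
    using that fin by (intro int_span_superset) (auto simp: B_def)
  have "x * b \<in> int_span B \<and> y * b \<in> int_span B" if b: "b \<in> B" for b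
  proof -
    obtain i j where ij: "i < m" "j < n" "b = x ^ i * y ^ j"
      using b by (auto simp: B_def)
    have "x ^ Suc i * y ^ j \<in> int_span B"
    proof (cases "Suc i = m")
      case True
      show ?thesis unfolding True
        by (rule m(2)) (use BI ij in auto)
    next
      case False
      then show ?thesis using BI[of "Suc i" j] ij by simp
    qed
    moreover have "y ^ Suc j * x ^ i \<in> int_span B"
    proof (cases "Suc j = n")
      case True
      show ?thesis unfolding True
        by (rule n(2)) (use BI ij in \<open>auto simp: mult.commute\<close>)
    next
      case False
      then show ?thesis using BI[of i "Suc j"] ij by (simp add: mult_ac)
    qed
    ultimately show ?thesis
      by (simp add: ij mult_ac)
  qed
  moreover have "1 \<in> B"
    unfolding B_def using m n by (intro image_eqI[of _ _ "(0, 0)"]) auto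
  ultimately show ?thesis using that[of B] fin by blast
qed

lemma algebraic_int_add [intro]:
  fixes x y :: complex
  assumes "algebraic_int x" "algebraic_int y"
  shows "algebraic_int (x + y)"
proof -
  obtain B where B: "finite B" "1 \<in> B" "\<And>b. b \<in> B \<Longrightarrow> x * b \<in> int_span B" "\<And>b. b \<in> B \<Longrightarrow> y * b \<in> int_span B"
    using algebraic_ints_common_int_span[OF assms] by blast
  show ?thesis
    by (rule algebraic_int_if_int_span_stable[of B 1]) (use B in \<open>auto simp: distrib_right intro: int_span_add\<close>)
qed

lemma algebraic_int_mult [intro]:
  fixes x y :: complex
  assumes "algebraic_int x" "algebraic_int y"
  shows "algebraic_int (x * y)"
proof -
  obtain B where B: "finite B" "1 \<in> B" "\<And>b. b \<in> B \<Longrightarrow> x * b \<in> int_span B" "\<And>b. b \<in> B \<Longrightarrow> y * b \<in> int_span B"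
    using algebraic_ints_common_int_span[OF assms] by blast
  have "(x * y) * b \<in> int_span B" if "b \<in> B" for b
    using int_span_mult_closed[OF B(3) B(4)[OF that]] by (simp add: mult_ac)
  then show ?thesis
    using algebraic_int_if_int_span_stable[of B 1] B by auto
qed

lemma algebraic_int_of_int [simp, intro]: "algebraic_int (of_int k :: complex)"
  by (simp add: int_imp_algebraic_int)

lemma algebraic_int_of_nat [simp, intro]: "algebraic_int (of_nat k :: complex)"
  by (simp add: int_imp_algebraic_int)

section \<open>The ring of all algebraic integers and its primes above \<open>p\<close>\<close>

lemma cring_algebraic_integers: "cring algebraic_integers"
proof (rule cringI)
  show "abelian_group algebraic_integers"
  proof (rule abelian_groupI)
    fix x assume "x \<in> carrier algebraic_integers"
    then show "\<exists>y\<in>carrier algebraic_integers. y \<oplus>\<^bsub>algebraic_integers\<^esub> x = \<zero>\<^bsub>algebraic_integers\<^esub>"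
      by (intro bexI[of _ "- x"]) (auto simp: algebraic_integers_def)
  qed (auto simp: algebraic_integers_def)
  show "comm_monoid algebraic_integers"
    by (rule comm_monoidI) (auto simp: algebraic_integers_def)
qed (auto simp: algebraic_integers_def algebra_simps)

text \<open>Ideals in elementary terms, without the record structure of the ring, so that Zorn's
  lemma can be run on plain sets of complex numbers.\<close>

definition algebraic_int_ideal :: "complex set \<Rightarrow> bool" where
  "algebraic_int_ideal I \<longleftrightarrow> (\<forall>x\<in>I. algebraic_int x) \<and> 0 \<in> I \<and> (\<forall>x\<in>I. \<forall>y\<in>I. x + y \<in> I)
     \<and> (\<forall>x\<in>I. \<forall>r. algebraic_int r \<longrightarrow> r * x \<in> I)"

lemma algebraic_int_ideal_imp_ideal:
  assumes "algebraic_int_ideal I"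
  shows "ideal I algebraic_integers"
proof -
  interpret R: cring algebraic_integers by (rule cring_algebraic_integers)
  have I: "\<And>x. x \<in> I \<Longrightarrow> algebraic_int x" "0 \<in> I" "\<And>x y. x \<in> I \<Longrightarrow> y \<in> I \<Longrightarrow> x + y \<in> I"
    "\<And>x r. x \<in> I \<Longrightarrow> algebraic_int r \<Longrightarrow> r * x \<in> I"
    using assms by (auto simp: algebraic_int_ideal_def)
  have minus: "- x \<in> I" if "x \<in> I" for x
    using I(4)[OF that, of "- 1"] by simp
  show ?thesis
  proof (rule idealI)
    show "ring algebraic_integers" by (rule R.ring_axioms)
    show "subgroup I (add_monoid algebraic_integers)"
    proof (rule group.subgroupI)
      show "Group.group (add_monoid algebraic_integers)"
        by (rule R.a_group)
      fix a assume a: "a \<in> I"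
      have "inv\<^bsub>add_monoid algebraic_integers\<^esub> a = - a"
        by (rule group.inv_equality[OF R.a_group])
           (use I minus a in \<open>auto simp: algebraic_integers_def\<close>)
      then show "inv\<^bsub>add_monoid algebraic_integers\<^esub> a \<in> I"
        using minus[OF a] by simp
    qed (use I in \<open>auto simp: algebraic_integers_def\<close>)
  qed (use I in \<open>auto simp: algebraic_integers_def mult.commute\<close>)
qed

text \<open>Zorn's lemma gives an ideal that is maximal among those containing \<open>p\<close> but
  not 1, and maximality makes it prime. The family is nonempty because 1/p is rational but not an
  integer, hence not an algebraic integer.\<close>

lemma prime_above_exists:
  assumes p: "prime p"
  obtains P where "prime_above p P"
proof -
  define \<A> where "\<A> = {I. algebraic_int_ideal I \<and> of_nat p \<in> I \<and> 1 \<notin> I}"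
  have "{of_nat p * r |r. algebraic_int r} \<in> \<A>"
  proof -
    have "1 \<noteq> of_nat p * r" if "algebraic_int r" for r :: complex
    proof
      assume eq: "1 = of_nat p * r"
      then have r: "r = 1 / of_nat p"
        using p by (auto simp: field_simps)
      then have "r \<in> \<int>"
        using rational_algebraic_int_is_int[OF that] by auto
      then obtain k where k: "r = of_int k" by (auto elim: Ints_cases)
      have "(of_int (int p * k) :: complex) = of_int 1"
        using eq unfolding k by simp
      then have "int p * k = 1" by (simp only: of_int_eq_iff)
      then have "int p dvd 1" by (metis dvd_triv_left)
      then show False using p by (metis dvd_1_iff_1 int_dvd_int_iff not_prime_1 of_nat_1 nat_dvd_1_iff_1)
    qed
    moreover have "algebraic_int_ideal {of_nat p * r |r. algebraic_int r}"
      unfolding algebraic_int_ideal_def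
    proof (intro conjI ballI allI impI)
      show "0 \<in> {of_nat p * r |r::complex. algebraic_int r}"
        by (auto intro: exI[of _ 0])
    next
      fix x y :: complex assume "x \<in> {of_nat p * r |r. algebraic_int r}" "y \<in> {of_nat p * r |r. algebraic_int r}"
      then show "x + y \<in> {of_nat p * r |r. algebraic_int r}"
        by (auto simp flip: distrib_left)
    next
      fix x r :: complex assume "x \<in> {of_nat p * r |r. algebraic_int r}" "algebraic_int r"
      then obtain t where "x = of_nat p * t" "algebraic_int t" by auto
      then show "r * x \<in> {of_nat p * r |r. algebraic_int r}"
        using \<open>algebraic_int r\<close> by (intro CollectI exI[of _ "r * t"]) auto
    qed auto
    ultimately show ?thesis
      unfolding \<A>_def by (auto intro: exI[of _ 1])
  qed
  then have "\<A> \<noteq> {}" by auto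
  moreover have "\<Union>C \<in> \<A>" if C: "C \<noteq> {}" "subset.chain \<A> C" for C
  proof -
    have CA: "\<And>I. I \<in> C \<Longrightarrow> I \<in> \<A>" and lin: "\<And>I J. I \<in> C \<Longrightarrow> J \<in> C \<Longrightarrow> I \<subseteq> J \<or> J \<subseteq> I"
      using C(2) by (auto simp: subset_chain_def)
    have "x + y \<in> \<Union>C" if "x \<in> \<Union>C" "y \<in> \<Union>C" for x y
    proof -
      obtain I J where "I \<in> C" "J \<in> C" "x \<in> I" "y \<in> J" using \<open>x \<in> \<Union>C\<close> \<open>y \<in> \<Union>C\<close> by auto
      then obtain K where "K \<in> C" "x \<in> K" "y \<in> K" using lin by blast
      then show ?thesis using CA[of K] by (auto simp: \<A>_def algebraic_int_ideal_def)
    qed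
    moreover have "0 \<in> \<Union>C" "of_nat p \<in> \<Union>C" "1 \<notin> \<Union>C" "\<forall>x\<in>\<Union>C. algebraic_int x"
      "\<forall>x\<in>\<Union>C. \<forall>r. algebraic_int r \<longrightarrow> r * x \<in> \<Union>C"
      using C(1) CA unfolding \<A>_def algebraic_int_ideal_def by blast+
    ultimately show ?thesis
      unfolding \<A>_def algebraic_int_ideal_def by blast
  qed
  ultimately obtain M where M: "M \<in> \<A>" and max: "\<And>X. X \<in> \<A> \<Longrightarrow> M \<subseteq> X \<Longrightarrow> X = M"
    using subset_Zorn_nonempty[of \<A>] by blast
  have Mi: "algebraic_int_ideal M" and pM: "of_nat p \<in> M" and 1: "1 \<notin> M"
    using M by (auto simp: \<A>_def)
  have Mint: "\<And>x. x \<in> M \<Longrightarrow> algebraic_int x" and M0: "0 \<in> M"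
    and Madd: "\<And>x y. x \<in> M \<Longrightarrow> y \<in> M \<Longrightarrow> x + y \<in> M"
    and Mmult: "\<And>x r. x \<in> M \<Longrightarrow> algebraic_int r \<Longrightarrow> r * x \<in> M"
    using Mi by (auto simp: algebraic_int_ideal_def)
  have prime_M: "b \<in> M" if a: "algebraic_int a" "a \<notin> M" and b: "algebraic_int b" and ab: "a * b \<in> M" for a b
  proof -
    \<comment> \<open>The ideal generated by \<open>M\<close> and \<open>a\<close>. Being strictly
      larger than \<open>M\<close>, it must contain 1; multiplying the resulting equation by
      \<open>b\<close> then puts \<open>b\<close> into \<open>M\<close>.\<close>
    define X where "X = {m + r * a |m r. m \<in> M \<and> algebraic_int r}"
    have XI: "m + r * a \<in> X" if "m \<in> M" "algebraic_int r" for m r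
      using that by (auto simp: X_def)
    have "algebraic_int_ideal X"
      unfolding algebraic_int_ideal_def
    proof (intro conjI ballI allI impI)
      show "0 \<in> X" using XI[OF M0, of 0] by simp
    next
      fix x assume "x \<in> X" then show "algebraic_int x"
        using Mint a by (auto simp: X_def)
    next
      fix x y assume "x \<in> X" "y \<in> X"
      then obtain m r m' r' where *: "x = m + r * a" "y = m' + r' * a" "m \<in> M" "m' \<in> M" "algebraic_int r" "algebraic_int r'"
        by (auto simp: X_def)
      have "(m + m') + (r + r') * a \<in> X"
        using * by (intro XI Madd) auto
      then show "x + y \<in> X" by (simp add: * algebra_simps)
    next
      fix x t :: complex assume "x \<in> X" and t: "algebraic_int t"
      then obtain m r where *: "x = m + r * a" "m \<in> M" "algebraic_int r"
        by (auto simp: X_def)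
      have "t * m + (t * r) * a \<in> X"
        using * t by (intro XI Mmult) auto
      then show "t * x \<in> X" by (simp add: * algebra_simps)
    qed
    moreover have MX: "M \<subseteq> X" using XI[of _ 0] by auto
    moreover have "a \<in> X" using XI[OF M0, of 1] by simp
    ultimately have "1 \<in> X"
      using max[of X] a(2) pM unfolding \<A>_def by blast
    then obtain m r where mr: "1 = m + r * a" "m \<in> M" "algebraic_int r"
      by (auto simp: X_def)
    have "b = b * m + r * (a * b)"
      using arg_cong[OF mr(1), of "\<lambda>x. b * x"] by (simp add: algebra_simps)
    moreover have "b * m + r * (a * b) \<in> M"
      using mr b ab by (intro Madd Mmult[of m b] Mmult[of "a * b" r]) auto
    ultimately show ?thesis by simp
  qed
  have "primeideal M algebraic_integers"
  proof (rule primeidealI[OF algebraic_int_ideal_imp_ideal[OF Mi] cring_algebraic_integers])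
    show "carrier algebraic_integers \<noteq> M"
      using 1 algebraic_int_of_int[of 1] by (auto simp: algebraic_integers_def)
  next
    fix a b assume "a \<in> carrier algebraic_integers" "b \<in> carrier algebraic_integers"
      "a \<otimes>\<^bsub>algebraic_integers\<^esub> b \<in> M"
    then show "a \<in> M \<or> b \<in> M"
      using prime_M[of a b] by (auto simp: algebraic_integers_def)
  qed
  \<comment> \<open>An integer in \<open>M\<close> prime to \<open>p\<close> would put 1 into
    \<open>M\<close> by Bezout, so \<open>M\<close> meets the integers exactly in the multiples of
    \<open>p\<close>.\<close>
  moreover have "int p dvd a" if "of_int a \<in> M" for a
  proof (rule ccontr)
    assume "\<not> int p dvd a"
    then have "Rings.coprime a (int p)"
      using p by (metis coprime_commute prime_imp_coprime prime_nat_int_transfer)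
    then obtain u v where "u * a + v * int p = 1"
      by (metis bezout_int coprime_imp_gcd_eq_1)
    then have "(1 :: complex) = of_int u * of_int a + of_int v * of_nat p"
      by (metis of_int_1 of_int_add of_int_mult of_int_of_nat_eq)
    also have "\<dots> \<in> M"
      using that pM by (intro Madd Mmult) auto
    finally show False using 1 by simp
  qed
  moreover have "of_int a \<in> M" if a: "int p dvd a" for a
  proof -
    obtain k where "a = int p * k" using a by (auto elim: dvdE)
    then have "(of_int a :: complex) = of_int k * of_nat p" by simp
    then show ?thesis using Mmult[OF pM, of "of_int k"] by simp
  qed
  ultimately have "prime_above p M"
    unfolding prime_above_def by auto
  then show ?thesis using that by blast
qed

section \<open>Power series with bounded denominators\<close>

text \<open>The predicate \<open>p_integral\<close> of this locale plays the part of a valuation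
  ring over the p-adic one: it is closed under the ring operations, inverts the integers prime to
  \<open>p\<close> and excludes 1/p.\<close>

locale prime_over =
  fixes p :: nat and P :: "complex set"
  assumes prime_p: "prime p" and prime_above: "prime_above p P"
begin

lemma p_nonzero [simp]: "p \<noteq> 0"
  using prime_p by auto

lemma P_integral: "x \<in> P \<Longrightarrow> algebraic_int x"
  and P_mult: "x \<in> P \<Longrightarrow> algebraic_int r \<Longrightarrow> r * x \<in> P"
  and P_prime: "algebraic_int a \<Longrightarrow> algebraic_int b \<Longrightarrow> a * b \<in> P \<Longrightarrow> a \<in> P \<or> b \<in> P"
  and P_ne: "1 \<notin> P"
proof -
  interpret I: primeideal P algebraic_integers
    using prime_above by (simp add: prime_above_def)
  show "x \<in> P \<Longrightarrow> algebraic_int x"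
    using I.a_subset by (auto simp: algebraic_integers_def)
  show *: "x \<in> P \<Longrightarrow> algebraic_int r \<Longrightarrow> r * x \<in> P" for r x
    using I.I_l_closed[of x r] by (auto simp: algebraic_integers_def)
  show "algebraic_int a \<Longrightarrow> algebraic_int b \<Longrightarrow> a * b \<in> P \<Longrightarrow> a \<in> P \<or> b \<in> P"
    using I.I_prime[of a b] by (auto simp: algebraic_integers_def)
  show "1 \<notin> P"
  proof
    assume "1 \<in> P"
    then have "algebraic_int r \<Longrightarrow> r \<in> P" for r
      using *[of 1 r] by simp
    then have "carrier algebraic_integers = P"
      using I.a_subset by (auto simp: algebraic_integers_def)
    then show False using I.I_notcarr by blast
  qed
qed

lemma of_int_in_P_iff: "of_int a \<in> P \<longleftrightarrow> int p dvd a"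
  using prime_above by (auto simp: prime_above_def)

abbreviation p_integral :: "complex \<Rightarrow> bool" where
  "p_integral \<equiv> integral_at P"

lemma integral_algebraic_int: "algebraic_int x \<Longrightarrow> p_integral x"
  unfolding integral_at_def using P_ne by (intro exI[of _ 1]) auto

lemma integral_of_int [simp, intro]: "p_integral (of_int a)"
  by (rule integral_algebraic_int) auto

lemma integral_of_nat [simp, intro]: "p_integral (of_nat a)"
  by (rule integral_algebraic_int) auto

lemma integral_0 [simp, intro]: "p_integral 0" and integral_1 [simp, intro]: "p_integral 1"
  using integral_of_int[of 0] integral_of_int[of 1] by auto

lemma integral_mult [intro]:
  assumes "p_integral x" "p_integral y"
  shows "p_integral (x * y)"
proof -
  obtain s t where st: "algebraic_int s" "s \<notin> P" "algebraic_int (s * x)" "algebraic_int t" "t \<notin> P" "algebraic_int (t * y)"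
    using assms by (auto simp: integral_at_def)
  have "algebraic_int ((s * x) * (t * y))" using st by blast
  moreover have "s * t \<notin> P" using st P_prime by blast
  ultimately show ?thesis
    unfolding integral_at_def using st by (intro exI[of _ "s * t"]) (auto simp: mult_ac)
qed

lemma integral_add [intro]:
  assumes "p_integral x" "p_integral y"
  shows "p_integral (x + y)"
proof -
  obtain s t where st: "algebraic_int s" "s \<notin> P" "algebraic_int (s * x)" "algebraic_int t" "t \<notin> P" "algebraic_int (t * y)"
    using assms by (auto simp: integral_at_def)
  have "algebraic_int (t * (s * x) + s * (t * y))" using st by blast
  moreover have "s * t \<notin> P" using st P_prime by blast
  ultimately show ?thesis
    unfolding integral_at_def using st by (intro exI[of _ "s * t"]) (auto simp: algebra_simps)
qed

lemma integral_minus [intro]: "p_integral x \<Longrightarrow> p_integral (- x)"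
  using integral_mult[OF integral_of_int[of "-1"], of x] by simp

lemma integral_diff [intro]: "p_integral x \<Longrightarrow> p_integral y \<Longrightarrow> p_integral (x - y)"
  using integral_add[of x "- y"] by auto

lemma integral_sum [intro]: "(\<And>i. i \<in> I \<Longrightarrow> p_integral (f i)) \<Longrightarrow> p_integral (sum f I)"
  by (induction I rule: infinite_finite_induct) auto

lemma integral_power [intro]: "p_integral x \<Longrightarrow> p_integral (x ^ k)"
  by (induction k) auto

lemma integral_Ints: "x \<in> \<int> \<Longrightarrow> p_integral x"
  by (auto elim!: Ints_cases)

lemma integral_inverse_of_int:
  assumes "\<not> int p dvd a"
  shows "p_integral (inverse (of_int a))"
proof -
  have "a \<noteq> 0" using assms by auto
  then show ?thesis
    unfolding integral_at_def using assms of_int_in_P_iff[of a]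
    by (intro exI[of _ "of_int a"]) auto
qed

lemma not_integral_inverse_p: "\<not> p_integral (inverse (of_nat p))"
proof
  assume "p_integral (inverse (of_nat p))"
  then obtain s where s: "algebraic_int s" "s \<notin> P" "algebraic_int (s * inverse (of_nat p))"
    by (auto simp: integral_at_def)
  have "of_nat p \<in> P" using of_int_in_P_iff[of "int p"] by simp
  from P_mult[OF this s(3)] s(2) show False by (simp add: mult.assoc)
qed

text \<open>Cancelling the power of X at the low end of a polynomial keeps its nonzero roots. The
  nonzero constant term then does the work of a norm, without a number field.\<close>

lemma algebraic_int_root_of_nonzero_const:
  fixes x :: complex
  assumes "x \<noteq> 0" "algebraic_int x"
  obtains q where "poly (map_poly of_int q) x = 0" "coeff q 0 \<noteq> 0"
proof -
  have "\<exists>q'. poly (map_poly of_int q') x = 0 \<and> coeff q' 0 \<noteq> 0"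
    if "q \<noteq> 0" "poly (map_poly of_int q) x = 0" for q :: "int poly"
    using that
  proof (induction q)
    case (pCons a q)
    show ?case
    proof (cases "a = 0")
      case True
      then have "q \<noteq> 0" "poly (map_poly of_int q) x = 0"
        using pCons.prems assms(1) by (auto simp: map_poly_pCons)
      then show ?thesis using pCons.IH by blast
    next
      case False
      then show ?thesis using pCons.prems by (intro exI[of _ "pCons a q"]) auto
    qed
  qed auto
  moreover obtain q where "poly (map_poly of_int q) x = 0" "lead_coeff q = (1::int)"
    using assms(2) unfolding algebraic_int_altdef_ipoly by blast
  moreover from this have "q \<noteq> 0" by auto
  ultimately show ?thesis using that by blast
qed

text \<open>By a polynomial equation for \<open>s * d\<close>, its constant term \<open>a\<close> is
  a p-integral multiple of \<open>d\<close>. If \<open>d\<close> were nonzero, the nonzero integer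
  \<open>a\<close> would therefore be infinitely divisible by \<open>p\<close> as well, and removing
  the exact power of \<open>p\<close> from \<open>a\<close> would make 1/p integral.\<close>

lemma integral_all_quotients_imp_0:
  assumes "\<And>i. p_integral (d / of_nat p ^ i)"
  shows "d = 0"
proof (rule ccontr)
  assume d: "d \<noteq> 0"
  obtain s where s: "algebraic_int s" "s \<notin> P" "algebraic_int (s * d)"
    using assms[of 0] by (auto simp: integral_at_def)
  have "0 \<in> P" using of_int_in_P_iff[of 0] by simp
  with s have "s \<noteq> 0" by auto
  obtain q where q: "poly (map_poly of_int q) (s * d) = 0" "coeff q 0 \<noteq> 0"
    using algebraic_int_root_of_nonzero_const[of "s * d"] d \<open>s \<noteq> 0\<close> s by auto
  obtain a q' where aq: "q = pCons a q'" by (cases q)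
  define E where "E = poly (map_poly of_int q') (s * d)"
  have E: "p_integral E"
    unfolding E_def poly_altdef
    by (intro integral_sum integral_mult integral_power[OF integral_algebraic_int[OF s(3)]]) (auto simp: coeff_map_poly)
  have a0: "a \<noteq> 0" using q aq by simp
  have "map_poly of_int q = pCons (of_int a :: complex) (map_poly of_int q')"
    by (rule poly_eqI) (simp add: aq coeff_map_poly coeff_pCons split: nat.splits)
  then have "of_int a + s * d * E = 0"
    using q(1) by (simp add: E_def)
  then have a: "of_int a = - (s * d * E)"
    by (simp add: eq_neg_iff_add_eq_0)
  have quot: "p_integral (of_int a / of_nat p ^ i)" for i
  proof -
    have "p_integral (- (s * (d / of_nat p ^ i) * E))"
      using s E assms by (intro integral_minus integral_mult) (auto intro: integral_algebraic_int)
    then show ?thesis by (simp add: a)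
  qed
  define e where "e = multiplicity (int p) a"
  obtain b where b: "a = int p ^ e * b" "\<not> int p dvd b"
    using multiplicity_decompose'[of a "int p"] a0 prime_p unfolding e_def
    by (metis not_prime_unit prime_nat_int_transfer)
  have "b \<noteq> 0" using b by auto
  have "p_integral (of_int a / of_nat p ^ Suc e * inverse (of_int b))"
    using quot integral_inverse_of_int[OF b(2)] by blast
  also have "of_int a / of_nat p ^ Suc e * inverse (of_int b) = inverse (of_nat p :: complex)"
    using \<open>b \<noteq> 0\<close> by (simp add: b field_simps)
  finally show False using not_integral_inverse_p by simp
qed

text \<open>The localisation at \<open>P\<close> with \<open>p\<close> inverted, a ring that
  contains the rationals. The coefficients of the polynomial in the Hauptmodul arise as arbitrary
  complex numbers, and this is the property established for them one at a time.\<close>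

definition integral_frac :: "complex \<Rightarrow> bool" where
  "integral_frac x \<longleftrightarrow> (\<exists>N. p_integral (of_nat p ^ N * x))"

lemma integral_of_nat_power_mult:
  assumes "p_integral (of_nat p ^ N * x)" "N \<le> M"
  shows "p_integral (of_nat p ^ M * x)"
proof -
  have "p_integral (of_nat p ^ (M - N) * (of_nat p ^ N * x))"
    by (intro integral_mult[OF integral_power assms(1)]) auto
  also have "of_nat p ^ (M - N) * (of_nat p ^ N * x) = of_nat p ^ M * x"
    using assms(2) by (simp add: mult.assoc[symmetric] flip: power_add)
  finally show ?thesis .
qed

lemma integral_fracI: "p_integral x \<Longrightarrow> integral_frac x"
  unfolding integral_frac_def by (intro exI[of _ 0]) auto

lemma integral_frac_add [intro]: "integral_frac x \<Longrightarrow> integral_frac y \<Longrightarrow> integral_frac (x + y)"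
  unfolding integral_frac_def
proof clarify
  fix M N assume "p_integral (of_nat p ^ M * x)" "p_integral (of_nat p ^ N * y)"
  then have "p_integral (of_nat p ^ (M + N) * x)" "p_integral (of_nat p ^ (M + N) * y)"
    by (auto elim: integral_of_nat_power_mult)
  then show "\<exists>N. p_integral (of_nat p ^ N * (x + y))"
    by (intro exI[of _ "M + N"]) (auto simp: distrib_left)
qed

lemma integral_frac_mult [intro]: "integral_frac x \<Longrightarrow> integral_frac y \<Longrightarrow> integral_frac (x * y)"
  unfolding integral_frac_def
proof clarify
  fix M N assume "p_integral (of_nat p ^ M * x)" "p_integral (of_nat p ^ N * y)"
  then have "p_integral ((of_nat p ^ M * x) * (of_nat p ^ N * y))" by blast
  then show "\<exists>N. p_integral (of_nat p ^ N * (x * y))"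
    by (intro exI[of _ "M + N"]) (auto simp: power_add mult_ac)
qed

lemma integral_frac_sum [intro]: "(\<And>i. i \<in> I \<Longrightarrow> integral_frac (f i)) \<Longrightarrow> integral_frac (sum f I)"
  by (induction I rule: infinite_finite_induct) (auto intro: integral_fracI)

lemma integral_frac_Rats:
  assumes "x \<in> \<rat>"
  shows "integral_frac x"
proof -
  obtain a b where ab: "b > 0" "x = of_int a / of_int b"
    using assms by (auto elim: Rats_cases')
  define e where "e = multiplicity (int p) b"
  obtain c where c: "b = int p ^ e * c" "\<not> int p dvd c"
    using multiplicity_decompose'[of b "int p"] ab prime_p unfolding e_def
    by (metis not_prime_unit prime_nat_int_transfer less_irrefl)
  have "of_nat p ^ e * x = of_int a * inverse (of_int c)"
    using ab by (simp add: c field_simps)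
  then show ?thesis
    unfolding integral_frac_def using integral_inverse_of_int[OF c(2)]
    by (intro exI[of _ e]) auto
qed

lemma integral_frac_minus [intro]: "integral_frac x \<Longrightarrow> integral_frac (- x)"
  using integral_frac_mult[of "-1" x] by (auto intro: integral_fracI)

lemma integral_frac_diff [intro]: "integral_frac x \<Longrightarrow> integral_frac y \<Longrightarrow> integral_frac (x - y)"
  using integral_frac_add[of x "- y"] by auto

text \<open>One power of \<open>p\<close> serves all coefficients, in contrast to
  \<open>integral_frac\<close> for each coefficient separately; closing this gap for
  \<open>B\<close> is the purpose of the triangular argument below.\<close>

definition bounded_denominators :: "complex fps \<Rightarrow> bool" where
  "bounded_denominators f \<longleftrightarrow> (\<exists>N. \<forall>m. p_integral (of_nat p ^ N * fps_nth f m))"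

lemma bounded_denominators_mult [intro]:
  assumes "bounded_denominators f" "bounded_denominators g"
  shows "bounded_denominators (f * g)"
proof -
  obtain M N where MN: "\<And>m. p_integral (of_nat p ^ M * fps_nth f m)" "\<And>m. p_integral (of_nat p ^ N * fps_nth g m)"
    using assms by (auto simp: bounded_denominators_def)
  have "p_integral (of_nat p ^ (M + N) * fps_nth (f * g) m)" for m
  proof -
    have "of_nat p ^ (M + N) * fps_nth (f * g) m
      = (\<Sum>i=0..m. (of_nat p ^ M * fps_nth f i) * (of_nat p ^ N * fps_nth g (m - i)))"
      by (simp add: fps_mult_nth sum_distrib_left power_add mult_ac)
    also have "p_integral \<dots>" using MN by blast
    finally show ?thesis .
  qed
  then show ?thesis by (auto simp: bounded_denominators_def)
qed

lemma bounded_denominators_add [intro]: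
  assumes "bounded_denominators f" "bounded_denominators g"
  shows "bounded_denominators (f + g)"
proof -
  obtain M N where "\<And>m. p_integral (of_nat p ^ M * fps_nth f m)" "\<And>m. p_integral (of_nat p ^ N * fps_nth g m)"
    using assms by (auto simp: bounded_denominators_def)
  then have "p_integral (of_nat p ^ (M + N) * fps_nth f m)" "p_integral (of_nat p ^ (M + N) * fps_nth g m)" for m
    by (auto intro: integral_of_nat_power_mult[where M = "M + N" and N = M]
        integral_of_nat_power_mult[where M = "M + N" and N = N])
  then show ?thesis
    unfolding bounded_denominators_def by (intro exI[of _ "M + N"]) (auto simp: distrib_left)
qed

lemma bounded_denominators_Ints: "(\<And>m. fps_nth f m \<in> \<int>) \<Longrightarrow> bounded_denominators f"
  unfolding bounded_denominators_def by (intro exI[of _ 0]) (auto intro: integral_Ints)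

lemma bounded_denominators_power [intro]: "bounded_denominators f \<Longrightarrow> bounded_denominators (f ^ k)"
  by (induction k) (auto intro: bounded_denominators_Ints)

lemma bounded_denominators_sum [intro]:
  "(\<And>i. i \<in> I \<Longrightarrow> bounded_denominators (f i)) \<Longrightarrow> bounded_denominators (sum f I)"
  by (induction I rule: infinite_finite_induct) (auto intro: bounded_denominators_Ints)

lemma bounded_denominators_const: "integral_frac a \<Longrightarrow> bounded_denominators (fps_const a)"
  unfolding bounded_denominators_def integral_frac_def by (auto simp: if_distrib cong: if_cong)

end

section \<open>Coefficients of products, inverses and roots of power series\<close>

lemma fps_nth_Ints_mult:
  "(\<And>m. fps_nth f m \<in> \<int>) \<Longrightarrow> (\<And>m. fps_nth g m \<in> \<int>) \<Longrightarrow> fps_nth (f * g) m \<in> \<int>"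
  by (auto simp: fps_mult_nth)

lemma fps_nth_Ints_power: "(\<And>m. fps_nth f m \<in> \<int>) \<Longrightarrow> fps_nth (f ^ k) m \<in> (\<int> :: complex set)"
  by (induction k arbitrary: m) (auto intro: fps_nth_Ints_mult)

text \<open>\<open>R\<close> stands for any subring: it is the integers for inverses of integral
  products and the rationals for the inverse of the root \<open>h\<close>.\<close>

lemma fps_inverse_nth_closed:
  fixes f :: "complex fps"
  assumes f: "fps_nth f 0 = 1" "\<And>m. fps_nth f m \<in> R"
    and R: "1 \<in> R" "\<And>x. x \<in> R \<Longrightarrow> - x \<in> R" "\<And>x y. x \<in> R \<Longrightarrow> y \<in> R \<Longrightarrow> x * y \<in> R"
      "\<And>g I. (\<And>i. i \<in> I \<Longrightarrow> g i \<in> R) \<Longrightarrow> sum g (I :: nat set) \<in> R"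
  shows "fps_nth (inverse f) m \<in> R"
proof (induction m rule: less_induct)
  case (less m)
  show ?case
  proof (cases m)
    case 0 then show ?thesis using f R(1) by simp
  next
    case (Suc l)
    have "0 = fps_nth (f * inverse f) m" using Suc f(1) by (simp add: inverse_mult_eq_1')
    also have "\<dots> = fps_nth (inverse f) m + (\<Sum>i=1..m. fps_nth f i * fps_nth (inverse f) (m - i))"
      using f(1) by (simp add: fps_mult_nth sum.atLeast_Suc_atMost)
    finally have eq: "fps_nth (inverse f) m = - (\<Sum>i=1..m. fps_nth f i * fps_nth (inverse f) (m - i))"
      by (simp add: eq_neg_iff_add_eq_0)
    show ?thesis
      unfolding eq by (intro R(2,3,4) f(2) less.IH) (use Suc in auto)
  qed
qed

text \<open>Differentiating \<open>h ^ n = u\<close> and multiplying by \<open>h\<close> gives the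
  linear equation u' h = n h' u, which determines the coefficients of \<open>h\<close> recursively
  with divisions by positive integers only.\<close>

lemma fps_root_nth_Rats:
  fixes h u :: "complex fps"
  assumes "h ^ n = u" "n > 0" "fps_nth h 0 = 1" "\<And>m. fps_nth u m \<in> \<rat>"
  shows "fps_nth h m \<in> \<rat>"
proof -
  have u0: "fps_nth u 0 = 1"
    using assms(1,3) by (auto simp: fps_power_zeroth)
  have "fps_deriv u * h = of_nat n * fps_deriv h * u"
  proof -
    have "fps_deriv u = of_nat n * fps_deriv h * h ^ (n - 1)"
      by (simp add: assms(1)[symmetric] fps_deriv_power fps_of_nat)
    moreover have "h ^ (n - 1) * h = u"
      using assms(1,2) by (metis mult.commute power_eq_if not_gr_zero)
    ultimately show ?thesis by (simp add: mult.assoc)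
  qed
  then have "fps_nth (fps_deriv u * h) k = of_nat n * fps_nth (fps_deriv h * u) k" for k
    by (simp only: mult.assoc fps_of_nat[symmetric] fps_mult_left_const_nth)
  then have ode: "(\<Sum>i=0..k. fps_nth (fps_deriv u) i * fps_nth h (k - i))
      = of_nat n * (\<Sum>i=0..k. fps_nth (fps_deriv h) i * fps_nth u (k - i))" for k
    by (simp only: fps_mult_nth)
  show ?thesis
  proof (induction m rule: less_induct)
    case (less m)
    show ?case
    proof (cases m)
      case 0
      then show ?thesis using assms(3) by simp
    next
      case (Suc k)
      \<comment> \<open>The term with i = k is split off from the right-hand sum: it holds the new
        coefficient of \<open>h\<close>, multiplied by the constant term 1 of
        \<open>u\<close>.\<close>
      have "of_nat n * of_nat (Suc k) * fps_nth h (Suc k)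
        = (\<Sum>i=0..k. fps_nth (fps_deriv u) i * fps_nth h (k - i))
          - of_nat n * (\<Sum>i=0..<k. fps_nth (fps_deriv h) i * fps_nth u (k - i))"
        unfolding ode by (simp add: sum.last_plus u0 algebra_simps atLeastLessThanSuc_atLeastAtMost flip: sum.op_ivl_Suc)
      also have "\<dots> \<in> \<rat>"
        using less assms(4) Suc by (intro Rats_diff Rats_mult Rats_sum) (auto intro!: Rats_mult Rats_add)
      finally have "of_nat n * of_nat (Suc k) * fps_nth h (Suc k) \<in> \<rat>" .
      then have "of_nat n * of_nat (Suc k) * fps_nth h (Suc k) / (of_nat n * of_nat (Suc k)) \<in> \<rat>"
        by (intro Rats_divide) (auto intro!: Rats_mult simp del: of_nat_Suc)
      then show ?thesis using assms(2) Suc by (simp del: of_nat_Suc)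
    qed
  qed
qed

context prime_over
begin

text \<open>The coefficient of \<open>B\<close> at exponent t + e i contains \<open>a i\<close> with
  factor 1 and otherwise only earlier ones with integer factors, so forward substitution gives each
  \<open>a i\<close>. As there are finitely many of them and the \<open>v i\<close> are integral,
  separate denominators turn into a common bound.\<close>

lemma bounded_denominators_triangular:
  assumes B: "B = (\<Sum>i\<le>D. fps_const (a i) * fps_X ^ (t + e * i) * v i)" and "e > 0"
    and v: "\<And>i m. fps_nth (v i) m \<in> \<int>" "\<And>i. fps_nth (v i) 0 = 1"
    and Bfrac: "\<And>m. integral_frac (fps_nth B m)"
  shows "bounded_denominators B"
proof -
  have "integral_frac (a i)" if "i \<le> D" for i
    using that
  proof (induction i rule: less_induct)
    case (less i)
    have "fps_nth B (t + e * i) = (\<Sum>k\<le>D. if k \<le> i then a k * fps_nth (v k) (e * i - e * k) else 0)"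
      unfolding B fps_sum_nth
      using \<open>e > 0\<close> by (intro sum.cong) (auto simp: mult.assoc fps_X_power_mult_nth)
    also have "\<dots> = (\<Sum>k\<in>insert i {..<i}. a k * fps_nth (v k) (e * i - e * k))"
      using less.prems by (intro sum.mono_neutral_cong_right) auto
    also have "\<dots> = a i + (\<Sum>k<i. a k * fps_nth (v k) (e * i - e * k))"
      by (simp add: v)
    finally have "a i = fps_nth B (t + e * i) - (\<Sum>k<i. a k * fps_nth (v k) (e * i - e * k))"
      by simp
    moreover have "integral_frac \<dots>"
      using less v by (intro integral_frac_diff Bfrac integral_frac_sum integral_frac_mult)
        (auto intro: integral_fracI[OF integral_Ints[OF v(1)]])
    ultimately show ?case by simp
  qed
  then show ?thesis
    unfolding B using v
    by (intro bounded_denominators_sum bounded_denominators_mult bounded_denominators_const)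
       (auto intro!: bounded_denominators_Ints fps_nth_Ints_power)
qed

text \<open>The ring of power series with coefficients in a valuation ring is completely integrally
  closed: if a root \<open>h\<close> of an integral series is a quotient of series with bounded denominators,
  then all powers of \<open>h - 1\<close> have a common denominator, and so its leading coefficient is
  \<open>p\<close>-integral.\<close>

lemma not_bounded_denominators_root:
  fixes f A h u g B :: "complex fps" and c \<alpha> k :: int
  assumes bounded: "bounded_denominators f" "bounded_denominators A" "bounded_denominators B"
    and eq: "f * A = h * B" and "B \<noteq> 0"
    and h: "h ^ n = u" "n > 0" "fps_nth h 0 = 1"
    and u: "\<And>m. fps_nth u m \<in> \<int>" "u = 1 + fps_X ^ s * g" "fps_nth g 0 = of_int c"
    and c: "k * c * int p = \<alpha> * int n" "\<not> int p dvd \<alpha>"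
  shows False
proof -
  \<comment> \<open>As \<open>h\<close> is f A / B, the n-th power of \<open>B\<close> clears the
    denominator of all powers of \<open>h\<close> below \<open>n\<close>; higher powers reduce to
    these because h^n = u is integral.\<close>
  define d where "d = B ^ n"
  have "d \<noteq> 0" using \<open>B \<noteq> 0\<close> by (simp add: d_def)
  have "\<exists>N. \<forall>m. p_integral (of_nat p ^ N * fps_nth (d * h ^ t) m)" if "t < n" for t
  proof -
    have "d * h ^ t = (f * A) ^ t * B ^ (n - t)"
    proof -
      have "B ^ n = B ^ t * B ^ (n - t)" using that by (simp flip: power_add)
      then show ?thesis unfolding eq d_def power_mult_distrib by (simp only: mult_ac)
    qed
    moreover have "bounded_denominators \<dots>"
      using bounded by blast
    ultimately show ?thesis by (simp add: bounded_denominators_def)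
  qed
  then obtain M where M: "\<And>t m. t < n \<Longrightarrow> p_integral (of_nat p ^ M t * fps_nth (d * h ^ t) m)"
    by metis
  define N where "N = (\<Sum>t<n. M t)"
  have N: "p_integral (of_nat p ^ N * fps_nth (d * h ^ t) m)" if "t < n" for t m
    using that by (intro integral_of_nat_power_mult[OF M[OF that]]) (auto simp: N_def intro!: member_le_sum)
  have powers: "p_integral (of_nat p ^ N * fps_nth (d * h ^ i) m)" for i m
  proof -
    \<comment> \<open>The factor \<open>d - d + 1\<close> is just 1; the content is division of the
      exponent \<open>i\<close> by \<open>n\<close> with remainder.\<close>
    have "h ^ i = (d - d + 1) * h ^ (i mod n) * u ^ (i div n)"
      by (simp flip: h(1) power_mult power_add)
    then have "of_nat p ^ N * fps_nth (d * h ^ i) m = of_nat p ^ N * fps_nth (d * h ^ (i mod n) * u ^ (i div n)) m"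
      by (simp add: mult.assoc)
    also have "\<dots> = (\<Sum>l=0..m. (of_nat p ^ N * fps_nth (d * h ^ (i mod n)) l) * fps_nth (u ^ (i div n)) (m - l))"
      unfolding fps_mult_nth[of "d * h ^ (i mod n)" "u ^ (i div n)"] sum_distrib_left by (simp only: mult.assoc)
    also have "p_integral \<dots>"
      by (intro integral_sum N integral_mult integral_Ints[OF fps_nth_Ints_power]) (use h(2) u(1) in auto)
    finally show ?thesis .
  qed
  have "p_integral (of_nat p ^ N * fps_nth (d * h ^ i * (h - 1) ^ j) m)" for i j m
  proof (induction j arbitrary: i m)
    case (Suc j)
    have "of_nat p ^ N * fps_nth (d * h ^ i * (h - 1) ^ Suc j) m
      = of_nat p ^ N * fps_nth (d * h ^ Suc i * (h - 1) ^ j) m - of_nat p ^ N * fps_nth (d * h ^ i * (h - 1) ^ j) m"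
      by (simp add: algebra_simps)
    then show ?case
      using integral_diff[OF Suc.IH[of "Suc i" m] Suc.IH[of i m]] by (simp only:)
  qed (use powers in simp)
  from this[of 0] have bound: "p_integral (of_nat p ^ N * fps_nth (d * (h - 1) ^ j) m)" for j m
    by simp
  \<comment> \<open>Since u - 1 = (h - 1) w and w has constant term \<open>n\<close>, the series h -
    1 starts with c/n at exponent \<open>s\<close>.\<close>
  define w where "w = (\<Sum>i<n. h ^ i)"
  have "u - 1 = (h - 1) * w"
    unfolding w_def h(1)[symmetric] by (rule power_diff_1_eq)
  moreover have w0: "fps_nth w 0 = of_nat n"
    using h(3) by (simp add: w_def fps_sum_nth fps_power_zeroth)
  ultimately have "(h - 1) * w * inverse w = fps_X ^ s * g * inverse w"
    using u(2) by simp
  then have h1: "h - 1 = fps_X ^ s * (g * inverse w)"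
    using w0 h(2) by (simp add: mult.assoc inverse_mult_eq_1')
  define r where "r = fps_nth (g * inverse w) 0"
  have r: "r = of_int c / of_nat n"
    using w0 h(2) u(3) by (simp add: r_def field_simps)
  define d' where "d' = unit_factor d"
  have d': "d = fps_X ^ subdegree d * d'" "fps_nth d' 0 \<noteq> 0"
    using \<open>d \<noteq> 0\<close> subdegree_decompose[of d] by (simp_all add: d'_def mult.commute)
  define d0 where "d0 = of_nat p ^ N * fps_nth d' 0"
  have int1: "p_integral (d0 * r ^ j)" for j
  proof -
    have "(h - 1) ^ j = fps_X ^ (s * j) * (g * inverse w) ^ j"
      unfolding h1 by (simp only: power_mult_distrib[of "fps_X ^ s"] power_mult)
    then have "d * (h - 1) ^ j = fps_X ^ (subdegree d + s * j) * (d' * (g * inverse w) ^ j)"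
      by (subst d'(1)) (simp only: power_add ac_simps)
    then have "fps_nth (d * (h - 1) ^ j) (subdegree d + s * j) = fps_nth d' 0 * r ^ j"
      by (simp add: fps_X_power_mult_nth r_def fps_power_zeroth)
    then show ?thesis using bound[of j "subdegree d + s * j"] by (simp add: d0_def mult_ac)
  qed
  have "\<alpha> \<noteq> 0" using c by auto
  \<comment> \<open>The quotient k / \<alpha> is p-integral and turns r = c/n into 1/p. Integrality
    of d0 r^j for all j thus becomes integrality of d0 / p^j for all j, which is impossible unless
    \<open>d0\<close> is 0.\<close>
  have kr: "of_int k * r * inverse (of_int \<alpha>) = inverse (of_nat p)"
  proof -
    have "of_int k * of_int c * of_nat p = (of_int \<alpha> * of_nat n :: complex)"
      using arg_cong[OF c(1), of of_int] by simp
    then show ?thesis using h(2) \<open>\<alpha> \<noteq> 0\<close> by (simp add: r field_simps)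
  qed
  have "p_integral (d0 / of_nat p ^ j)" for j
  proof -
    have "p_integral ((d0 * r ^ j) * (of_int k * inverse (of_int \<alpha>)) ^ j)"
      using int1 integral_inverse_of_int[OF c(2)] by blast
    also have "(d0 * r ^ j) * (of_int k * inverse (of_int \<alpha>)) ^ j = d0 * (of_int k * r * inverse (of_int \<alpha>)) ^ j"
      by (simp add: power_mult_distrib mult_ac)
    finally show ?thesis by (simp only: kr power_inverse divide_inverse)
  qed
  then have "d0 = 0" by (rule integral_all_quotients_imp_0)
  then show False using d' by (simp add: d0_def)
qed

text \<open>The \<open>a i\<close> are arbitrary complex numbers here. Because \<open>h\<close> has
  constant term 1 and rational coefficients, every single coefficient of B = h^(-1) f A satisfies
  \<open>integral_frac\<close>. The denominators of h^(-1) are not controlled uniformly; the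
  triangular shape of \<open>B\<close> makes up for this.\<close>

lemma triangular_root_contradiction:
  fixes f A h u g B :: "complex fps" and c \<alpha> k :: int
  assumes bounded: "bounded_denominators f" and A: "\<And>m. fps_nth A m \<in> \<int>"
    and eq: "f * A = h * B" and "B \<noteq> 0"
    and B: "B = (\<Sum>i\<le>D. fps_const (a i) * fps_X ^ (t + e * i) * v i)" and "e > 0"
    and v: "\<And>i m. fps_nth (v i) m \<in> \<int>" "\<And>i. fps_nth (v i) 0 = 1"
    and h: "h ^ n = u" "n > 0" "fps_nth h 0 = 1"
    and u: "\<And>m. fps_nth u m \<in> \<int>" "u = 1 + fps_X ^ s * g" "fps_nth g 0 = of_int c"
    and c: "k * c * int p = \<alpha> * int n" "\<not> int p dvd \<alpha>"
  shows False
proof -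
  have A': "bounded_denominators A" by (rule bounded_denominators_Ints[OF A])
  have hR: "fps_nth h m \<in> \<rat>" for m
    by (rule fps_root_nth_Rats[OF h]) (use u Ints_subset_Rats in auto)
  have hiR: "fps_nth (inverse h) m \<in> \<rat>" for m
    by (rule fps_inverse_nth_closed[OF h(3) hR]) (auto intro: Rats_sum)
  have B': "B = inverse h * (f * A)"
    using h(3) by (simp add: eq inverse_mult_eq_1 flip: mult.assoc)
  have "integral_frac (fps_nth (f * A) m)" for m
    using bounded_denominators_mult[OF bounded A'] by (auto simp: bounded_denominators_def integral_frac_def)
  then have "integral_frac (fps_nth B m)" for m
    unfolding B' fps_mult_nth[of "inverse h"]
    using hiR by (intro integral_frac_sum integral_frac_mult) (auto intro: integral_frac_Rats)
  then have "bounded_denominators B"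
    by (intro bounded_denominators_triangular[OF B \<open>e > 0\<close> v])
  then show False
    using not_bounded_denominators_root[OF bounded A' _ eq \<open>B \<noteq> 0\<close> h u c] by blast
qed

end

section \<open>Euler's product and Jacobi's product\<close>

lemma uniform_limit_has_prod:
  fixes f :: "nat \<Rightarrow> complex \<Rightarrow> complex"
  assumes "compact A" "\<And>n. continuous_on A (f n)" "summable M"
    and bound: "\<And>n x. x \<in> A \<Longrightarrow> norm (f n x - 1) \<le> M n"
    and g: "\<And>x. x \<in> A \<Longrightarrow> (\<lambda>n. f n x) has_prod g x"
  shows "uniform_limit A (\<lambda>N x. \<Prod>n<N. f n x) g sequentially"
proof -
  have "uniformly_convergent_on A (\<lambda>N x. \<Prod>n<N. f n x)"
    by (rule uniformly_convergent_on_prod'[OF assms(2,1)], rule Weierstrass_m_test'[OF _ assms(3)])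
       (use bound in auto)
  then obtain h where h: "uniform_limit A (\<lambda>N x. \<Prod>n<N. f n x) h sequentially"
    by (auto simp: uniformly_convergent_on_def)
  have "h x = g x" if "x \<in> A" for x
    using tendsto_uniform_limitI[OF h that] has_prod_imp_tendsto'[OF g[OF that]] LIMSEQ_unique by blast
  then show ?thesis
    using h by (subst uniform_limit_cong'[of A _ "\<lambda>N x. \<Prod>n<N. f n x" g h]) auto
qed

text \<open>The infinite q-Pochhammer symbol (w; q).\<close>

definition qpoch :: "complex \<Rightarrow> complex \<Rightarrow> complex" where
  "qpoch q w = (\<Prod>m. 1 - q ^ m * w)"

lemma qpoch_has_prod:
  assumes "norm q < 1"
  shows "(\<lambda>m. 1 - q ^ m * w) has_prod qpoch q w"
proof -
  have "summable (\<lambda>m. norm ((1 - q ^ m * w) - 1))"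
    using assms by (auto simp: norm_mult norm_power intro!: summable_mult2 summable_geometric)
  then have "convergent_prod (\<lambda>m. 1 - q ^ m * w)"
    by (intro abs_convergent_prod_imp_convergent_prod summable_imp_abs_convergent_prod)
  then show ?thesis
    unfolding qpoch_def by (rule convergent_prod_has_prod)
qed

lemma qpoch_LIMSEQ: "norm q < 1 \<Longrightarrow> (\<lambda>N. \<Prod>m<N. 1 - q ^ m * w) \<longlonglongrightarrow> qpoch q w"
  using qpoch_has_prod has_prod_imp_tendsto' by blast

lemma qpoch_eq_0_iff: "norm q < 1 \<Longrightarrow> qpoch q w = 0 \<longleftrightarrow> (\<exists>m. q ^ m * w = 1)"
  using has_prod_eq_0_iff[OF qpoch_has_prod[of q w]] by auto

lemma qpoch_shift:
  assumes "norm q < 1"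
  shows "qpoch q w = (1 - w) * qpoch q (q * w)"
proof (rule LIMSEQ_unique)
  show "(\<lambda>N. \<Prod>m<Suc N. 1 - q ^ m * w) \<longlonglongrightarrow> qpoch q w"
    by (rule LIMSEQ_Suc[OF qpoch_LIMSEQ[OF assms]])
  have "(\<Prod>m<Suc N. 1 - q ^ m * w) = (1 - w) * (\<Prod>m<N. 1 - q ^ m * (q * w))" for N
    by (simp add: prod.lessThan_Suc_shift mult_ac del: prod.lessThan_Suc)
  then show "(\<lambda>N. \<Prod>m<Suc N. 1 - q ^ m * w) \<longlonglongrightarrow> (1 - w) * qpoch q (q * w)"
    using tendsto_mult_left[OF qpoch_LIMSEQ[OF assms, of "q * w"], of "1 - w"] by simp
qed

lemma norm_power_less_1: "norm (q :: complex) < 1 \<Longrightarrow> k > 0 \<Longrightarrow> norm (q ^ k) < 1"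
  by (simp add: norm_power power_less_one_iff)

lemma qpoch_split:
  assumes "norm q < 1"
  shows "qpoch q w = qpoch (q\<^sup>2) w * qpoch (q\<^sup>2) (q * w)"
proof (rule LIMSEQ_unique)
  have q2: "norm (q\<^sup>2) < 1" using norm_power_less_1[OF assms, of 2] by simp
  have "filterlim (\<lambda>N :: nat. 2 * N) sequentially sequentially"
    by (rule filterlim_subseq) (auto simp: strict_mono_def)
  from filterlim_compose[OF qpoch_LIMSEQ[OF assms] this]
  show "(\<lambda>N. \<Prod>m<2 * N. 1 - q ^ m * w) \<longlonglongrightarrow> qpoch q w" .
  have "(\<Prod>m<2 * N. 1 - q ^ m * w) = (\<Prod>m<N. 1 - (q\<^sup>2) ^ m * w) * (\<Prod>m<N. 1 - (q\<^sup>2) ^ m * (q * w))" for N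
  proof (induction N)
    case (Suc N)
    have "2 * Suc N = Suc (Suc (2 * N))" by simp
    then show ?case
      by (simp only: prod.lessThan_Suc Suc.IH) (simp add: power_mult[symmetric] mult_ac)
  qed auto
  then show "(\<lambda>N. \<Prod>m<2 * N. 1 - q ^ m * w) \<longlonglongrightarrow> qpoch (q\<^sup>2) w * qpoch (q\<^sup>2) (q * w)"
    using tendsto_mult[OF qpoch_LIMSEQ[OF q2] qpoch_LIMSEQ[OF q2]] by simp
qed

lemma qpoch_mult_minus:
  assumes "norm q < 1"
  shows "qpoch q w * qpoch q (- w) = qpoch (q\<^sup>2) (w\<^sup>2)"
proof (rule LIMSEQ_unique)
  have q2: "norm (q\<^sup>2) < 1" using norm_power_less_1[OF assms, of 2] by simp
  show "(\<lambda>N. (\<Prod>m<N. 1 - q ^ m * w) * (\<Prod>m<N. 1 - q ^ m * (- w))) \<longlonglongrightarrow> qpoch q w * qpoch q (- w)"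
    by (intro tendsto_mult qpoch_LIMSEQ assms)
  have "(1 - q ^ m * w) * (1 - q ^ m * (- w)) = 1 - (q\<^sup>2) ^ m * w\<^sup>2" for m
    by (simp add: power_mult[symmetric] algebra_simps power2_eq_square mult_2 power_add)
  then have "(\<Prod>m<N. 1 - q ^ m * w) * (\<Prod>m<N. 1 - q ^ m * (- w)) = (\<Prod>m<N. 1 - (q\<^sup>2) ^ m * w\<^sup>2)" for N
    by (simp only: prod.distrib[symmetric])
  then show "(\<lambda>N. (\<Prod>m<N. 1 - q ^ m * w) * (\<Prod>m<N. 1 - q ^ m * (- w))) \<longlonglongrightarrow> qpoch (q\<^sup>2) (w\<^sup>2)"
    using qpoch_LIMSEQ[OF q2] by simp
qed

lemma qpoch_holomorphic:
  assumes "norm q < 1"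
  shows "qpoch q holomorphic_on A"
proof (rule holomorphic_on_subset)
  show "qpoch q holomorphic_on UNIV"
  proof (rule holomorphic_uniform_sequence)
    fix z :: complex
    have "uniform_limit (cball z 1) (\<lambda>N x. \<Prod>m<N. 1 - q ^ m * x) (qpoch q) sequentially"
    proof (rule uniform_limit_has_prod)
      show "summable (\<lambda>m. norm q ^ m * (norm z + 1))"
        using assms by (intro summable_mult2 summable_geometric) auto
      fix m x assume "x \<in> cball z 1"
      then have "norm x \<le> norm z + 1"
        using norm_triangle_sub[of x z] by (simp add: dist_norm norm_minus_commute)
      then show "norm (1 - q ^ m * x - 1) \<le> norm q ^ m * (norm z + 1)"
        by (auto simp: norm_mult norm_power intro: mult_left_mono)
    qed (auto intro!: continuous_intros qpoch_has_prod assms)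
    then show "\<exists>d>0. cball z d \<subseteq> UNIV \<and> uniform_limit (cball z d) (\<lambda>N x. \<Prod>m<N. 1 - q ^ m * x) (qpoch q) sequentially"
      by (intro exI[of _ 1]) auto
  qed (auto intro!: holomorphic_intros)
qed auto

lemma qpoch_holomorphic' [holomorphic_intros]:
  assumes "norm q < 1" "f holomorphic_on A"
  shows "(\<lambda>z. qpoch q (f z)) holomorphic_on A"
  using holomorphic_on_compose[OF assms(2) qpoch_holomorphic[OF assms(1)]] by (simp add: o_def)

text \<open>The product of 1 - y^m over m >= 1, the choice w = y shifting the exponents by one. At y
  = exp(2 pi i \<tau>) it is Dedekind's eta function without its fractional power of q.\<close>

definition euler_prod :: "complex \<Rightarrow> complex" where
  "euler_prod y = qpoch y y"

lemma euler_prod_nonzero: "norm y < 1 \<Longrightarrow> euler_prod y \<noteq> 0"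
proof
  assume y: "norm y < 1" and "euler_prod y = 0"
  then obtain m where "y ^ Suc m = 1"
    using qpoch_eq_0_iff[of y y] by (auto simp: euler_prod_def mult.commute)
  then show False
    using norm_power_less_1[OF y, of "Suc m"] by simp
qed

lemma euler_prod_uniform_limit:
  assumes "r < 1"
  shows "uniform_limit (cball 0 r) (\<lambda>N y. \<Prod>m<N. 1 - y ^ m * y) euler_prod sequentially"
proof (cases "r < 0")
  case False
  show ?thesis
  proof (rule uniform_limit_has_prod)
    show "summable (\<lambda>m. r ^ m)" using False assms by (intro summable_geometric) auto
    fix m x assume "x \<in> cball (0 :: complex) r"
    then have "norm x \<le> r" by simp
    then have "norm x ^ m * norm x \<le> r ^ m * 1"
      using assms False by (intro mult_mono power_mono) auto
    then show "norm (1 - x ^ m * x - 1) \<le> r ^ m"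
      by (simp add: norm_mult norm_power)
  next
    fix x assume "x \<in> cball (0 :: complex) r"
    then show "(\<lambda>m. 1 - x ^ m * x) has_prod euler_prod x"
      unfolding euler_prod_def using assms by (intro qpoch_has_prod) auto
  qed (auto intro!: continuous_intros)
qed auto

lemma euler_prod_holomorphic: "euler_prod holomorphic_on ball 0 1"
proof (rule holomorphic_uniform_sequence)
  fix z :: complex assume "z \<in> ball 0 1"
  then have z: "norm z < 1" by simp
  define d where "d = (1 - norm z) / 2"
  have "cball z d \<subseteq> cball 0 (norm z + d)"
    by (auto simp: cball_subset_cball_iff)
  moreover have "norm z + d < 1" using z by (simp add: d_def field_simps)
  ultimately have "uniform_limit (cball z d) (\<lambda>N y. \<Prod>m<N. 1 - y ^ m * y) euler_prod sequentially" "cball z d \<subseteq> ball 0 1"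
    using uniform_limit_on_subset[OF euler_prod_uniform_limit] by (auto simp: subset_iff)
  moreover have "d > 0" using z by (simp add: d_def)
  ultimately show "\<exists>d>0. cball z d \<subseteq> ball 0 1 \<and> uniform_limit (cball z d) (\<lambda>N y. \<Prod>m<N. 1 - y ^ m * y) euler_prod sequentially"
    by blast
qed (auto intro!: holomorphic_intros)

lemma euler_prod_holomorphic' [holomorphic_intros]:
  assumes "f holomorphic_on A" "\<And>z. z \<in> A \<Longrightarrow> norm (f z) < 1"
  shows "(\<lambda>z. euler_prod (f z)) holomorphic_on A"
proof -
  have "f ` A \<subseteq> ball 0 1" using assms(2) by auto
  then show ?thesis
    using holomorphic_on_compose_gen[OF assms(1) euler_prod_holomorphic] by (simp add: o_def)
qed

definition euler_fps :: "complex fps" where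
  "euler_fps = fps_expansion euler_prod 0"

lemma euler_prod_has_fps_expansion: "euler_prod has_fps_expansion euler_fps"
  unfolding euler_fps_def
  by (rule has_fps_expansion_fps_expansion[OF _ _ euler_prod_holomorphic]) auto

text \<open>Derivatives at 0 pass to locally uniform limits of holomorphic functions, so the Taylor
  coefficients can be read off from the finite products.\<close>

lemma euler_fps_nth: "(\<lambda>N. fps_nth (\<Prod>m<N. 1 - fps_X ^ m * fps_X) k) \<longlonglongrightarrow> fps_nth euler_fps k"
proof -
  have "((\<lambda>N. (deriv ^^ k) (\<lambda>y. \<Prod>m<N. 1 - y ^ m * y) 0) \<longlongrightarrow> (deriv ^^ k) euler_prod 0) sequentially"
    by (rule higher_deriv_complex_uniform_limit[where A = "ball 0 (1/2)"])
       (auto intro!: holomorphic_intros always_eventually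
         intro: uniform_limit_on_subset[OF euler_prod_uniform_limit[of "1/2"]])
  then have "(\<lambda>N. (deriv ^^ k) (\<lambda>y. \<Prod>m<N. 1 - y ^ m * y) 0 / fact k) \<longlonglongrightarrow> (deriv ^^ k) euler_prod 0 / fact k"
    by (intro tendsto_divide) auto
  moreover have "(deriv ^^ k) (\<lambda>y::complex. \<Prod>m<N. 1 - y ^ m * y) 0 / fact k = fps_nth (\<Prod>m<N. 1 - fps_X ^ m * fps_X) k" for N
  proof (rule fps_nth_fps_expansion[symmetric])
    show "(\<lambda>y::complex. \<Prod>m<N. 1 - y ^ m * y) has_fps_expansion (\<Prod>m<N. 1 - fps_X ^ m * fps_X)"
      by (intro fps_expansion_intros)
  qed
  ultimately show ?thesis by (simp add: euler_fps_def fps_expansion_def)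
qed

text \<open>The integers form a closed set, and these coefficients are limits of coefficients of
  finite integral products.\<close>

lemma euler_fps_nth_Ints: "fps_nth euler_fps k \<in> \<int>"
proof (rule Lim_in_closed_set[OF _ _ _ euler_fps_nth])
  have "fps_nth (\<Prod>m<N. 1 - fps_X ^ m * fps_X) k \<in> (\<int> :: complex set)" for N
  proof (induction N arbitrary: k)
    case (Suc N)
    have *: "fps_nth (1 - fps_X ^ N * fps_X :: complex fps) k \<in> \<int>" for k
      by (simp add: fps_X_power_nth flip: power_Suc2)
    show ?case
      unfolding prod.lessThan_Suc fps_mult_nth by (intro Ints_sum Ints_mult Suc.IH *)
  qed auto
  then show "\<forall>\<^sub>F N in sequentially. fps_nth (\<Prod>m<N. 1 - fps_X ^ m * fps_X) k \<in> (\<int> :: complex set)"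
    by simp
qed auto

lemma euler_fps_nth_0: "fps_nth euler_fps 0 = 1"
  using has_fps_expansion_imp_0_eq_fps_nth_0[OF euler_prod_has_fps_expansion]
  by (simp add: euler_prod_def qpoch_def)

text \<open>Only the factor 1 - y has a linear term. This coefficient, taken 24 times, is what
  finally appears in 24 j/n.\<close>

lemma euler_fps_nth_1: "fps_nth euler_fps 1 = -1"
proof (rule LIMSEQ_unique[OF euler_fps_nth tendsto_eventually])
  have "fps_nth (\<Prod>m<Suc N. 1 - fps_X ^ m * fps_X) 0 = (1 :: complex) \<and>
        fps_nth (\<Prod>m<Suc N. 1 - fps_X ^ m * fps_X) 1 = (-1 :: complex)" for N
  proof (induction N)
    case (Suc N)
    have "(\<Prod>m<Suc (Suc N). 1 - fps_X ^ m * fps_X :: complex fps)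
        = (\<Prod>m<Suc N. 1 - fps_X ^ m * fps_X) * (1 - fps_X ^ Suc (Suc N))"
      by (simp only: prod.lessThan_Suc[of _ "Suc N"] power_Suc2)
    then show ?case
      using Suc by (simp add: fps_mult_nth fps_X_power_nth del: prod.lessThan_Suc power_Suc)
  qed auto
  then show "\<forall>\<^sub>F N in sequentially. fps_nth (\<Prod>m<N. 1 - fps_X ^ m * fps_X) 1 = (-1 :: complex)"
    by (intro eventually_sequentiallyI[of 1]) (metis Suc_le_D One_nat_def)
qed

text \<open>Separating odd from even exponents gives euler_prod(y) = (y; y^2) euler_prod(y^2). The
  odd parts for y and -y multiply to (y^2; y^4), and this is the odd part of euler_prod(y^2), whose
  even part is euler_prod(y^4).\<close>

lemma euler_prod_identity:
  assumes "norm y < 1"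
  shows "euler_prod y * euler_prod (- y) * euler_prod (y ^ 4) = euler_prod (y\<^sup>2) ^ 3"
proof -
  have y2: "norm (y\<^sup>2) < 1" using norm_power_less_1[OF assms, of 2] by simp
  have e: "euler_prod y = qpoch (y\<^sup>2) y * euler_prod (y\<^sup>2)" if "norm y < 1" for y
    using qpoch_split[OF that, of y] by (simp add: euler_prod_def power2_eq_square)
  have "euler_prod y * euler_prod (- y) = (qpoch (y\<^sup>2) y * qpoch (y\<^sup>2) (- y)) * euler_prod (y\<^sup>2) ^ 2"
    using e[OF assms] e[of "- y"] assms by (simp add: power2_eq_square)
  also have "\<dots> = qpoch (y ^ 4) (y\<^sup>2) * euler_prod (y\<^sup>2) ^ 2"
    using qpoch_mult_minus[OF y2] by (simp add: power_mult[symmetric])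
  finally have "euler_prod y * euler_prod (- y) * euler_prod (y ^ 4)
      = (qpoch (y ^ 4) (y\<^sup>2) * euler_prod (y ^ 4)) * euler_prod (y\<^sup>2) ^ 2"
    by (simp add: mult_ac)
  also have "qpoch (y ^ 4) (y\<^sup>2) * euler_prod (y ^ 4) = euler_prod (y\<^sup>2)"
    using e[OF y2] by (simp flip: power_mult)
  finally show ?thesis by (simp add: power2_eq_square power3_eq_cube)
qed

text \<open>Jacobi's theta function in the product form of the triple product identity, without the
  factor (q; q).\<close>

definition jacobi_prod :: "complex \<Rightarrow> complex \<Rightarrow> complex" where
  "jacobi_prod q w = qpoch q w * qpoch q (q / w)"

lemma jacobi_prod_shift:
  assumes "norm q < 1" "q \<noteq> 0" "w \<noteq> 0"
  shows "jacobi_prod q (q * w) = - (1 / w) * jacobi_prod q w"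
proof -
  have "qpoch q (1 / w) = (1 - 1 / w) * qpoch q (q / w)"
    using qpoch_shift[OF assms(1), of "1 / w"] by simp
  moreover have "1 - 1 / w = - (1 / w) * (1 - w)" using assms by (simp add: field_simps)
  ultimately show ?thesis
    using assms by (simp add: jacobi_prod_def qpoch_shift[OF assms(1), of w])
qed

lemma jacobi_prod_eq_0_iff:
  assumes q: "norm q < 1" "q \<noteq> 0" "w \<noteq> 0"
  shows "jacobi_prod q w = 0 \<longleftrightarrow> (\<exists>m::int. w = q powi m)"
proof
  assume "jacobi_prod q w = 0"
  then consider m where "q ^ m * w = 1" | m where "q ^ Suc m = w"
    using assms by (auto simp: jacobi_prod_def qpoch_eq_0_iff field_simps)
  then show "\<exists>m::int. w = q powi m"
  proof cases
    case 1
    then show ?thesis using q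
      by (intro exI[of _ "- int m"]) (simp add: power_int_minus field_simps)
  next
    case 2
    then show ?thesis
      by (intro exI[of _ "int (Suc m)"]) (simp add: power_int_of_nat del: of_nat_Suc)
  qed
next
  assume "\<exists>m::int. w = q powi m"
  then obtain m where m: "w = q powi m" by blast
  show "jacobi_prod q w = 0"
  proof (cases "m \<le> 0")
    case True
    then obtain k where "m = - int k" by (metis nonpos_int_cases)
    then have "q ^ k * w = 1" using q by (simp add: m power_int_minus)
    then show ?thesis using q by (auto simp: jacobi_prod_def qpoch_eq_0_iff)
  next
    case False
    then obtain k where "m = int (Suc k)" by (metis zero_less_imp_eq_int not_le Suc_pred)
    then have "w = q ^ Suc k" by (simp only: m power_int_of_nat)
    then have "q ^ k * (q / w) = 1" using q by simp
    then show ?thesis using q by (auto simp: jacobi_prod_def qpoch_eq_0_iff)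
  qed
qed

lemma jacobi_prod_minus_1:
  assumes "norm q < 1"
  shows "jacobi_prod q (-1) = 2 * (euler_prod (q\<^sup>2) / euler_prod q) ^ 2"
proof -
  have "qpoch q (- 1) = 2 * qpoch q (- q)"
    using qpoch_shift[OF assms, of "-1"] by simp
  moreover have "qpoch q (- q) = euler_prod (q\<^sup>2) / euler_prod q"
    using qpoch_mult_minus[OF assms, of q] euler_prod_nonzero[OF assms]
    by (simp add: euler_prod_def field_simps)
  ultimately show ?thesis by (simp add: jacobi_prod_def power2_eq_square)
qed

lemma jacobi_prod_sqrt:
  assumes "norm y < 1" "y \<noteq> 0"
  shows "jacobi_prod (y\<^sup>2) y = (euler_prod y / euler_prod (y\<^sup>2)) ^ 2"
proof -
  have y2: "norm (y\<^sup>2) < 1" using norm_power_less_1[OF assms(1), of 2] by simp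
  have "euler_prod y = qpoch (y\<^sup>2) y * euler_prod (y\<^sup>2)"
    using qpoch_split[OF assms(1), of y] by (simp add: euler_prod_def power2_eq_square)
  then have "qpoch (y\<^sup>2) y = euler_prod y / euler_prod (y\<^sup>2)"
    using euler_prod_nonzero[OF y2] by (simp add: field_simps)
  then show ?thesis using assms by (simp add: jacobi_prod_def power2_eq_square)
qed

text \<open>For q = y^2 the half periods are -1, y and -y in the multiplicative variable. The three
  values are quotients of Euler products, and Euler's identity collapses their product to a number
  independent of \<open>y\<close>; it is therefore the same before and after the inversion of
  \<tau>.\<close>

lemma jacobi_prod_half_periods:
  assumes "norm y < 1" "y \<noteq> 0"
  shows "jacobi_prod (y\<^sup>2) (-1) * jacobi_prod (y\<^sup>2) y * jacobi_prod (y\<^sup>2) (- y) = 2"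
proof -
  have y2: "norm (y\<^sup>2) < 1" using norm_power_less_1[OF assms(1), of 2] by simp
  have "jacobi_prod (y\<^sup>2) (-1) * jacobi_prod (y\<^sup>2) y * jacobi_prod (y\<^sup>2) (- y)
    = 2 * ((euler_prod y * euler_prod (- y) * euler_prod (y ^ 4)) / euler_prod (y\<^sup>2) ^ 3) ^ 2"
    using jacobi_prod_minus_1[OF y2] jacobi_prod_sqrt[OF assms] jacobi_prod_sqrt[of "- y"] assms
    by (simp add: power_mult_distrib power_divide power2_eq_square power3_eq_cube power4_eq_xxxx mult_ac)
  also have "\<dots> = 2"
    using euler_prod_identity[OF assms(1)] euler_prod_nonzero[OF y2] by simp
  finally show ?thesis .
qed

section \<open>The transformation of the eta function\<close>

lemma periodic_of_int:
  fixes h :: "complex \<Rightarrow> 'a"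
  assumes "\<And>z. h (z + w) = h z"
  shows "h (z + of_int a * w) = h z"
proof -
  have nat: "h (z + of_nat m * w) = h z" for m z
  proof (induction m)
    case (Suc m)
    have "h (z + of_nat (Suc m) * w) = h ((z + of_nat m * w) + w)"
      by (simp add: algebra_simps)
    then show ?case using assms Suc by simp
  qed simp
  show ?thesis
  proof (cases a)
    case (nonneg m)
    then show ?thesis using nat by simp
  next
    case (neg m)
    have eq: "z + of_int a * w + of_nat (Suc m) * w = z"
      unfolding neg by (simp add: algebra_simps)
    show ?thesis
      using nat[of "z + of_int a * w" "Suc m"] unfolding eq by (rule sym)
  qed
qed

lemma lattice_reduction:
  assumes "Im \<tau> > 0"
  obtains a b :: int and s t where "z = (of_real s + of_real t * \<tau>) + of_int a + of_int b * \<tau>"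
    "s \<in> {0..1}" "t \<in> {0..1}"
proof -
  define v where "v = Im z / Im \<tau>"
  define u where "u = Re z - v * Re \<tau>"
  have "z = of_real u + of_real v * \<tau>"
    using assms by (simp add: complex_eq_iff u_def v_def)
  then have "z = (of_real (frac u) + of_real (frac v) * \<tau>) + of_int \<lfloor>u\<rfloor> + of_int \<lfloor>v\<rfloor> * \<tau>"
    by (simp add: frac_def algebra_simps)
  then show ?thesis
    by (rule that) (auto simp: frac_ge_0 less_imp_le[OF frac_lt_1])
qed

text \<open>f / g is doubly periodic because both functions have the same multipliers. At the
  lattice points the simple zeros of \<open>g\<close> are cancelled by zeros of \<open>f\<close>, so
  the quotient is entire and bounded, and Liouville's theorem applies; the constant is its value at
  0.\<close>

lemma quasi_periodic_quotient:
  fixes f g :: "complex \<Rightarrow> complex"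
  assumes \<tau>: "Im \<tau> > 0"
    and hol: "f holomorphic_on UNIV" "g holomorphic_on UNIV"
    and per: "\<And>w. w \<in> {1, \<tau>} \<Longrightarrow> \<exists>m. \<forall>z. m z \<noteq> 0 \<and> f (z + w) = m z * f z \<and> g (z + w) = m z * g z"
    and zeros: "\<And>z. g z = 0 \<longleftrightarrow> (\<exists>a b :: int. z = of_int a + of_int b * \<tau>)"
    and 0: "f 0 = 0" "deriv g 0 \<noteq> 0"
    and z: "g z \<noteq> 0"
  shows "f z = deriv f 0 / deriv g 0 * g z"
proof -
  \<comment> \<open>The limit at 0 is prescribed at every lattice point, so \<open>\<phi>\<close> is
    periodic from the outset. The removable singularity needs treatment at 0 only and is then
    translated.\<close>
  define \<phi> where "\<phi> = (\<lambda>z. if g z = 0 then deriv f 0 / deriv g 0 else f z / g z)"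
  have step: "\<phi> (z + w) = \<phi> z" if w: "w \<in> {1, \<tau>}" for w z
  proof -
    obtain m where "\<And>z. m z \<noteq> 0 \<and> f (z + w) = m z * f z \<and> g (z + w) = m z * g z"
      using per[OF w] by blast
    then show ?thesis by (simp add: \<phi>_def)
  qed
  have periodic: "\<phi> (z + of_int a + of_int b * \<tau>) = \<phi> z" for z and a b :: int
    using periodic_of_int[of \<phi> \<tau> "z + of_int a" b] periodic_of_int[of \<phi> 1 z a] step by simp
  have g0: "g 0 = 0" using zeros[of 0] by (auto intro!: exI[of _ 0])
  have "(f has_field_derivative deriv f 0) (at 0)" "(g has_field_derivative deriv g 0) (at 0)"
    using hol by (auto intro!: holomorphic_derivI[of _ UNIV])
  then have lim: "((\<lambda>z. f z / z) \<longlongrightarrow> deriv f 0) (at 0)" "((\<lambda>z. g z / z) \<longlongrightarrow> deriv g 0) (at 0)"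
    using 0 g0 by (auto simp: has_field_derivative_iff)
  have "eventually (\<lambda>z. g z / z \<noteq> 0) (at 0)"
    using lim(2) 0(2) by (rule tendsto_imp_eventually_ne)
  then obtain r where r: "r > 0" "\<And>z. z \<noteq> 0 \<Longrightarrow> dist z 0 < r \<Longrightarrow> g z / z \<noteq> 0"
    unfolding eventually_at by blast
  then have gr: "g z \<noteq> 0" if "z \<in> ball 0 r - {0}" for z
    using that by (auto simp: dist_commute)
  have hol0: "\<phi> holomorphic_on ball 0 r"
  proof (rule no_isolated_singularity'[of "{0}"])
    show "(\<phi> \<longlongrightarrow> \<phi> z) (at z within ball 0 r)" if "z \<in> {0}" for z
    proof -
      have "((\<lambda>z. (f z / z) / (g z / z)) \<longlongrightarrow> deriv f 0 / deriv g 0) (at 0)"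
        using lim 0(2) by (intro tendsto_divide)
      moreover have "eventually (\<lambda>z. (f z / z) / (g z / z) = \<phi> z) (at 0)"
        unfolding eventually_at using r gr
        by (intro exI[of _ r]) (auto simp: \<phi>_def dist_commute)
      ultimately have "(\<phi> \<longlongrightarrow> deriv f 0 / deriv g 0) (at 0)"
        by (rule Lim_transform_eventually)
      then show ?thesis using that g0 by (auto simp: \<phi>_def intro: tendsto_within_subset)
    qed
    have "(\<lambda>z. f z / g z) holomorphic_on ball 0 r - {0}"
      using hol gr by (intro holomorphic_intros) (auto elim: holomorphic_on_subset)
    then show "\<phi> holomorphic_on ball 0 r - {0}"
      by (rule holomorphic_transform) (use gr in \<open>auto simp: \<phi>_def\<close>)
  qed auto
  have "\<phi> field_differentiable at z" for z
  proof (cases "g z = 0")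
    case False
    have "open {z. g z \<noteq> 0}"
      using hol(2) by (intro open_Collect_neq holomorphic_on_imp_continuous_on) auto
    moreover have "(\<lambda>z. f z / g z) holomorphic_on {z. g z \<noteq> 0}"
      using hol by (intro holomorphic_intros) (auto elim: holomorphic_on_subset)
    then have "\<phi> holomorphic_on {z. g z \<noteq> 0}"
      by (rule holomorphic_transform) (auto simp: \<phi>_def)
    ultimately show ?thesis
      using False holomorphic_on_imp_differentiable_at by blast
  next
    case True
    then obtain a b :: int where ab: "z = of_int a + of_int b * \<tau>" using zeros by blast
    have "\<phi> field_differentiable at 0"
      using hol0 r(1) by (auto intro: holomorphic_on_imp_differentiable_at[of _ "ball 0 r"])
    then have "(\<phi> \<circ> (\<lambda>w. w - z)) field_differentiable at z"
      by (intro field_differentiable_compose) (auto intro!: derivative_intros)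
    moreover have "\<phi> \<circ> (\<lambda>w. w - z) = \<phi>"
    proof
      fix w
      have "\<phi> w = \<phi> ((w - z) + of_int a + of_int b * \<tau>)" by (simp add: ab)
      then show "(\<phi> \<circ> (\<lambda>w. w - z)) w = \<phi> w" using periodic by simp
    qed
    ultimately show ?thesis by simp
  qed
  then have hol\<phi>: "\<phi> holomorphic_on UNIV"
    by (auto simp: holomorphic_on_def)
  \<comment> \<open>The closed period parallelogram: it is compact, and by periodicity it already
    yields all values of \<open>\<phi>\<close>.\<close>
  define K where "K = (\<lambda>(s, t). of_real s + of_real t * \<tau>) ` ({0..1} \<times> {0..1 :: real})"
  have "compact K"
    unfolding K_def
    by (intro compact_continuous_image compact_Times) (auto simp: case_prod_beta intro!: continuous_intros)
  then have "compact (\<phi> ` K)"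
    using hol\<phi> by (intro compact_continuous_image) (auto intro: holomorphic_on_imp_continuous_on holomorphic_on_subset)
  moreover have "range \<phi> \<subseteq> \<phi> ` K"
  proof
    fix y assume "y \<in> range \<phi>"
    then obtain z where y: "y = \<phi> z" by blast
    obtain a b :: int and s t where "z = (of_real s + of_real t * \<tau>) + of_int a + of_int b * \<tau>"
      "s \<in> {0..1}" "t \<in> {0..1}"
      using lattice_reduction[OF \<tau>] by metis
    then have "y = \<phi> (of_real s + of_real t * \<tau>)" "of_real s + of_real t * \<tau> \<in> K"
      using periodic by (auto simp: y K_def)
    then show "y \<in> \<phi> ` K" by blast
  qed
  ultimately have "bounded (range \<phi>)"
    using compact_imp_bounded bounded_subset by blast
  then have "\<phi> constant_on UNIV"
    using Liouville_theorem hol\<phi> by blast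
  then have "\<phi> z = \<phi> 0" by (auto simp: constant_on_def)
  then show ?thesis using z g0 by (simp add: \<phi>_def field_simps)
qed

text \<open>The classical nome: nome(\<tau>) is q^(1/2), so nome(\<tau>/n) is the local parameter of
  expansions in q^(1/(2n)).\<close>

definition nome :: "complex \<Rightarrow> complex" where
  "nome z = exp (of_real pi * \<i> * z)"

lemma nome_add: "nome (z + w) = nome z * nome w"
  by (simp add: nome_def distrib_left exp_add)

lemma nome_minus: "nome (- z) = inverse (nome z)"
  by (simp add: nome_def exp_minus)

lemma nome_diff: "nome (z - w) = nome z / nome w"
  using nome_add[of z "- w"] by (simp add: nome_minus divide_inverse)

lemma nome_0 [simp]: "nome 0 = 1" and nome_nonzero [simp]: "nome z \<noteq> 0" and nome_1 [simp]: "nome 1 = -1"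
  by (simp_all add: nome_def)

lemma nome_half: "nome (1 / 2) = \<i>"
  using cis_pi_half by (simp add: nome_def cis_conv_exp mult_ac)

lemma nome_power: "nome z ^ n = nome (of_nat n * z)"
  by (simp add: nome_def mult_ac flip: exp_of_nat_mult)

lemma nome_2 [simp]: "nome 2 = 1"
  using nome_power[of 1 2] by simp

lemma nome_eq_iff: "nome z = nome w \<longleftrightarrow> (\<exists>a::int. z = w + 2 * of_int a)"
proof -
  have "nome z = nome w \<longleftrightarrow> (\<exists>n::int. of_real pi * \<i> * z = of_real pi * \<i> * w + (of_int (2 * n) * of_real pi) * \<i>)"
    by (simp add: exp_eq nome_def)
  also have "\<dots> \<longleftrightarrow> (\<exists>a::int. z = w + 2 * of_int a)"
  proof (intro iff_exI)
    fix n :: int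
    have "of_real pi * \<i> * z = of_real pi * \<i> * w + (of_int (2 * n) * of_real pi) * \<i>
      \<longleftrightarrow> (of_real pi * \<i>) * z = (of_real pi * \<i>) * (w + 2 * of_int n)"
      by (simp add: algebra_simps)
    also have "\<dots> \<longleftrightarrow> z = w + 2 * of_int n" by simp
    finally show "(of_real pi * \<i> * z = of_real pi * \<i> * w + (of_int (2 * n) * of_real pi) * \<i>) = (z = w + 2 * of_int n)" .
  qed
  finally show ?thesis .
qed

lemma norm_nome: "norm (nome z) = exp (- (pi * Im z))"
  by (simp add: nome_def)

lemma norm_nome_less_1: "Im z > 0 \<Longrightarrow> norm (nome z) < 1"
  by (simp add: norm_nome)

lemma nome_holomorphic [holomorphic_intros]: "f holomorphic_on A \<Longrightarrow> (\<lambda>z. nome (f z)) holomorphic_on A"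
  unfolding nome_def by (intro holomorphic_intros)

lemma Im_minus_inverse_pos: "Im \<tau> > 0 \<Longrightarrow> Im (- 1 / \<tau>) > 0"
  by (auto simp: Im_divide power2_eq_square intro!: divide_pos_pos add_nonneg_pos)

text \<open>The simple zero at z = 0 comes from the first factor 1 - w of the product. Once it is
  split off, the remaining product has the value euler_prod(q)^2 there. The function
  \<open>h\<close> leaves room for the Gaussian factor.\<close>

lemma deriv_jacobi_prod_nome:
  assumes q: "norm q < 1" and h: "h holomorphic_on UNIV" "h 0 = 1"
  shows "deriv (\<lambda>z. h z * jacobi_prod q (nome (2 * c * z))) 0 = - (2 * of_real pi * \<i> * c) * euler_prod q ^ 2"
proof -
  define R where "R = (\<lambda>z. h z * (qpoch q (q * nome (2 * c * z)) * qpoch q (q / nome (2 * c * z))))"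
  have "R holomorphic_on UNIV"
    unfolding R_def by (intro holomorphic_intros q h) auto
  then have R: "(R has_field_derivative deriv R 0) (at 0)"
    by (auto intro: holomorphic_derivI)
  have "(\<lambda>z. h z * jacobi_prod q (nome (2 * c * z))) = (\<lambda>z. (1 - nome (2 * c * z)) * R z)"
    by (auto simp: R_def jacobi_prod_def fun_eq_iff qpoch_shift[OF q, of "nome _"])
  moreover have "((\<lambda>z. 1 - nome (2 * c * z)) has_field_derivative - (2 * of_real pi * \<i> * c)) (at 0)"
    unfolding nome_def by (auto intro!: derivative_eq_intros)
  then have "((\<lambda>z. (1 - nome (2 * c * z)) * R z) has_field_derivative - (2 * of_real pi * \<i> * c) * R 0) (at 0)"
    using DERIV_mult[OF _ R] by fastforce
  moreover have "R 0 = euler_prod q ^ 2"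
    by (simp add: R_def h euler_prod_def power2_eq_square)
  ultimately show ?thesis by (simp add: DERIV_imp_deriv)
qed

text \<open>The exponent z^2/\<tau> + z/\<tau> - z is chosen so that both sides are invariant under
  z -> z + \<tau> and acquire the same multiplier under z -> z + 1. The factor on the right is the
  ratio of the derivatives at 0.\<close>

lemma jacobi_prod_modular:
  assumes \<tau>: "Im \<tau> > 0" and nz: "jacobi_prod (nome (- 2 / \<tau>)) (nome (2 * z / \<tau>)) \<noteq> 0"
  shows "nome (z\<^sup>2 / \<tau> + z / \<tau> - z) * jacobi_prod (nome (2 * \<tau>)) (nome (2 * z))
    = \<tau> * euler_prod (nome (2 * \<tau>)) ^ 2 / euler_prod (nome (- 2 / \<tau>)) ^ 2
      * jacobi_prod (nome (- 2 / \<tau>)) (nome (2 * z / \<tau>))"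
proof -
  define q where "q = nome (2 * \<tau>)"
  define q' where "q' = nome (- 2 / \<tau>)"
  have q: "norm q < 1" "q \<noteq> 0"
    using \<tau> by (auto simp: q_def intro!: norm_nome_less_1)
  have "Im (- 2 / \<tau>) > 0" using Im_minus_inverse_pos[OF \<tau>] by (simp add: Im_divide)
  then have q': "norm q' < 1" "q' \<noteq> 0"
    by (auto simp: q'_def intro!: norm_nome_less_1)
  have \<tau>0: "\<tau> \<noteq> 0" using \<tau> by auto
  define f where "f = (\<lambda>z. nome (z\<^sup>2 / \<tau> + z / \<tau> - z) * jacobi_prod q (nome (2 * z)))"
  define g where "g = (\<lambda>z. jacobi_prod q' (nome (2 * z / \<tau>)))"
  have hol: "f holomorphic_on UNIV" "g holomorphic_on UNIV"
    unfolding f_def g_def jacobi_prod_def using q q' \<tau>0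
    by (auto intro!: holomorphic_intros)
  have "(\<lambda>z. nome (z\<^sup>2 / \<tau> + z / \<tau> - z)) holomorphic_on UNIV"
    using \<tau>0 by (intro holomorphic_intros) auto
  then have df: "deriv f 0 = - (2 * of_real pi * \<i>) * euler_prod q ^ 2"
    using deriv_jacobi_prod_nome[OF q(1), of "\<lambda>z. nome (z\<^sup>2 / \<tau> + z / \<tau> - z)" 1]
    by (simp add: f_def)
  have dg: "deriv g 0 = - (2 * of_real pi * \<i> / \<tau>) * euler_prod q' ^ 2"
    using deriv_jacobi_prod_nome[OF q'(1), of "\<lambda>_. 1" "1 / \<tau>"] by (simp add: g_def)
  have A: "euler_prod q' \<noteq> 0" using euler_prod_nonzero q' by auto
  have zeros: "g z = 0 \<longleftrightarrow> (\<exists>a b :: int. z = of_int a + of_int b * \<tau>)" for z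
  proof -
    have "q' powi m = nome (2 * (- of_int m / \<tau>))" for m
    proof (cases m)
      case (nonneg k)
      then show ?thesis by (simp add: q'_def nome_power mult_ac)
    next
      case (neg k)
      have "q' powi m = inverse (q' ^ Suc k)" by (simp only: neg power_int_minus power_int_of_nat)
      then show ?thesis by (simp only: q'_def nome_power neg flip: nome_minus) (simp add: field_simps)
    qed
    then have "g z = 0 \<longleftrightarrow> (\<exists>m::int. nome (2 * z / \<tau>) = nome (2 * (- of_int m / \<tau>)))"
      using q' by (simp add: g_def jacobi_prod_eq_0_iff)
    also have "\<dots> \<longleftrightarrow> (\<exists>m a :: int. z = - of_int m + of_int a * \<tau>)"
      unfolding nome_eq_iff
    proof (intro iff_exI)
      fix m a :: int
      have "2 * (- of_int m / \<tau>) + 2 * of_int a = 2 * ((- of_int m + of_int a * \<tau>) / \<tau>)"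
        using \<tau>0 by (simp add: field_simps)
      moreover have "2 * z / \<tau> = 2 * (z / \<tau>)" by simp
      moreover have "2 * (z / \<tau>) = 2 * ((- of_int m + of_int a * \<tau>) / \<tau>) \<longleftrightarrow> z = - of_int m + of_int a * \<tau>"
        using \<tau>0 by (simp only: mult_cancel_left divide_cancel_right) simp
      ultimately show "(2 * z / \<tau> = 2 * (- of_int m / \<tau>) + 2 * of_int a) = (z = - of_int m + of_int a * \<tau>)"
        by simp
    qed
    also have "\<dots> \<longleftrightarrow> (\<exists>a b :: int. z = of_int a + of_int b * \<tau>)"
      by (metis add.inverse_inverse of_int_minus)
    finally show ?thesis .
  qed
  have per: "\<exists>m. \<forall>z. m z \<noteq> 0 \<and> f (z + w) = m z * f z \<and> g (z + w) = m z * g z" if "w \<in> {1, \<tau>}" for w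
  proof (cases "w = 1")
    case True
    have "f (z + 1) = - nome (2 * (z + 1) / \<tau>) * f z" for z
    proof -
      have "(z + 1)\<^sup>2 / \<tau> + (z + 1) / \<tau> - (z + 1) = (z\<^sup>2 / \<tau> + z / \<tau> - z) + 2 * (z + 1) / \<tau> - 1"
        using \<tau>0 by (simp add: field_simps power2_eq_square)
      then have "nome ((z + 1)\<^sup>2 / \<tau> + (z + 1) / \<tau> - (z + 1)) = - nome (2 * (z + 1) / \<tau>) * nome (z\<^sup>2 / \<tau> + z / \<tau> - z)"
        by (simp only: nome_diff[of _ 1] nome_add[of _ "2 * (z + 1) / \<tau>"]) simp
      moreover have "nome (2 * (z + 1)) = nome (2 * z)"
        by (simp add: distrib_left nome_add)
      ultimately show ?thesis by (simp add: f_def)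
    qed
    moreover have "g (z + 1) = - nome (2 * (z + 1) / \<tau>) * g z" for z
    proof -
      have "q' * nome (2 * (z + 1) / \<tau>) = nome (2 * z / \<tau>)"
        unfolding q'_def nome_add[symmetric] using \<tau>0 by (simp add: field_simps)
      then show ?thesis
        using jacobi_prod_shift[OF q', of "nome (2 * (z + 1) / \<tau>)"] by (simp add: g_def)
    qed
    ultimately show ?thesis using True by (intro exI[of _ "\<lambda>z. - nome (2 * (z + 1) / \<tau>)"]) auto
  next
    case False
    then have w: "w = \<tau>" using that by auto
    have "f (z + \<tau>) = f z" for z
    proof -
      have "(z + \<tau>)\<^sup>2 / \<tau> + (z + \<tau>) / \<tau> - (z + \<tau>) = (z\<^sup>2 / \<tau> + z / \<tau> - z) + 2 * z + 1"
        using \<tau>0 by (simp add: field_simps power2_eq_square)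
      then have "nome ((z + \<tau>)\<^sup>2 / \<tau> + (z + \<tau>) / \<tau> - (z + \<tau>)) = - nome (2 * z) * nome (z\<^sup>2 / \<tau> + z / \<tau> - z)"
        by (simp only: nome_add[of _ 1] nome_add[of _ "2 * z"]) simp
      moreover have "nome (2 * (z + \<tau>)) = q * nome (2 * z)"
        by (simp add: q_def distrib_left nome_add)
      ultimately show ?thesis
        using jacobi_prod_shift[OF q, of "nome (2 * z)"] by (simp add: f_def)
    qed
    moreover have "g (z + \<tau>) = g z" for z
    proof -
      have "2 * (z + \<tau>) / \<tau> = 2 * z / \<tau> + 2" using \<tau>0 by (simp add: field_simps)
      then show ?thesis by (simp add: g_def nome_add)
    qed
    ultimately show ?thesis unfolding w by (intro exI[of _ "\<lambda>_. 1"]) auto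
  qed
  have "f 0 = 0"
    using jacobi_prod_eq_0_iff[OF q, of 1] by (auto simp: f_def intro!: exI[of _ 0])
  moreover have "deriv g 0 \<noteq> 0" using A \<tau>0 by (simp add: dg)
  moreover have "g z \<noteq> 0" using nz by (simp add: g_def q'_def)
  ultimately have fz: "f z = deriv f 0 / deriv g 0 * g z"
    using quasi_periodic_quotient[OF \<tau> hol per zeros] by blast
  have "deriv f 0 / deriv g 0 = \<tau> * euler_prod q ^ 2 / euler_prod q' ^ 2"
    using \<tau>0 A by (simp add: df dg field_simps)
  from fz[unfolded this] show ?thesis unfolding f_def g_def q_def q'_def .
qed

text \<open>The fourth power of Dedekind's eta function, nome(\<tau>/3) being q^(1/6). For this
  power the inversion formula involves no square root of \<tau>.\<close>

definition eta4 :: "complex \<Rightarrow> complex" where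
  "eta4 \<tau> = nome (\<tau> / 3) * euler_prod (nome (2 * \<tau>)) ^ 4"

text \<open>The inversion of the sixth power of eta. The relation for Jacobi's product is multiplied
  over z = 1/2, \<tau>/2 and (1 + \<tau>)/2; the theta values contribute 2 on both sides, and what
  remains is \<open>C ^ 3\<close> against exponential factors.\<close>

lemma eta_pow6_modular:
  assumes \<tau>: "Im \<tau> > 0"
  shows "\<tau> ^ 3 * (nome (\<tau> / 2) * euler_prod (nome (2 * \<tau>)) ^ 6)
    = - \<i> * (nome (- 1 / (2 * \<tau>)) * euler_prod (nome (- 2 / \<tau>)) ^ 6)"
proof -
  define y where "y = nome \<tau>"
  define y' where "y' = nome (- 1 / \<tau>)"
  have \<tau>0: "\<tau> \<noteq> 0" using \<tau> by auto
  have y: "norm y < 1" "y \<noteq> 0" and y': "norm y' < 1" "y' \<noteq> 0"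
    unfolding y_def y'_def using norm_nome_less_1[OF \<tau>] norm_nome_less_1[OF Im_minus_inverse_pos[OF \<tau>]] by auto
  have q: "nome (2 * \<tau>) = y\<^sup>2" and q': "nome (- 2 / \<tau>) = y'\<^sup>2"
    by (simp_all add: y_def y'_def nome_power)
  have y'2: "norm (y'\<^sup>2) < 1" using norm_power_less_1[OF y'(1), of 2] by simp
  define C where "C = \<tau> * euler_prod (y\<^sup>2) ^ 2 / euler_prod (y'\<^sup>2) ^ 2"
  define J where "J = jacobi_prod (y\<^sup>2)"
  define J' where "J' = jacobi_prod (y'\<^sup>2)"
  have J: "J (-1) * J y * J (- y) = 2" and J': "J' (-1) * J' y' * J' (- y') = 2"
    unfolding J_def J'_def using jacobi_prod_half_periods y y' by blast+
  \<comment> \<open>For z = 1/2 and z = (1 + \<tau>)/2 the inverted variable is 1/y' and -1/y'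
    rather than y' and -y'; one quasi-period brings it back to the half periods.\<close>
  have "J' (y'\<^sup>2 * (1 / y')) = - (1 / (1 / y')) * J' (1 / y')"
    unfolding J'_def using y' y'2 by (intro jacobi_prod_shift) auto
  moreover have "y'\<^sup>2 * (1 / y') = y'" using y' by (simp add: power2_eq_square)
  ultimately have J'1: "J' (1 / y') = - (1 / y') * J' y'" using y' by (simp add: field_simps)
  have "J' (y'\<^sup>2 * (- 1 / y')) = - (1 / (- 1 / y')) * J' (- 1 / y')"
    unfolding J'_def using y' y'2 by (intro jacobi_prod_shift) auto
  moreover have "y'\<^sup>2 * (- 1 / y') = - y'" using y' by (simp add: power2_eq_square)
  ultimately have J'2: "J' (- 1 / y') = 1 / y' * J' (- y')" using y' by (simp add: field_simps)
  have nz: "J' (-1) \<noteq> 0" "J' (1 / y') \<noteq> 0" "J' (- 1 / y') \<noteq> 0"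
    unfolding J'1 J'2 using J' y' by auto
  have main: "nome (z\<^sup>2 / \<tau> + z / \<tau> - z) * J (nome (2 * z)) = C * J' (nome (2 * z / \<tau>))"
    if "J' (nome (2 * z / \<tau>)) \<noteq> 0" for z
    using that unfolding J_def J'_def C_def q[symmetric] q'[symmetric] by (rule jacobi_prod_modular[OF \<tau>])
  have inv: "nome (1 / \<tau>) = 1 / y'" by (simp add: y'_def nome_minus divide_inverse)
  have e1: "nome (1 / (4 * \<tau>) + 1 / (2 * \<tau>) - 1 / 2) * J (-1) = C * J' (1 / y')"
    using main[of "1 / 2"] nz by (simp add: inv power2_eq_square)
  have e2: "nome (\<tau> / 4 + 1 / 2 - \<tau> / 2) * J y = C * J' (-1)"
    using main[of "\<tau> / 2"] nz \<tau>0 by (simp add: power2_eq_square y_def)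
  have a: "nome (1 + \<tau>) = - y" by (simp add: nome_add y_def)
  have b: "nome ((1 + \<tau>) / \<tau>) = - 1 / y'"
  proof -
    have "(1 + \<tau>) / \<tau> = 1 / \<tau> + 1" using \<tau>0 by (simp add: field_simps)
    then show ?thesis by (simp add: nome_add inv)
  qed
  have e3: "nome (((1 + \<tau>) / 2)\<^sup>2 / \<tau> + (1 + \<tau>) / 2 / \<tau> - (1 + \<tau>) / 2) * J (- y) = C * J' (- 1 / y')"
  proof -
    have h: "2 * ((1 + \<tau>) / 2) = 1 + \<tau>" by simp
    show ?thesis
      using main[of "(1 + \<tau>) / 2"] nz unfolding h a b by blast
  qed
  \<comment> \<open>The sum of the three Gaussian exponents.\<close>
  define S where "S = 3 / (2 * \<tau>) + 1 / 2 - \<tau> / 2"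
  have "(1 / (4 * \<tau>) + 1 / (2 * \<tau>) - 1 / 2) + (\<tau> / 4 + 1 / 2 - \<tau> / 2)
      + (((1 + \<tau>) / 2)\<^sup>2 / \<tau> + (1 + \<tau>) / 2 / \<tau> - (1 + \<tau>) / 2) = S"
    using \<tau>0 by (simp add: S_def field_simps power2_eq_square)
  then have "nome S = nome (1 / (4 * \<tau>) + 1 / (2 * \<tau>) - 1 / 2) * nome (\<tau> / 4 + 1 / 2 - \<tau> / 2)
      * nome (((1 + \<tau>) / 2)\<^sup>2 / \<tau> + (1 + \<tau>) / 2 / \<tau> - (1 + \<tau>) / 2)"
    by (metis nome_add)
  then have "nome S * (J (-1) * J y * J (- y)) = (nome (1 / (4 * \<tau>) + 1 / (2 * \<tau>) - 1 / 2) * J (-1))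
      * (nome (\<tau> / 4 + 1 / 2 - \<tau> / 2) * J y)
      * (nome (((1 + \<tau>) / 2)\<^sup>2 / \<tau> + (1 + \<tau>) / 2 / \<tau> - (1 + \<tau>) / 2) * J (- y))"
    by (simp only: mult_ac)
  also have "\<dots> = C ^ 3 * (- (1 / y'\<^sup>2)) * (J' (-1) * J' y' * J' (- y'))"
    unfolding e1 e2 e3 J'1 J'2 by (simp add: power3_eq_cube power2_eq_square)
  finally have "nome S * 2 = C ^ 3 * (- (1 / y'\<^sup>2)) * 2"
    unfolding J J' .
  then have "nome S = C ^ 3 * (- (1 / y'\<^sup>2))"
    by (simp only: mult_cancel_right) simp
  then have "nome S * y'\<^sup>2 = - (C ^ 3)"
    using y' by simp
  moreover have "nome S * y'\<^sup>2 = \<i> * nome (- 1 / (2 * \<tau>)) / nome (\<tau> / 2)"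
  proof -
    have "nome S * y'\<^sup>2 = nome (S + - 2 / \<tau>)" by (simp only: nome_add q')
    also have "S + - 2 / \<tau> = 1 / 2 + - 1 / (2 * \<tau>) - \<tau> / 2"
      using \<tau>0 by (simp add: S_def field_simps)
    also have "nome \<dots> = \<i> * nome (- 1 / (2 * \<tau>)) / nome (\<tau> / 2)"
      by (simp only: nome_add nome_diff nome_half)
    finally show ?thesis .
  qed
  ultimately have "C ^ 3 = - (\<i> * nome (- 1 / (2 * \<tau>)) / nome (\<tau> / 2))" by simp
  moreover have "C ^ 3 = \<tau> ^ 3 * euler_prod (y\<^sup>2) ^ 6 / euler_prod (y'\<^sup>2) ^ 6"
    by (simp add: C_def power_divide power_mult_distrib flip: power_mult)
  ultimately have X: "\<tau> ^ 3 * euler_prod (y\<^sup>2) ^ 6 / euler_prod (y'\<^sup>2) ^ 6 = - (\<i> * nome (- 1 / (2 * \<tau>)) / nome (\<tau> / 2))"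
    by simp
  have "\<tau> ^ 3 * (nome (\<tau> / 2) * euler_prod (y\<^sup>2) ^ 6)
    = (\<tau> ^ 3 * euler_prod (y\<^sup>2) ^ 6 / euler_prod (y'\<^sup>2) ^ 6) * (nome (\<tau> / 2) * euler_prod (y'\<^sup>2) ^ 6)"
    using euler_prod_nonzero[OF y'2] by simp
  also have "\<dots> = - \<i> * (nome (- 1 / (2 * \<tau>)) * euler_prod (y'\<^sup>2) ^ 6)"
    unfolding X by simp
  finally show ?thesis unfolding q q' .
qed

lemma eta4_nonzero: "Im \<tau> > 0 \<Longrightarrow> eta4 \<tau> \<noteq> 0"
  by (auto simp: eta4_def intro!: euler_prod_nonzero norm_nome_less_1)

lemma eta4_holomorphic: "eta4 holomorphic_on {\<tau>. Im \<tau> > 0}"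
  unfolding eta4_def by (intro holomorphic_intros) (auto intro!: norm_nome_less_1)

text \<open>Squaring the relation for the sixth power gives the cube of the claim, so the quotient
  \<open>f\<close> of both sides takes cube roots of unity as values. Being continuous on a
  connected set it is constant, and at the fixed point i of the inversion it is 1.\<close>

lemma eta4_inversion:
  assumes \<tau>: "Im \<tau> > 0"
  shows "eta4 (- 1 / \<tau>) = - (\<tau>\<^sup>2) * eta4 \<tau>"
proof -
  define f where "f = (\<lambda>\<tau>. eta4 (- 1 / \<tau>) / (- (\<tau>\<^sup>2) * eta4 \<tau>))"
  define H where "H = {\<tau>. Im \<tau> > 0}"
  have cube: "f \<tau> ^ 3 = 1" if "Im \<tau> > 0" for \<tau>
  proof -
    have e3: "eta4 \<tau> ^ 3 = (nome (\<tau> / 2) * euler_prod (nome (2 * \<tau>)) ^ 6)\<^sup>2" for \<tau>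
      by (simp add: eta4_def power_mult_distrib nome_power flip: power_mult)
    have e3': "eta4 (- 1 / \<tau>) ^ 3 = (nome (- 1 / (2 * \<tau>)) * euler_prod (nome (- 2 / \<tau>)) ^ 6)\<^sup>2"
      using e3[of "- 1 / \<tau>"] by (simp add: mult.commute)
    have "(\<tau> ^ 3)\<^sup>2 * eta4 \<tau> ^ 3 = (- \<i>)\<^sup>2 * eta4 (- 1 / \<tau>) ^ 3"
      unfolding e3[of \<tau>] e3' power_mult_distrib[symmetric] by (simp only: eta_pow6_modular[OF that])
    then have "eta4 (- 1 / \<tau>) ^ 3 = (- (\<tau>\<^sup>2) * eta4 \<tau>) ^ 3"
      by (simp add: power_mult_distrib flip: power_mult)
    moreover have "(- (\<tau>\<^sup>2) * eta4 \<tau>) ^ 3 \<noteq> 0"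
      using that eta4_nonzero[OF that] by auto
    ultimately show ?thesis by (simp add: f_def power_divide del: power_mult_distrib)
  qed
  have "continuous_on H f"
  proof (rule holomorphic_on_imp_continuous_on)
    have "(\<lambda>\<tau>. - 1 / \<tau>) holomorphic_on H"
      by (intro holomorphic_intros) (auto simp: H_def)
    moreover have "(\<lambda>\<tau>. - 1 / \<tau>) ` H \<subseteq> {\<tau>. Im \<tau> > 0}"
      using Im_minus_inverse_pos unfolding H_def by blast
    ultimately have "(\<lambda>\<tau>. eta4 (- 1 / \<tau>)) holomorphic_on H"
      using holomorphic_on_compose_gen[OF _ eta4_holomorphic] unfolding o_def by blast
    then show "f holomorphic_on H"
      unfolding f_def using eta4_holomorphic eta4_nonzero
      by (auto simp: H_def intro!: holomorphic_intros)
  qed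
  moreover have "connected H"
    unfolding H_def by (simp add: convex_connected convex_halfspace_Im_gt)
  moreover have "finite (f ` H)"
  proof (rule finite_subset)
    show "f ` H \<subseteq> {z. z ^ 3 = 1}" using cube by (auto simp: H_def)
    show "finite {z::complex. z ^ 3 = 1}" by (rule finite_roots_unity) simp
  qed
  ultimately have "f constant_on H"
    by (intro continuous_finite_range_constant)
  then obtain b where b: "\<And>\<sigma>. \<sigma> \<in> H \<Longrightarrow> f \<sigma> = b"
    by (auto simp: constant_on_def)
  have "\<tau> \<in> H" "\<i> \<in> H" by (simp_all add: H_def \<tau>)
  then have "f \<tau> = f \<i>" by (simp only: b)
  also have "f \<i> = 1" using eta4_nonzero[of \<i>] by (simp add: f_def)
  finally have f1: "f \<tau> = 1" .
  have ne: "- (\<tau>\<^sup>2) * eta4 \<tau> \<noteq> 0" using eta4_nonzero[OF \<tau>] \<tau> by auto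
  show ?thesis
    by (rule iffD1[OF right_inverse_eq[OF ne] f1[unfolded f_def]])
qed

section \<open>Theta constants and the Hauptmodul\<close>

text \<open>In classical notation, with nome y: 16 y theta_a(y) is theta_2^4, theta_b(y) is
  theta_4^4 and theta_b(-y) is theta_3^4. The factor 16 y is kept apart so that
  \<open>theta_a\<close> has constant term 1.\<close>

definition theta_a :: "complex \<Rightarrow> complex" where
  "theta_a y = euler_prod (y ^ 4) ^ 8 / euler_prod (y\<^sup>2) ^ 4"

definition theta_b :: "complex \<Rightarrow> complex" where
  "theta_b y = euler_prod y ^ 8 / euler_prod (y\<^sup>2) ^ 4"

text \<open>The fourth powers of the theta constants, with the sign of the second one reversed so that
  the full modular group permutes them up to a common sign.\<close>

definition theta4 :: "3 \<Rightarrow> complex \<Rightarrow> complex" where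
  "theta4 i \<tau> = (if i = 1 then 16 * nome \<tau> * theta_a (nome \<tau>)
     else if i = 2 then - theta_b (- nome \<tau>) else theta_b (nome \<tau>))"

text \<open>The permutations underlying \<rho>(T) and \<rho>(S). Index 1 belongs to the cusp
  infinity; 2 and 3 belong to the cusp 0, which has width 2, and T exchanges them.\<close>

definition permT :: "3 \<Rightarrow> 3" where
  "permT i = (if i = 1 then 1 else if i = 2 then 3 else 2)"

definition permS :: "3 \<Rightarrow> 3" where
  "permS i = (if i = 1 then 3 else if i = 2 then 2 else 1)"

text \<open>Encodes a scalar form on Gamma_0(2) by its conjugates over the three cosets. One scalar
  \<open>s\<close> serves both generators, just as \<epsilon> does in \<rho>.\<close>

definition perm_form :: "int \<Rightarrow> complex \<Rightarrow> (3 \<Rightarrow> complex \<Rightarrow> complex) \<Rightarrow> bool" where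
  "perm_form k s G \<longleftrightarrow> (\<forall>i \<tau>. Im \<tau> > 0 \<longrightarrow>
     G i (\<tau> + 1) = s * G (permT i) \<tau> \<and> G i (- 1 / \<tau>) = s * \<tau> powi k * G (permS i) \<tau>)"

lemma perm_formD:
  assumes "perm_form k s G" "Im \<tau> > 0"
  shows "G i (\<tau> + 1) = s * G (permT i) \<tau>" "G i (- 1 / \<tau>) = s * \<tau> powi k * G (permS i) \<tau>"
  using assms by (auto simp: perm_form_def)

lemma perm_form_mult:
  assumes "perm_form k s G" "perm_form l t H"
  shows "perm_form (k + l) (s * t) (\<lambda>i \<tau>. G i \<tau> * H i \<tau>)"
  unfolding perm_form_def
proof safe
  fix i \<tau> assume \<tau>: "Im \<tau> > 0"
  then have "\<tau> \<noteq> 0" by auto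
  with \<tau> show "G i (\<tau> + 1) * H i (\<tau> + 1) = s * t * (G (permT i) \<tau> * H (permT i) \<tau>)"
    "G i (- 1 / \<tau>) * H i (- 1 / \<tau>) = s * t * \<tau> powi (k + l) * (G (permS i) \<tau> * H (permS i) \<tau>)"
    using perm_formD[OF assms(1) \<tau>] perm_formD[OF assms(2) \<tau>]
    by (simp_all only: power_int_add mult_ac simp_thms)
qed

lemma perm_form_powi:
  assumes "perm_form k s G"
  shows "perm_form (k * m) (s powi m) (\<lambda>i \<tau>. G i \<tau> powi m)"
  unfolding perm_form_def
proof safe
  fix i \<tau> assume \<tau>: "Im \<tau> > 0"
  show "G i (\<tau> + 1) powi m = s powi m * G (permT i) \<tau> powi m"
    "G i (- 1 / \<tau>) powi m = s powi m * \<tau> powi (k * m) * G (permS i) \<tau> powi m"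
    by (simp_all only: perm_formD[OF assms \<tau>] power_int_mult_distrib power_int_mult)
qed

lemma perm_form_power:
  assumes "perm_form k s G"
  shows "perm_form (k * int m) (s ^ m) (\<lambda>i \<tau>. G i \<tau> ^ m)"
  using perm_form_powi[OF assms, of "int m"] by (simp only: power_int_of_nat)

lemma prod_permT: "f (permT 1) * f (permT 2) * f (permT 3) = f 1 * f 2 * (f 3 :: complex)"
  and prod_permS: "f (permS 1) * f (permS 2) * f (permS 3) = f 1 * f 2 * (f 3 :: complex)"
  by (simp_all add: permT_def permS_def)

lemma perm_form_prod:
  assumes "perm_form k s G"
  shows "perm_form (3 * k) (s ^ 3) (\<lambda>_ \<tau>. G 1 \<tau> * G 2 \<tau> * G 3 \<tau>)"
  unfolding perm_form_def
proof safe
  fix \<tau> assume \<tau>: "Im \<tau> > 0"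
  have "G 1 (\<tau> + 1) * G 2 (\<tau> + 1) * G 3 (\<tau> + 1) = s ^ 3 * (G (permT 1) \<tau> * G (permT 2) \<tau> * G (permT 3) \<tau>)"
    by (simp only: perm_formD[OF assms \<tau>] power3_eq_cube mult_ac)
  then show "G 1 (\<tau> + 1) * G 2 (\<tau> + 1) * G 3 (\<tau> + 1) = s ^ 3 * (G 1 \<tau> * G 2 \<tau> * G 3 \<tau>)"
    by (simp only: prod_permT[of "\<lambda>i. G i \<tau>"])
  have "\<tau> powi (3 * k) = (\<tau> powi k) ^ 3"
    by (simp only: mult.commute[of 3] power_int_mult power_int_numeral)
  then have "G 1 (- 1 / \<tau>) * G 2 (- 1 / \<tau>) * G 3 (- 1 / \<tau>)
      = s ^ 3 * \<tau> powi (3 * k) * (G (permS 1) \<tau> * G (permS 2) \<tau> * G (permS 3) \<tau>)"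
    by (simp only: perm_formD[OF assms \<tau>] power3_eq_cube mult_ac)
  then show "G 1 (- 1 / \<tau>) * G 2 (- 1 / \<tau>) * G 3 (- 1 / \<tau>) = s ^ 3 * \<tau> powi (3 * k) * (G 1 \<tau> * G 2 \<tau> * G 3 \<tau>)"
    by (simp only: prod_permS[of "\<lambda>i. G i \<tau>"])
qed

text \<open>The product formulas are the fourth power of theta_2 theta_3 theta_4 = 2 eta^3; they
  follow from Euler's identity raised to the eighth power.\<close>

lemma theta4_eq_eta4:
  assumes \<tau>: "Im \<tau> > 0"
  shows "theta4 1 \<tau> = 16 * eta4 (2 * \<tau>) ^ 2 / eta4 \<tau>"
    and "theta4 3 \<tau> = eta4 (\<tau> / 2) ^ 2 / eta4 \<tau>"
    and "theta4 1 \<tau> * theta4 2 \<tau> * theta4 3 \<tau> = - 16 * nome \<tau> * euler_prod (nome \<tau> ^ 2) ^ 12"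
    and "theta4 1 \<tau> * theta4 2 \<tau> * theta4 3 \<tau> = - 16 * eta4 \<tau> ^ 3"
proof -
  define y where "y = nome \<tau>"
  have y: "norm y < 1" by (simp add: y_def norm_nome_less_1 \<tau>)
  have y2: "norm (y\<^sup>2) < 1" using norm_power_less_1[OF y, of 2] by simp
  have A: "euler_prod (y\<^sup>2) \<noteq> 0" using euler_prod_nonzero y2 by blast
  have n: "nome (2 * \<tau>) = y\<^sup>2" "nome (4 * \<tau>) = y ^ 4" by (simp_all add: y_def nome_power)
  have e: "eta4 \<tau> = nome (\<tau> / 3) * euler_prod (y\<^sup>2) ^ 4"
    "eta4 (2 * \<tau>) = nome (2 * \<tau> / 3) * euler_prod (y ^ 4) ^ 4"
    "eta4 (\<tau> / 2) = nome (\<tau> / 6) * euler_prod y ^ 4"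
    by (simp_all add: eta4_def n y_def[symmetric])
  have "nome (2 * \<tau> / 3) ^ 2 = nome (\<tau> / 3) * y"
    by (simp add: y_def nome_power flip: nome_add)
  then have "16 * eta4 (2 * \<tau>) ^ 2 / eta4 \<tau> = 16 * (nome (\<tau> / 3) * y * euler_prod (y ^ 4) ^ 8) / (nome (\<tau> / 3) * euler_prod (y\<^sup>2) ^ 4)"
    unfolding e power_mult_distrib by (simp flip: power_mult)
  then show "theta4 1 \<tau> = 16 * eta4 (2 * \<tau>) ^ 2 / eta4 \<tau>"
    by (simp add: theta4_def theta_a_def y_def[symmetric])
  have "nome (\<tau> / 6) ^ 2 = nome (\<tau> / 3)"
    by (simp add: nome_power)
  then have "eta4 (\<tau> / 2) ^ 2 / eta4 \<tau> = (nome (\<tau> / 3) * euler_prod y ^ 8) / (nome (\<tau> / 3) * euler_prod (y\<^sup>2) ^ 4)"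
    unfolding e power_mult_distrib by (simp flip: power_mult)
  then show "theta4 3 \<tau> = eta4 (\<tau> / 2) ^ 2 / eta4 \<tau>"
    by (simp add: theta4_def theta_b_def y_def[symmetric])
  have "theta4 1 \<tau> * theta4 2 \<tau> * theta4 3 \<tau>
    = - 16 * y * ((euler_prod y * euler_prod (- y) * euler_prod (y ^ 4)) ^ 8 / euler_prod (y\<^sup>2) ^ 12)"
    by (simp add: theta4_def theta_a_def theta_b_def y_def[symmetric] power_mult_distrib mult_ac flip: power_add)
  also have "\<dots> = - 16 * y * (euler_prod (y\<^sup>2) ^ 24 / euler_prod (y\<^sup>2) ^ 12)"
    by (simp add: euler_prod_identity[OF y] flip: power_mult)
  also have "euler_prod (y\<^sup>2) ^ 24 / euler_prod (y\<^sup>2) ^ 12 = euler_prod (y\<^sup>2) ^ 12"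
    using A by (simp add: field_simps flip: power_add)
  finally show 1: "theta4 1 \<tau> * theta4 2 \<tau> * theta4 3 \<tau> = - 16 * nome \<tau> * euler_prod (nome \<tau> ^ 2) ^ 12"
    by (simp add: y_def)
  show "theta4 1 \<tau> * theta4 2 \<tau> * theta4 3 \<tau> = - 16 * eta4 \<tau> ^ 3"
    unfolding 1 by (simp add: eta4_def power_mult_distrib nome_power flip: power_mult)
qed

lemma theta4_nonzero:
  assumes "Im \<tau> > 0"
  shows "theta4 i \<tau> \<noteq> 0"
  using exhaust_3[of i] theta4_eq_eta4(4)[OF assms] eta4_nonzero[OF assms] by auto

text \<open>Indices 1 and 3 are eta quotients involving 2 \<tau> and \<tau>/2, which the inversion
  exchanges. The law for index 2 under S is obtained by dividing them out of the law for the product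
  of all three.\<close>

lemma perm_form_theta4: "perm_form 2 (- 1) theta4"
  unfolding perm_form_def forall_3
proof (intro conjI allI impI)
  fix \<tau> :: complex assume \<tau>: "Im \<tau> > 0"
  have \<tau>0: "\<tau> \<noteq> 0" using \<tau> by auto
  show "theta4 1 (\<tau> + 1) = - 1 * theta4 (permT 1) \<tau>" "theta4 2 (\<tau> + 1) = - 1 * theta4 (permT 2) \<tau>"
    "theta4 3 (\<tau> + 1) = - 1 * theta4 (permT 3) \<tau>"
    by (simp_all add: theta4_def permT_def nome_add theta_a_def)
  have \<tau>': "Im (- 1 / \<tau>) > 0" by (rule Im_minus_inverse_pos[OF \<tau>])
  have e: "eta4 (- 1 / \<tau>) = - (\<tau>\<^sup>2) * eta4 \<tau>"
    by (rule eta4_inversion[OF \<tau>])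
  have h: "eta4 (2 * (- 1 / \<tau>)) = - ((\<tau> / 2)\<^sup>2) * eta4 (\<tau> / 2)"
    using eta4_inversion[of "\<tau> / 2"] \<tau> by simp
  then have S1: "theta4 1 (- 1 / \<tau>) = - (\<tau>\<^sup>2) * theta4 3 \<tau>"
    unfolding theta4_eq_eta4(1)[OF \<tau>'] theta4_eq_eta4(2)[OF \<tau>] e h
    using \<tau>0 eta4_nonzero[OF \<tau>] by (simp add: field_simps power2_eq_square)
  have h': "eta4 (- 1 / \<tau> / 2) = - ((2 * \<tau>)\<^sup>2) * eta4 (2 * \<tau>)"
    using eta4_inversion[of "2 * \<tau>"] \<tau> by (simp add: mult.commute)
  then have S3: "theta4 3 (- 1 / \<tau>) = - (\<tau>\<^sup>2) * theta4 1 \<tau>"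
    unfolding theta4_eq_eta4(2)[OF \<tau>'] theta4_eq_eta4(1)[OF \<tau>] e h'
    using \<tau>0 eta4_nonzero[OF \<tau>] by (simp add: field_simps power2_eq_square)
  have "theta4 1 (- 1 / \<tau>) * theta4 2 (- 1 / \<tau>) * theta4 3 (- 1 / \<tau>) = - (\<tau> ^ 6) * (theta4 1 \<tau> * theta4 2 \<tau> * theta4 3 \<tau>)"
    unfolding theta4_eq_eta4(4)[OF \<tau>] theta4_eq_eta4(4)[OF \<tau>'] e
    by (simp add: power_mult_distrib flip: power_mult)
  then have "(theta4 1 \<tau> * theta4 3 \<tau> * \<tau> ^ 4) * theta4 2 (- 1 / \<tau>) = (theta4 1 \<tau> * theta4 3 \<tau> * \<tau> ^ 4) * (- (\<tau>\<^sup>2) * theta4 2 \<tau>)"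
    unfolding S1 S3 by (simp add: algebra_simps flip: power_add)
  then have S2: "theta4 2 (- 1 / \<tau>) = - (\<tau>\<^sup>2) * theta4 2 \<tau>"
    using theta4_nonzero[OF \<tau>] \<tau>0 by (simp only: mult_cancel_left) auto
  show "theta4 1 (- 1 / \<tau>) = - 1 * \<tau> powi 2 * theta4 (permS 1) \<tau>" "theta4 2 (- 1 / \<tau>) = - 1 * \<tau> powi 2 * theta4 (permS 2) \<tau>"
    "theta4 3 (- 1 / \<tau>) = - 1 * \<tau> powi 2 * theta4 (permS 3) \<tau>"
    unfolding S1 S2 S3 by (simp_all add: permS_def)
qed

lemma euler_prod_power_nonzero: "y \<in> ball 0 1 \<Longrightarrow> k > 0 \<Longrightarrow> euler_prod (y ^ k) \<noteq> 0"
  by (intro euler_prod_nonzero norm_power_less_1) auto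

lemma euler_prod_power_holomorphic: "k > 0 \<Longrightarrow> (\<lambda>y. euler_prod (y ^ k)) holomorphic_on ball 0 1"
  by (intro holomorphic_intros norm_power_less_1) auto

lemma theta_a_holomorphic: "theta_a holomorphic_on ball 0 1"
  unfolding theta_a_def
  by (intro holomorphic_on_divide holomorphic_on_power euler_prod_power_holomorphic)
     (simp_all add: euler_prod_power_nonzero)

lemma theta_b_holomorphic: "theta_b holomorphic_on ball 0 1"
  unfolding theta_b_def
  by (intro holomorphic_on_divide holomorphic_on_power euler_prod_power_holomorphic euler_prod_holomorphic)
     (simp_all add: euler_prod_power_nonzero)

text \<open>Cube and product have the same weight and sign, so the quotient is invariant. Index 1 is
  -256 (eta(2 \<tau>)/eta(\<tau>))^24, and the other two are its conjugates at the cusp 0.\<close>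

definition hauptmodul :: "3 \<Rightarrow> complex \<Rightarrow> complex" where
  "hauptmodul i \<tau> = theta4 i \<tau> ^ 3 / (theta4 1 \<tau> * theta4 2 \<tau> * theta4 3 \<tau>)"

text \<open>S and T act as transpositions, which reverse these cyclic differences and so cancel the
  sign -1 of \<open>theta4\<close>. Having weight 2 with either sign available later allows the
  weight and \<epsilon> to be removed at the same time.\<close>

definition theta4_diff :: "3 \<Rightarrow> complex \<Rightarrow> complex" where
  "theta4_diff i \<tau> = (if i = 1 then theta4 2 \<tau> - theta4 3 \<tau> else if i = 2 then theta4 3 \<tau> - theta4 1 \<tau>
     else theta4 1 \<tau> - theta4 2 \<tau>)"

lemma perm_form_hauptmodul: "perm_form 0 1 hauptmodul"
proof -
  have "perm_form (2 * int 3 + 3 * 2 * (-1)) ((-1) ^ 3 * ((-1) ^ 3) powi (-1))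
    (\<lambda>i \<tau>. theta4 i \<tau> ^ 3 * (theta4 1 \<tau> * theta4 2 \<tau> * theta4 3 \<tau>) powi (-1))"
    by (rule perm_form_mult[OF perm_form_power[OF perm_form_theta4] perm_form_powi[OF perm_form_prod[OF perm_form_theta4]]])
  moreover have "(\<lambda>i \<tau>. theta4 i \<tau> ^ 3 * (theta4 1 \<tau> * theta4 2 \<tau> * theta4 3 \<tau>) powi (-1)) = hauptmodul"
    by (simp add: hauptmodul_def fun_eq_iff power_int_minus divide_inverse)
  ultimately show ?thesis by (simp add: power_int_minus)
qed

lemma perm_form_theta4_diff: "perm_form 2 1 theta4_diff"
  unfolding perm_form_def forall_3
proof (intro conjI allI impI)
  fix \<tau> :: complex assume \<tau>: "Im \<tau> > 0"
  note D = perm_formD[OF perm_form_theta4 \<tau>]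
  show "theta4_diff 1 (\<tau> + 1) = 1 * theta4_diff (permT 1) \<tau>" "theta4_diff 2 (\<tau> + 1) = 1 * theta4_diff (permT 2) \<tau>"
    "theta4_diff 3 (\<tau> + 1) = 1 * theta4_diff (permT 3) \<tau>"
    by (simp_all add: theta4_diff_def D(1) permT_def)
  show "theta4_diff 1 (- 1 / \<tau>) = 1 * \<tau> powi 2 * theta4_diff (permS 1) \<tau>" "theta4_diff 2 (- 1 / \<tau>) = 1 * \<tau> powi 2 * theta4_diff (permS 2) \<tau>"
    "theta4_diff 3 (- 1 / \<tau>) = 1 * \<tau> powi 2 * theta4_diff (permS 3) \<tau>"
    unfolding theta4_diff_def D(2) by (simp_all add: permS_def algebra_simps)
qed

text \<open>The product of (1 - y^m)^24 over odd m, equivalently of (1 + y^m)^(-24) over all m >= 1: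
  the Hauptmodul up to inversion, a constant and a power of y.\<close>

definition odd_prod24 :: "complex \<Rightarrow> complex" where
  "odd_prod24 y = (euler_prod y / euler_prod (y\<^sup>2)) ^ 24"

lemma odd_prod24_holomorphic: "odd_prod24 holomorphic_on ball 0 1"
  unfolding odd_prod24_def
  by (intro holomorphic_on_divide holomorphic_on_power euler_prod_power_holomorphic euler_prod_holomorphic)
     (simp_all add: euler_prod_power_nonzero)

lemma odd_prod24_nonzero: "norm y < 1 \<Longrightarrow> odd_prod24 y \<noteq> 0"
  using euler_prod_power_nonzero[of y 2] euler_prod_nonzero[of y] by (simp add: odd_prod24_def)

lemma hauptmodul_eq:
  assumes \<tau>: "Im \<tau> > 0"
  shows "hauptmodul 1 \<tau> = - 256 * nome \<tau> ^ 2 / odd_prod24 (nome \<tau> ^ 2)"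
    and "hauptmodul 3 \<tau> = - 1 / 16 * odd_prod24 (nome \<tau>) / nome \<tau>"
    and "hauptmodul 2 \<tau> = hauptmodul 3 (\<tau> + 1)"
proof -
  define y where "y = nome \<tau>"
  have y: "norm y < 1" by (simp add: y_def norm_nome_less_1 \<tau>)
  have y0: "y \<noteq> 0" by (simp add: y_def)
  have A: "euler_prod (y\<^sup>2) \<noteq> 0" "euler_prod (y ^ 4) \<noteq> 0"
    using euler_prod_nonzero norm_power_less_1[OF y] by auto
  have "hauptmodul 1 \<tau> = (16 * y * (euler_prod (y ^ 4) ^ 8 / euler_prod (y\<^sup>2) ^ 4)) ^ 3 / (- 16 * y * euler_prod (y\<^sup>2) ^ 12)"
    unfolding hauptmodul_def theta4_eq_eta4(3)[OF \<tau>] by (simp add: theta4_def theta_a_def y_def)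
  also have "\<dots> = - 256 * y\<^sup>2 / (euler_prod (y\<^sup>2) / euler_prod (y ^ 4)) ^ 24"
    using y0 A by (simp add: power_mult_distrib power_divide field_simps power2_eq_square power3_eq_cube flip: power_mult power_add)
  finally show "hauptmodul 1 \<tau> = - 256 * nome \<tau> ^ 2 / odd_prod24 (nome \<tau> ^ 2)"
    by (simp add: odd_prod24_def y_def flip: power_mult)
  have "hauptmodul 3 \<tau> = (euler_prod y ^ 8 / euler_prod (y\<^sup>2) ^ 4) ^ 3 / (- 16 * y * euler_prod (y\<^sup>2) ^ 12)"
    unfolding hauptmodul_def theta4_eq_eta4(3)[OF \<tau>] by (simp add: theta4_def theta_b_def y_def)
  also have "\<dots> = - 1 / 16 * (euler_prod y / euler_prod (y\<^sup>2)) ^ 24 / y"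
    using y0 A by (simp add: power_divide field_simps flip: power_mult power_add)
  finally show "hauptmodul 3 \<tau> = - 1 / 16 * odd_prod24 (nome \<tau>) / nome \<tau>"
    by (simp add: odd_prod24_def y_def)
  show "hauptmodul 2 \<tau> = hauptmodul 3 (\<tau> + 1)"
    using perm_formD(1)[OF perm_form_hauptmodul \<tau>, of 3] by (simp add: permT_def)
qed

lemma hauptmodul_nonzero: "Im \<tau> > 0 \<Longrightarrow> hauptmodul i \<tau> \<noteq> 0"
  by (simp add: hauptmodul_def theta4_nonzero)

text \<open>Meant for the difference of two logarithms of one nonvanishing function: the derivative
  of exp(f) is 0, hence that of \<open>f\<close> is.\<close>

lemma exp_eq_1_imp_constant:
  assumes "open S" "connected S" "f holomorphic_on S" "\<And>z. z \<in> S \<Longrightarrow> exp (f z) = 1"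
  obtains c where "\<And>z. z \<in> S \<Longrightarrow> f z = c"
proof -
  have "(f has_field_derivative 0) (at z)" if "z \<in> S" for z
  proof -
    have f: "(f has_field_derivative deriv f z) (at z)"
      using assms that holomorphic_derivI by blast
    then have "((\<lambda>z. exp (f z)) has_field_derivative exp (f z) * deriv f z) (at z)"
      by (auto intro!: derivative_eq_intros)
    moreover have "((\<lambda>z. exp (f z)) has_field_derivative 0) (at z)"
      by (rule has_field_derivative_transform_within_open[of "\<lambda>_. 1" _ _ S])
         (use assms that in auto)
    ultimately have "exp (f z) * deriv f z = 0" by (rule DERIV_unique)
    then show ?thesis using f by simp
  qed
  then show ?thesis
    using DERIV_zero_connected_constant[OF assms(2,1), of "{}" f] assms(3) that
    by (metis Diff_empty finite.emptyI holomorphic_on_imp_continuous_on)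
qed

section \<open>Invariant functions are polynomials in the Hauptmodul\<close>

lemma euler_prod_0 [simp]: "euler_prod 0 = 1"
  by (simp add: euler_prod_def qpoch_def)

lemma odd_prod24_0 [simp]: "odd_prod24 0 = 1"
  by (simp add: odd_prod24_def)

text \<open>Carries identities from the half plane over to the punctured disc of the local parameter
  nome(\<tau>/n).\<close>

lemma nome_surj_disc:
  assumes "x \<noteq> 0" "norm x < 1" "n > 0"
  obtains \<tau> where "Im \<tau> > 0" "nome (\<tau> / of_nat n) = x"
proof -
  define \<tau> where "\<tau> = of_nat n * (Ln x / (of_real pi * \<i>))"
  have "nome (\<tau> / of_nat n) = x"
    using assms by (simp add: nome_def \<tau>_def)
  moreover have "Im \<tau> > 0"
  proof -
    have "ln (norm x) < 0" using assms by simp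
    moreover have "Im \<tau> = - (of_nat n * ln (norm x) / pi)"
      using assms by (simp add: \<tau>_def Im_divide power2_eq_square)
    ultimately show ?thesis using assms by (simp add: divide_neg_pos mult_pos_neg)
  qed
  ultimately show ?thesis using that by blast
qed

lemma permT_permT [simp]: "permT (permT i) = i" and permS_permS [simp]: "permS (permS i) = i"
  using exhaust_3[of i] by (auto simp: permT_def permS_def)

lemma perm_form_translate:
  assumes "perm_form k 1 G" "Im \<tau> > 0"
  shows "\<exists>j. G i \<tau> = G j (\<tau> + of_int m)"
proof -
  have nat: "\<exists>j. G i \<tau> = G j (\<tau> + of_nat m)" if "Im \<tau> > 0" for i m \<tau>
  proof (induction m)
    case (Suc m)
    then obtain j where "G i \<tau> = G j (\<tau> + of_nat m)" by blast
    also have "\<dots> = G (permT j) (\<tau> + of_nat m + 1)"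
      using perm_formD(1)[OF assms(1), of "\<tau> + of_nat m" "permT j"] that by simp
    finally show ?case by (auto simp: add_ac)
  qed (auto intro: exI[of _ i])
  show ?thesis
  proof (cases m)
    case (nonneg l)
    then show ?thesis using nat[OF assms(2)] by simp
  next
    case (neg l)
    have im: "Im (\<tau> + of_int m) > 0" using assms(2) by simp
    have bij: "\<exists>j'. G i' (\<tau>' + of_nat l') = G j' \<tau>'" if "Im \<tau>' > 0" for i' \<tau>' l'
      using that
    proof (induction l' arbitrary: i')
      case (Suc l')
      have "G i' (\<tau>' + of_nat (Suc l')) = G (permT i') (\<tau>' + of_nat l')"
        using perm_formD(1)[OF assms(1), of "\<tau>' + of_nat l'" i'] Suc.prems by (simp add: add_ac)
      then show ?case using Suc by simp
    qed auto
    have eq: "\<tau> + of_int m + of_nat (Suc l) = \<tau>" using neg by simp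
    show ?thesis using bij[OF im, of i "Suc l"] unfolding eq .
  qed
qed

text \<open>Below height 1/2, translating to |Re| <= 1/2 makes the squared absolute value less than
  1/2, so S at least doubles the imaginary part; finitely many doublings suffice. The height 1/2
  spares the exact fundamental domain.\<close>

lemma perm_form_fundamental_domain:
  assumes G: "perm_form 0 1 G" and \<tau>: "Im \<tau> > 0"
  obtains j \<tau>' where "Im \<tau>' \<ge> 1 / 2" "G i \<tau> = G j \<tau>'"
proof -
  have *: "\<exists>j \<tau>'. Im \<tau>' \<ge> 1 / 2 \<and> G i \<tau> = G j \<tau>'" if "Im \<tau> > 0" "Im \<tau> \<ge> 1 / 2 ^ k" for k i \<tau>
    using that
  proof (induction k arbitrary: \<tau> i)
    case 0
    then show ?case by (intro exI[of _ i] exI[of _ \<tau>]) auto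
  next
    case (Suc k)
    show ?case
    proof (cases "Im \<tau> \<ge> 1 / 2")
      case True
      then show ?thesis by blast
    next
      case False
      define \<sigma> where "\<sigma> = \<tau> + of_int (- round (Re \<tau>))"
      obtain j where j: "G i \<tau> = G j \<sigma>"
        using perm_form_translate[OF G Suc.prems(1)] unfolding \<sigma>_def by metis
      have im: "Im \<sigma> = Im \<tau>" by (simp add: \<sigma>_def)
      have "\<bar>Re \<sigma>\<bar> \<le> 1 / 2"
        using of_int_round_abs_le[of "Re \<tau>"] by (simp add: \<sigma>_def abs_minus_commute)
      then have "(Re \<sigma>)\<^sup>2 \<le> (1 / 2)\<^sup>2"
        by (metis abs_ge_zero power2_abs power_mono)
      moreover have "(Im \<sigma>)\<^sup>2 < (1 / 2)\<^sup>2"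
        using False Suc.prems(1) im by (intro power_strict_mono) auto
      ultimately have nrm: "(Re \<sigma>)\<^sup>2 + (Im \<sigma>)\<^sup>2 < 1 / 2" by (simp add: power2_eq_square)
      have pos: "(Re \<sigma>)\<^sup>2 + (Im \<sigma>)\<^sup>2 > 0"
        using Suc.prems(1) im by (simp add: sum_power2_gt_zero_iff)
      have imS: "Im (- 1 / \<sigma>) = Im \<sigma> / ((Re \<sigma>)\<^sup>2 + (Im \<sigma>)\<^sup>2)"
        by (simp add: Im_divide)
      have "2 * Im \<sigma> \<le> Im (- 1 / \<sigma>)"
      proof -
        have "2 * Im \<sigma> * ((Re \<sigma>)\<^sup>2 + (Im \<sigma>)\<^sup>2) \<le> 2 * Im \<sigma> * (1 / 2)"
          using nrm Suc.prems(1) im by (intro mult_left_mono) auto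
        then show ?thesis unfolding imS using pos by (simp add: field_simps)
      qed
      moreover have "2 * Im \<sigma> \<ge> 1 / 2 ^ k" using Suc.prems(2) im by simp
      ultimately have "Im (- 1 / \<sigma>) > 0" "Im (- 1 / \<sigma>) \<ge> 1 / 2 ^ k"
        using Suc.prems(1) im by linarith+
      then obtain l \<tau>' where "Im \<tau>' \<ge> 1 / 2" "G (permS j) (- 1 / \<sigma>) = G l \<tau>'"
        using Suc.IH by blast
      moreover have "G j \<sigma> = G (permS j) (- 1 / \<sigma>)"
        using perm_formD(2)[OF G, of \<sigma> "permS j"] Suc.prems(1) im by simp
      ultimately show ?thesis using j by metis
    qed
  qed
  obtain k where "(1 / 2) ^ k < Im \<tau>"
    using real_arch_pow_inv[OF \<tau>, of "1 / 2"] by auto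
  then have "Im \<tau> \<ge> 1 / 2 ^ k" by (simp add: power_divide)
  then show ?thesis using *[OF \<tau>] that by blast
qed

text \<open>Every value of a component is also a value of some component at height >= 1/2, that is,
  in a smaller closed disc of the local parameter. The largest of the maxima over these discs is
  thus a global maximum at an interior point, and the maximum principle applies.\<close>

lemma perm_form_constant:
  assumes G: "perm_form 0 1 G" and n: "n > 0"
    and g: "\<And>i. g i holomorphic_on ball 0 1" "\<And>i \<tau>. Im \<tau> > 0 \<Longrightarrow> G i \<tau> = g i (nome (\<tau> / of_nat n))"
  obtains c where "\<And>i \<tau>. Im \<tau> > 0 \<Longrightarrow> G i \<tau> = c"
proof -
  \<comment> \<open>The absolute value of nome(\<tau>/n) at Im \<tau> = 1/2.\<close>
  define \<rho> where "\<rho> = exp (- (pi / (2 * of_nat n)))"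
  have \<rho>: "0 \<le> \<rho>" "\<rho> < 1" using n by (auto simp: \<rho>_def)
  have "\<exists>x\<in>cball 0 \<rho>. \<forall>y\<in>cball 0 \<rho>. norm (g i y) \<le> norm (g i x)" for i
  proof (rule continuous_attains_sup)
    have "g i holomorphic_on cball 0 \<rho>" by (rule holomorphic_on_subset[OF g(1)]) (use \<rho> in auto)
    then show "continuous_on (cball 0 \<rho>) (\<lambda>x. norm (g i x))"
      by (intro continuous_on_norm holomorphic_on_imp_continuous_on)
  qed (use \<rho> in auto)
  then obtain x where x: "\<And>i. x i \<in> cball 0 \<rho>" "\<And>i y. y \<in> cball 0 \<rho> \<Longrightarrow> norm (g i y) \<le> norm (g i (x i))"
    by metis
  obtain i0 where i0: "\<And>i. norm (g i (x i)) \<le> norm (g i0 (x i0))"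
  proof -
    have "Max (range (\<lambda>i. norm (g i (x i)))) \<in> range (\<lambda>i. norm (g i (x i)))"
      by (rule Max_in) auto
    then obtain i0 where i0: "Max (range (\<lambda>i. norm (g i (x i)))) = norm (g i0 (x i0))"
      by (rule imageE)
    have "norm (g i (x i)) \<le> norm (g i0 (x i0))" for i
      unfolding i0[symmetric] by (rule Max_ge) auto
    then show ?thesis by (rule that)
  qed
  have "g i0 constant_on ball 0 1"
  proof (rule maximum_modulus_principle[OF g(1), where U = "ball 0 1" and \<xi> = "x i0"])
    show "x i0 \<in> ball 0 1" using x(1)[of i0] \<rho> by simp
    fix z :: complex assume z: "z \<in> ball 0 1"
    show "norm (g i0 z) \<le> norm (g i0 (x i0))"
    proof (cases "z = 0")
      case True
      then show ?thesis using x(2)[of 0 i0] \<rho> by simp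
    next
      case False
      then obtain \<tau> where \<tau>: "Im \<tau> > 0" "nome (\<tau> / of_nat n) = z"
        using nome_surj_disc[OF False _ n] z by auto
      obtain j \<tau>' where j: "Im \<tau>' \<ge> 1 / 2" "G i0 \<tau> = G j \<tau>'"
        using perm_form_fundamental_domain[OF G \<tau>(1)] by metis
      have "norm (nome (\<tau>' / of_nat n)) \<le> \<rho>"
        unfolding norm_nome \<rho>_def using j(1) n by (simp add: field_simps Im_divide_of_nat)
      then have "norm (g j (nome (\<tau>' / of_nat n))) \<le> norm (g j (x j))"
        by (intro x(2)) simp
      moreover have "g i0 z = g j (nome (\<tau>' / of_nat n))"
        using g(2)[OF \<tau>(1), of i0] g(2)[of \<tau>' j] j \<tau>(2) by simp
      ultimately show ?thesis using i0[of j] by simp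
    qed
  qed auto
  then obtain c where c: "\<And>z. z \<in> ball 0 1 \<Longrightarrow> g i0 z = c" by (auto simp: constant_on_def)
  \<comment> \<open>The constant value of one component spreads to the other two along the
    permutations of S and T.\<close>
  define C where "C = {i. \<forall>\<tau>. Im \<tau> > 0 \<longrightarrow> G i \<tau> = c}"
  have "norm (nome (\<tau> / of_nat n)) < 1" if "Im \<tau> > 0" for \<tau>
    using norm_nome_less_1[of "\<tau> / of_nat n"] that n by (simp add: Im_divide_of_nat)
  then have "i0 \<in> C"
    using c g(2) by (auto simp: C_def)
  have T: "permT i \<in> C" if "i \<in> C" for i
    using that perm_formD(1)[OF G, of _ i] by (auto simp: C_def)
  have S: "permS i \<in> C" if "i \<in> C" for i
    using that perm_formD(2)[OF G, of _ i] Im_minus_inverse_pos by (auto simp: C_def)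
  have 23: "2 \<in> C \<Longrightarrow> 3 \<in> C" "3 \<in> C \<Longrightarrow> 2 \<in> C" and 13: "1 \<in> C \<Longrightarrow> 3 \<in> C" "3 \<in> C \<Longrightarrow> 1 \<in> C"
    using T[of 2] T[of 3] S[of 1] S[of 3] by (simp_all add: permT_def permS_def)
  have "3 \<in> C"
    using exhaust_3[of i0] \<open>i0 \<in> C\<close> 23(1) 13(1) by metis
  then have "i \<in> C" for i
    using exhaust_3[of i] 23(2) 13(2) by metis
  then have "\<And>i \<tau>. Im \<tau> > 0 \<Longrightarrow> G i \<tau> = c" unfolding C_def by blast
  then show ?thesis by (rule that)
qed

lemma holomorphic_factor_id:
  assumes "g holomorphic_on ball 0 1" "g 0 = (0 :: complex)"
  obtains k where "k holomorphic_on ball 0 1" "\<And>x. g x = x * k x"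
proof -
  have "(\<lambda>z. if z = 0 then deriv g 0 else (g z - g 0) / (z - 0)) holomorphic_on ball 0 1"
    by (rule pole_lemma_open[OF assms(1)]) auto
  then show ?thesis by (rule that) (use assms(2) in auto)
qed

text \<open>Poles at the cusps are removed one by one by subtracting multiples of powers of the
  Hauptmodul.\<close>

lemma perm_form_hauptmodul_poly:
  assumes "perm_form 0 1 G" and n: "n > 0"
    and "g1 holomorphic_on ball 0 1" "g3 holomorphic_on ball 0 1"
    and "\<And>\<tau>. Im \<tau> > 0 \<Longrightarrow> G 1 \<tau> = g1 (nome (\<tau> / of_nat n))"
    and "\<And>\<tau>. Im \<tau> > 0 \<Longrightarrow> G 3 \<tau> * nome (\<tau> / of_nat n) ^ M = g3 (nome (\<tau> / of_nat n))"
  shows "\<exists>Q. \<forall>i \<tau>. Im \<tau> > 0 \<longrightarrow> G i \<tau> = poly Q (hauptmodul i \<tau>)"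
  using assms(1,3-)
proof (induction M arbitrary: G g1 g3)
  case 0
  \<comment> \<open>Index 2 is index 3 at \<tau> + 1, which rotates the local parameter by
    nome(1/n); hence it is holomorphic at x = 0 as well.\<close>
  define g where "g = (\<lambda>i :: 3. if i = 1 then g1 else if i = 2 then (\<lambda>x. g3 (nome (1 / of_nat n) * x)) else g3)"
  have "norm (nome (1 / of_nat n)) = 1" by (simp add: norm_nome)
  then have "(\<lambda>x. nome (1 / of_nat n) * x) ` ball 0 1 \<subseteq> ball 0 1" by (auto simp: norm_mult)
  then have "(\<lambda>x. g3 (nome (1 / of_nat n) * x)) holomorphic_on ball 0 1"
    using holomorphic_on_compose_gen[OF _ "0.prems"(3), of "\<lambda>x. nome (1 / of_nat n) * x" "ball 0 1"]
    by (auto simp: o_def intro!: holomorphic_intros)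
  then have "g i holomorphic_on ball 0 1" for i
    using "0.prems" exhaust_3[of i] by (auto simp: g_def)
  moreover have "G i \<tau> = g i (nome (\<tau> / of_nat n))" if "Im \<tau> > 0" for i \<tau>
  proof -
    have "G 2 \<tau> = G 3 (\<tau> + 1)"
      using perm_formD(1)[OF "0.prems"(1) that, of 3] by (simp add: permT_def)
    also have "\<dots> = g3 (nome (\<tau> / of_nat n) * nome (1 / of_nat n))"
      using "0.prems"(5)[of "\<tau> + 1"] that by (simp add: add_divide_distrib nome_add)
    finally show ?thesis
      using exhaust_3[of i] "0.prems"(4,5)[OF that] by (auto simp: g_def mult.commute)
  qed
  ultimately obtain c where "\<And>i \<tau>. Im \<tau> > 0 \<Longrightarrow> G i \<tau> = c"
    using perm_form_constant[OF "0.prems"(1) n] by metis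
  then show ?case by (intro exI[of _ "[:c:]"]) auto
next
  case (Suc M)
  let ?x = "\<lambda>\<tau>. nome (\<tau> / of_nat n)"
  note G = Suc.prems(1) and hol = Suc.prems(2,3) and G1 = Suc.prems(4) and G3 = Suc.prems(5)
  define c where "c = g3 0"
  show ?case
  proof (cases "c = 0")
    case True
    obtain k where k: "k holomorphic_on ball 0 1" "\<And>x. g3 x = x * k x"
      using holomorphic_factor_id[OF hol(2)] True by (auto simp: c_def)
    have "G 3 \<tau> * ?x \<tau> ^ M = k (?x \<tau>)" if "Im \<tau> > 0" for \<tau>
      using G3[OF that] k(2)[of "?x \<tau>"] by simp
    then show ?thesis using Suc.IH[OF G hol(1) k(1) G1] by blast
  next
    case False
    \<comment> \<open>T^2 fixes index 3 and multiplies the local parameter by \<open>\<xi>\<close>.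
      A nonzero leading coefficient therefore forces \<xi>^(M+1) = 1, so the pole order is a
      multiple of \<open>n\<close>, the pole order of \<open>hauptmodul 3\<close>.\<close>
    define \<xi> where "\<xi> = nome (2 / of_nat n)"
    have n\<xi>: "norm \<xi> = 1" by (simp add: \<xi>_def norm_nome)
    have rot: "g3 (x * \<xi>) = \<xi> ^ Suc M * g3 x" if x: "x \<in> ball 0 1 - {0}" for x
    proof -
      obtain \<tau> where \<tau>: "Im \<tau> > 0" "?x \<tau> = x"
        using nome_surj_disc[of x n] x n by auto
      have per: "G 3 (\<tau> + 1 + 1) = G 3 \<tau>"
        using perm_formD(1)[OF G, of "\<tau> + 1" 3] perm_formD(1)[OF G, of \<tau> "permT 3"] \<tau>(1) by simp
      have x\<xi>: "nome ((\<tau> + 1 + 1) / of_nat n) = x * \<xi>"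
      proof -
        have "(\<tau> + 1 + 1) / of_nat n = \<tau> / of_nat n + 2 / of_nat n"
          by (simp add: add_divide_distrib[symmetric])
        then show ?thesis by (simp only: nome_add \<tau>(2) \<xi>_def)
      qed
      have a: "G 3 \<tau> * x ^ Suc M = g3 x"
        using G3[OF \<tau>(1)] unfolding \<tau>(2) .
      have "Im (\<tau> + 1 + 1) > 0" using \<tau>(1) by simp
      from G3[OF this] have b: "G 3 \<tau> * (x * \<xi>) ^ Suc M = g3 (x * \<xi>)"
        unfolding per x\<xi> .
      show ?thesis
        unfolding a[symmetric] b[symmetric] power_mult_distrib by (simp only: mult_ac)
    qed
    have c\<xi>: "c = \<xi> ^ Suc M * c"
    proof (rule tendsto_unique[OF at_neq_bot])
      have cont: "isCont g3 0"
        using holomorphic_on_imp_continuous_on[OF hol(2)] by (auto simp: continuous_on_eq_continuous_at)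
      have "isCont (\<lambda>x. g3 (x * \<xi>)) 0"
        by (rule isCont_o2[where g = g3]) (use cont in auto)
      then show "((\<lambda>x. g3 (x * \<xi>)) \<longlongrightarrow> c) (at 0)" by (simp add: isCont_def c_def)
      have "((\<lambda>x. \<xi> ^ Suc M * g3 x) \<longlongrightarrow> \<xi> ^ Suc M * c) (at 0)"
        using cont unfolding isCont_def c_def by (intro tendsto_intros)
      moreover have "eventually (\<lambda>x. \<xi> ^ Suc M * g3 x = g3 (x * \<xi>)) (at 0)"
        unfolding eventually_at by (rule exI[of _ 1]) (use rot in auto)
      ultimately show "((\<lambda>x. g3 (x * \<xi>)) \<longlongrightarrow> \<xi> ^ Suc M * c) (at 0)"
        by (rule Lim_transform_eventually)
    qed
    then have "\<xi> ^ Suc M = 1"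
      using False by (simp del: power_Suc)
    then have "nome (of_nat (Suc M) * (2 / of_nat n)) = nome 0"
      by (simp only: \<xi>_def nome_power nome_0)
    then obtain a :: int where a: "of_nat (Suc M) * (2 / of_nat n) = (0 :: complex) + 2 * of_int a"
      unfolding nome_eq_iff by blast
    then have "2 * (of_nat (Suc M) :: complex) = 2 * (of_int a * of_nat n)"
      using n by (simp add: field_simps)
    then have "(of_nat (Suc M) :: complex) = of_int a * of_nat n"
      by (simp only: mult_cancel_left) simp
    then have "(of_int (int (Suc M)) :: complex) = of_int (a * int n)"
      by simp
    then have "int (Suc M) = a * int n" by (simp only: of_int_eq_iff)
    then have "n dvd Suc M" by (metis dvd_triv_right int_dvd_int_iff)
    then obtain j where j: "Suc M = n * j" by (auto elim: dvdE)
    \<comment> \<open>\<open>hauptmodul 3\<close> starts with -1/16 x^(-n), whence the factor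
      (-16)^j. At index 1 the Hauptmodul is holomorphic at x = 0, so the subtraction creates no pole
      there.\<close>
    define c' where "c' = c * (- 16) ^ j"
    define G' where "G' = (\<lambda>i \<tau>. G i \<tau> - c' * hauptmodul i \<tau> ^ j)"
    define g1' where "g1' = (\<lambda>x. g1 x - c' * (- 256 * (x ^ n) ^ 2 / odd_prod24 ((x ^ n) ^ 2)) ^ j)"
    define g3' where "g3' = (\<lambda>x. g3 x - c * odd_prod24 (x ^ n) ^ j)"
    have G': "perm_form 0 1 G'"
      using G perm_form_hauptmodul by (auto simp: perm_form_def G'_def)
    have pow: "(\<lambda>x. odd_prod24 (x ^ m)) holomorphic_on ball 0 1" if "m > 0" for m
    proof -
      have "(\<lambda>x::complex. x ^ m) ` ball 0 1 \<subseteq> ball 0 1"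
        using that norm_power_less_1 by auto
      moreover have "(\<lambda>x::complex. x ^ m) holomorphic_on ball 0 1"
        by (intro holomorphic_intros)
      ultimately show ?thesis
        using holomorphic_on_compose_gen[OF _ odd_prod24_holomorphic] unfolding o_def by blast
    qed
    have nz: "odd_prod24 ((x ^ n)\<^sup>2) \<noteq> 0" if "x \<in> ball 0 1" for x
      unfolding power_mult[symmetric] using that n by (intro odd_prod24_nonzero norm_power_less_1) auto
    have "g1' holomorphic_on ball 0 1"
      unfolding g1'_def using pow[of "n * 2"] nz n hol(1)
      by (intro holomorphic_intros) (auto simp: power_mult)
    moreover have "g3' holomorphic_on ball 0 1"
      unfolding g3'_def using pow[OF n] hol(2) by (intro holomorphic_intros)
    moreover have "g3' 0 = 0"
      unfolding g3'_def zero_power[OF n] c_def by simp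
    ultimately obtain k where k: "g1' holomorphic_on ball 0 1" "k holomorphic_on ball 0 1" "\<And>x. g3' x = x * k x"
      using holomorphic_factor_id by metis
    have xn: "?x \<tau> ^ n = nome \<tau>" for \<tau> using n by (simp add: nome_power)
    have "G' 1 \<tau> = g1' (?x \<tau>)" if "Im \<tau> > 0" for \<tau>
      by (simp only: G'_def g1'_def G1[OF that] hauptmodul_eq(1)[OF that] xn)
    moreover have "G' 3 \<tau> * ?x \<tau> ^ M = k (?x \<tau>)" if "Im \<tau> > 0" for \<tau>
    proof -
      define x where "x = ?x \<tau>"
      have x0: "x \<noteq> 0" by (simp add: x_def)
      have "c' * hauptmodul 3 \<tau> ^ j * x ^ Suc M = c * ((- 16) * (- 1 / 16 * odd_prod24 (x ^ n) / x ^ n) * x ^ n) ^ j"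
        by (simp only: c'_def hauptmodul_eq(2)[OF that] j power_mult power_mult_distrib x_def xn mult.assoc)
      also have "\<dots> = c * odd_prod24 (x ^ n) ^ j" using x0 by simp
      finally have "G' 3 \<tau> * x ^ Suc M = g3' x"
        using G3[OF that] unfolding G'_def g3'_def x_def by (simp only: left_diff_distrib)
      then show ?thesis using k(3)[of x] x0 by (simp add: x_def)
    qed
    ultimately obtain Q where Q: "\<And>i \<tau>. Im \<tau> > 0 \<Longrightarrow> G' i \<tau> = poly Q (hauptmodul i \<tau>)"
      using Suc.IH[OF G' k(1,2)] by blast
    have "G i \<tau> = poly (Q + monom c' j) (hauptmodul i \<tau>)" if "Im \<tau> > 0" for i \<tau>
      using Q[OF that, of i] by (simp add: G'_def poly_monom algebra_simps)
    then show ?thesis by blast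
  qed
qed

section \<open>The vector-valued form\<close>

text \<open>A common factor d of \<open>j\<close> and \<open>n\<close> would make \<zeta> a root of
  unity of order dividing n/d.\<close>

lemma primitive_root_of_unity_nome:
  assumes "primitive_root_of_unity n \<zeta>"
  obtains j where "\<zeta> = nome (2 * of_nat j / of_nat n)" "Rings.coprime j n"
proof -
  have n: "n > 0" and root: "\<zeta> ^ n = 1" and prim: "\<And>m. 0 < m \<Longrightarrow> m < n \<Longrightarrow> \<zeta> ^ m \<noteq> 1"
    using assms by (auto simp: primitive_root_of_unity_def)
  have "\<zeta> \<in> {exp (2 * of_real pi * \<i> * of_nat j / of_nat n) | j. j < n}"
    using complex_roots_unity[of n] n root by auto
  then obtain j where j: "\<zeta> = nome (2 * of_nat j / of_nat n)"
    by (auto simp: nome_def mult_ac)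
  define d where "d = gcd j n"
  have dpos: "d > 0" using n by (simp add: d_def)
  have "d dvd j" "d dvd n" by (simp_all add: d_def)
  then obtain j' n' where d: "j = d * j'" "n = d * n'" by (elim dvdE)
  have "n' > 0" using d n by auto
  have "of_nat n' * (2 * of_nat j / of_nat n) = (2 * of_nat j' :: complex)"
    using dpos \<open>n' > 0\<close> unfolding d by simp
  then have "\<zeta> ^ n' = nome (2 * of_nat j')"
    by (simp only: j nome_power)
  also have "\<dots> = 1"
    using nome_power[of 2 j'] by (simp add: mult.commute)
  finally have "\<not> n' < n" using prim \<open>n' > 0\<close> by blast
  then have "d * n' \<le> 1 * n'" using d(2) by linarith
  then have "d = 1" using dpos \<open>n' > 0\<close> by (simp only: mult_le_cancel2) simp
  then have "Rings.coprime j n" unfolding d_def by (simp only: coprime_iff_gcd_eq_1)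
  then show ?thesis using j that by blast
qed

text \<open>Write 24 = p^f t with t prime to \<open>p\<close>: f is 0 for p >= 5, 1 for p = 3 and 3
  for p = 2, and in each case p^(f+1) divides \<open>n\<close>. The witnesses are k = n / p^(f+1)
  and \<alpha> = t j; they express that 24 j/n is not p-integral without mentioning
  fractions.\<close>

lemma exponent_not_integral:
  fixes n p j :: nat
  assumes p: "prime p" "p dvd n" and n: "n > 0"
    and cases: "p \<ge> 5 \<or> p = 3 \<and> 9 dvd n \<or> p = 2 \<and> 16 dvd n"
    and cop: "Rings.coprime j n"
  obtains k \<alpha> :: int where "k * (24 * int j) * int p = \<alpha> * int n" "\<not> int p dvd \<alpha>"
proof -
  have "\<exists>f t. (24::nat) = p ^ f * t \<and> \<not> p dvd t \<and> p ^ Suc f dvd n"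
  proof -
    consider "p \<ge> 5" | "p = 3" "9 dvd n" | "p = 2" "16 dvd n" using cases by blast
    then show ?thesis
    proof cases
      case 1
      have "\<not> p dvd 24"
      proof
        assume "p dvd 24"
        then have "p dvd 2 * 2 * 2 * (3 :: nat)" by simp
        then have "p dvd 2 \<or> p dvd 3" using p(1) by (simp only: prime_dvd_mult_iff) blast
        then show False using 1 by (auto dest: dvd_imp_le)
      qed
      then show ?thesis using p by (intro exI[of _ 0] exI[of _ 24]) auto
    next
      case 2
      then show ?thesis by (intro exI[of _ 1] exI[of _ 8]) auto
    next
      case 3
      then show ?thesis by (intro exI[of _ 3] exI[of _ 3]) auto
    qed
  qed
  then obtain f t where ft: "(24::nat) = p ^ f * t" "\<not> p dvd t" "p ^ Suc f dvd n"
    by blast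
  then obtain m where nm: "n = p ^ Suc f * m"
    by (elim dvdE)
  have pj: "\<not> p dvd j"
    using cop p by (metis coprime_common_divisor not_prime_unit)
  have eq: "24 * int j = int p ^ f * int t * int j"
    using arg_cong[OF ft(1), of int] by simp
  have "int m * (24 * int j) * int p = (int t * int j) * int n"
    unfolding eq nm by (simp add: mult_ac)
  moreover have "\<not> int p dvd int t * int j"
    using ft(2) pj p(1) by (metis int_dvd_int_iff of_nat_mult prime_dvd_mult_iff)
  ultimately show ?thesis using that by blast
qed

text \<open>\<open>L\<close> consists of holomorphic logarithms of the three conjugates, so exp(r L)
  is a power with fractional exponent. The constants under T come from the formulas, index 2 being
  index 3 at \<tau> + 1. Under S they exist by connectedness: those of 1 and 3 are opposite since S
  exchanges these indices, and that of 2 vanishes at the fixed point i.\<close>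

lemma hauptmodul_log:
  assumes l: "l holomorphic_on ball 0 1" "\<forall>z. norm z < 1 \<longrightarrow> exp (l z) = odd_prod24 z"
  shows "\<exists>(L :: 3 \<Rightarrow> complex \<Rightarrow> complex) c1 c3 a. \<forall>\<tau>. Im \<tau> > 0 \<longrightarrow>
    L 1 \<tau> = c1 + 2 * of_real pi * \<i> * \<tau> - l (nome \<tau> ^ 2) \<and>
    L 3 \<tau> = c3 - of_real pi * \<i> * \<tau> + l (nome \<tau>) \<and>
    L 1 (\<tau> + 1) = L 1 \<tau> + 2 * of_real pi * \<i> \<and>
    L 2 (\<tau> + 1) = L 3 \<tau> - 2 * of_real pi * \<i> \<and>
    L 3 (\<tau> + 1) = L 2 \<tau> \<and>
    L 1 (- 1 / \<tau>) = L 3 \<tau> + a \<and>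
    L 2 (- 1 / \<tau>) = L 2 \<tau> \<and>
    L 3 (- 1 / \<tau>) = L 1 \<tau> - a"
proof -
  define H where "H = {\<tau>. Im \<tau> > 0}"
  define c1 where "c1 = Ln (- 256)"
  define c3 where "c3 = Ln (- 1 / 16)"
  define L3 where "L3 = (\<lambda>\<tau>. c3 - of_real pi * \<i> * \<tau> + l (nome \<tau>))"
  define L :: "3 \<Rightarrow> complex \<Rightarrow> complex" where
    "L = (\<lambda>i \<tau>. if i = 1 then c1 + 2 * of_real pi * \<i> * \<tau> - l (nome \<tau> ^ 2)
       else if i = 2 then L3 (\<tau> + 1) else L3 \<tau>)"
  have c: "exp c1 = - 256" "exp c3 = - 1 / 16"
    unfolding c1_def c3_def by (simp_all add: exp_Ln)
  have nome: "nome \<tau> \<in> ball 0 1" "nome \<tau> ^ 2 \<in> ball 0 1" "nome (\<tau> + 1) \<in> ball 0 1" if "\<tau> \<in> H" for \<tau>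
    using norm_nome_less_1[of \<tau>] norm_power_less_1[of "nome \<tau>" 2] that by (simp_all add: H_def nome_add)
  have comp: "(\<lambda>\<tau>. l (f \<tau>)) holomorphic_on H" if "f holomorphic_on H" "\<And>\<tau>. \<tau> \<in> H \<Longrightarrow> f \<tau> \<in> ball 0 1" for f
  proof -
    have "f ` H \<subseteq> ball 0 1" using that by blast
    then show ?thesis using holomorphic_on_compose_gen[OF that(1) l(1)] by (simp add: o_def)
  qed
  have hol: "L i holomorphic_on H" for i
    using exhaust_3[of i] unfolding L_def L3_def
    by (auto intro!: holomorphic_intros comp nome)
  have expL: "exp (L i \<tau>) = hauptmodul i \<tau>" if "\<tau> \<in> H" for i \<tau>
  proof -
    have im: "Im \<tau> > 0" "Im (\<tau> + 1) > 0" using that by (auto simp: H_def)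
    have e3: "exp (L3 \<sigma>) = hauptmodul 3 \<sigma>" if "Im \<sigma> > 0" for \<sigma>
      using nome[of \<sigma>] that
      by (simp add: L3_def exp_add exp_diff c l(2) hauptmodul_eq(2)[OF that] H_def flip: nome_def)
    have "exp (L 1 \<tau>) = hauptmodul 1 \<tau>"
    proof -
      have "exp (2 * of_real pi * \<i> * \<tau>) = nome \<tau> ^ 2"
        unfolding nome_power by (simp add: nome_def mult_ac)
      then show ?thesis
        using nome[OF that] by (simp add: L_def exp_add exp_diff c l(2) hauptmodul_eq(1)[OF im(1)])
    qed
    moreover have "exp (L 2 \<tau>) = hauptmodul 2 \<tau>"
      using e3[OF im(2)] by (simp add: L_def hauptmodul_eq(3)[OF im(1)])
    ultimately show ?thesis
      using e3[OF im(1)] exhaust_3[of i] by (auto simp: L_def)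
  qed
  have inv: "- 1 / \<tau> \<in> H" if "\<tau> \<in> H" for \<tau>
    using Im_minus_inverse_pos that by (simp add: H_def)
  have H: "open H" "connected H"
    unfolding H_def by (simp_all add: open_halfspace_Im_gt convex_connected convex_halfspace_Im_gt)
  have diff: "\<exists>a. \<forall>\<tau>\<in>H. L i (- 1 / \<tau>) = L (permS i) \<tau> + a" for i
  proof -
    have "(\<lambda>\<tau>. - 1 / \<tau>) holomorphic_on H"
      by (intro holomorphic_intros) (auto simp: H_def)
    moreover have "(\<lambda>\<tau>. - 1 / \<tau>) ` H \<subseteq> H" using inv by blast
    ultimately have "(\<lambda>\<tau>. L i (- 1 / \<tau>)) holomorphic_on H"
      using holomorphic_on_compose_gen[OF _ hol] unfolding o_def by blast
    then have "(\<lambda>\<tau>. L i (- 1 / \<tau>) - L (permS i) \<tau>) holomorphic_on H"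
      by (intro holomorphic_intros hol)
    moreover have "exp (L i (- 1 / \<tau>) - L (permS i) \<tau>) = 1" if "\<tau> \<in> H" for \<tau>
      unfolding exp_diff expL[OF that] expL[OF inv[OF that]]
      using perm_formD(2)[OF perm_form_hauptmodul, of \<tau> i] hauptmodul_nonzero[of \<tau> "permS i"] that
      by (simp add: H_def)
    ultimately obtain a where "\<And>\<tau>. \<tau> \<in> H \<Longrightarrow> L i (- 1 / \<tau>) - L (permS i) \<tau> = a"
      using exp_eq_1_imp_constant[OF H] by blast
    then show ?thesis by (intro exI[of _ a]) (auto simp: algebra_simps)
  qed
  obtain a where a: "\<And>\<tau>. \<tau> \<in> H \<Longrightarrow> L 1 (- 1 / \<tau>) = L 3 \<tau> + a"
    using diff[of 1] by (auto simp: permS_def)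
  obtain b where b: "\<And>\<tau>. \<tau> \<in> H \<Longrightarrow> L 2 (- 1 / \<tau>) = L 2 \<tau> + b"
    using diff[of 2] by (auto simp: permS_def)
  have "b = 0" using b[of \<i>] by (simp add: H_def)
  have "L 3 (- 1 / \<tau>) = L 1 \<tau> - a" if "\<tau> \<in> H" for \<tau>
    using a[OF inv[OF that]] by simp
  moreover have "L 1 (\<tau> + 1) = L 1 \<tau> + 2 * of_real pi * \<i>" if "\<tau> \<in> H" for \<tau>
    by (simp add: L_def nome_add algebra_simps)
  moreover have "L 2 (\<tau> + 1) = L 3 \<tau> - 2 * of_real pi * \<i>" if "\<tau> \<in> H" for \<tau>
    by (simp add: L_def L3_def nome_add algebra_simps)
  moreover have "L 3 (\<tau> + 1) = L 2 \<tau>" for \<tau>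
    by (simp add: L_def)
  moreover have "L 3 \<tau> = c3 - of_real pi * \<i> * \<tau> + l (nome \<tau>)"
    "L 1 \<tau> = c1 + 2 * of_real pi * \<i> * \<tau> - l (nome \<tau> ^ 2)" for \<tau>
    by (simp_all add: L_def L3_def)
  ultimately show ?thesis
    using a b \<open>b = 0\<close> unfolding H_def
    by (intro exI[of _ L] exI[of _ c1] exI[of _ c3] exI[of _ a]) auto
qed

section \<open>Transformation laws and Fourier expansions of the form\<close>

lemma to_PSL2Z_eq: "to_PSL2Z A = {A, - A}"
  unfolding to_PSL2Z_def r_coset_def SL2Z_def
  by (auto simp: minus_matrix_mult_left)

lemma to_PSL2Z_in_carrier: "det A = 1 \<Longrightarrow> to_PSL2Z A \<in> carrier PSL2Z"
  unfolding PSL2Z_def FactGroup_def RCOSETS_def to_PSL2Z_def by (auto simp: SL2Z_def)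

lemma slash_matT:
  assumes F: "F \<in> vv_modular_forms n k \<rho>" and \<tau>: "Im \<tau> > 0"
  shows "F (\<tau> + 1) = \<rho> (to_PSL2Z matT) *v F \<tau>"
proof -
  have "det matT = 1" by (simp add: matT_def det_2)
  then have "slash k matT F \<tau> = \<rho> (to_PSL2Z matT) *v F \<tau>"
    using F to_PSL2Z_in_carrier[of matT] \<tau> to_PSL2Z_eq[of matT]
    unfolding vv_modular_forms_def upper_half_plane_def by blast
  moreover have "slash k matT F \<tau> = F (\<tau> + 1)"
    by (simp add: slash_def matT_def moebius_def vector_2)
  ultimately show ?thesis by simp
qed

lemma slash_matS:
  assumes F: "F \<in> vv_modular_forms n k \<rho>" and \<tau>: "Im \<tau> > 0"
  shows "F (- 1 / \<tau>) = \<tau> powi k *s (\<rho> (to_PSL2Z matS) *v F \<tau>)"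
    and "F (- 1 / \<tau>) = (- \<tau>) powi k *s (\<rho> (to_PSL2Z matS) *v F \<tau>)"
proof -
  have \<tau>0: "\<tau> \<noteq> 0" using \<tau> by auto
  have "det matS = 1" by (simp add: matS_def det_2)
  then have s: "slash k A F \<tau> = \<rho> (to_PSL2Z matS) *v F \<tau>" if "A \<in> {matS, - matS}" for A
    using F to_PSL2Z_in_carrier[of matS] \<tau> to_PSL2Z_eq[of matS] that
    unfolding vv_modular_forms_def upper_half_plane_def by blast
  have "slash k matS F \<tau> = \<tau> powi (- k) *s F (- 1 / \<tau>)"
    by (simp add: slash_def matS_def moebius_def vector_2)
  then have "\<tau> powi k *s (\<rho> (to_PSL2Z matS) *v F \<tau>) = (\<tau> powi k * \<tau> powi (- k)) *s F (- 1 / \<tau>)"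
    using s[of matS] by (simp add: vector_smult_assoc)
  then show "F (- 1 / \<tau>) = \<tau> powi k *s (\<rho> (to_PSL2Z matS) *v F \<tau>)"
    using \<tau>0 by (simp add: power_int_minus)
  have "slash k (- matS) F \<tau> = (- \<tau>) powi (- k) *s F (- 1 / \<tau>)"
    by (simp add: slash_def matS_def moebius_def vector_2)
  then have "(- \<tau>) powi k *s (\<rho> (to_PSL2Z matS) *v F \<tau>) = ((- \<tau>) powi k * (- \<tau>) powi (- k)) *s F (- 1 / \<tau>)"
    using s[of "- matS"] by (simp add: vector_smult_assoc)
  then show "F (- 1 / \<tau>) = (- \<tau>) powi k *s (\<rho> (to_PSL2Z matS) *v F \<tau>)"
    using \<tau>0 by (simp add: power_int_minus)
qed

text \<open>The two matrices representing S make F(-1/\<tau>) both \<tau>^k and (-\<tau>)^k times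
  the same vector, which for odd \<open>k\<close> gives F = - F.\<close>

lemma vv_modular_forms_even_weight:
  assumes F: "F \<in> vv_modular_forms n k \<rho>" and nz: "Im \<tau> > 0" "F \<tau> \<noteq> 0"
  shows "even k"
proof (rule ccontr)
  assume odd: "odd k"
  have inv: "Im (- 1 / \<tau>) > 0" by (rule Im_minus_inverse_pos[OF nz(1)])
  define \<sigma> where "\<sigma> = - 1 / \<tau>"
  have \<sigma>: "Im \<sigma> > 0" "- 1 / \<sigma> = \<tau>" using inv by (auto simp: \<sigma>_def)
  define v where "v = \<rho> (to_PSL2Z matS) *v F \<sigma>"
  have "F \<tau> = \<sigma> powi k *s v" "F \<tau> = (- \<sigma>) powi k *s v"
    by (rule slash_matS[OF F \<sigma>(1), unfolded \<sigma>(2), folded v_def])+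
  moreover have "(- \<sigma>) powi k = - (\<sigma> powi k)"
    using odd by (simp add: power_int_minus_left)
  ultimately have eq: "F \<tau> = - F \<tau>" by (simp add: Finite_Cartesian_Product.vec_eq_iff)
  have "F \<tau> $ i = - (F \<tau> $ i)" for i
    by (subst eq) simp
  then have "F \<tau> $ i = 0" for i by simp
  then show False using nz(2) by (simp add: Finite_Cartesian_Product.vec_eq_iff)
qed

lemma F_transformation:
  fixes \<epsilon> :: real and F :: "complex \<Rightarrow> complex^3"
  assumes F: "F \<in> vv_modular_forms n k \<rho>"
    and rho_S: "\<rho> (to_PSL2Z matS) =
      \<epsilon> *\<^sub>R vector [vector [0, 0, \<zeta>], vector [0, 1, 0], vector [cnj \<zeta>, 0, 0]]"
    and rho_T: "\<rho> (to_PSL2Z matT) =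
      \<epsilon> *\<^sub>R vector [vector [\<zeta>, 0, 0], vector [0, 0, 1], vector [0, cnj \<zeta>, 0]]"
    and \<tau>: "Im \<tau> > 0"
  shows "F (\<tau> + 1) $ 1 = of_real \<epsilon> * \<zeta> * F \<tau> $ 1" "F (\<tau> + 1) $ 2 = of_real \<epsilon> * F \<tau> $ 3"
    "F (\<tau> + 1) $ 3 = of_real \<epsilon> * cnj \<zeta> * F \<tau> $ 2"
    "F (- 1 / \<tau>) $ 1 = of_real \<epsilon> * \<tau> powi k * \<zeta> * F \<tau> $ 3"
    "F (- 1 / \<tau>) $ 2 = of_real \<epsilon> * \<tau> powi k * F \<tau> $ 2"
    "F (- 1 / \<tau>) $ 3 = of_real \<epsilon> * \<tau> powi k * cnj \<zeta> * F \<tau> $ 1"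
  unfolding slash_matT[OF F \<tau>] slash_matS(1)[OF F \<tau>] rho_S rho_T
  by (simp_all add: matrix_vector_mult_def sum_3 vector_3 scaleR_conv_of_real[symmetric])

text \<open>In the local parameter x = nome(\<tau>/n) the m-th exponential is x^m. On the imaginary
  axis |x| takes every value in (0, 1), so convergence in the half plane yields the radius.\<close>

lemma has_fourier_expansion_eval_fps:
  assumes c: "has_fourier_expansion (2 * n) f c" and n: "n > 0"
  shows "fps_conv_radius (Abs_fps c) \<ge> 1"
    and "\<And>\<tau>. Im \<tau> > 0 \<Longrightarrow> f \<tau> = eval_fps (Abs_fps c) (nome (\<tau> / of_nat n))"
proof -
  have s: "(\<lambda>m. c m * nome (\<tau> / of_nat n) ^ m) sums f \<tau>" if "Im \<tau> > 0" for \<tau>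
  proof -
    have eq: "exp (2 * of_real pi * \<i> * \<tau> * of_nat m / of_nat (2 * n)) = nome (\<tau> / of_nat n) ^ m" for m
      using n unfolding nome_power unfolding nome_def by (simp add: field_simps)
    have "(\<lambda>m. c m * exp (2 * of_real pi * \<i> * \<tau> * of_nat m / of_nat (2 * n))) sums f \<tau>"
      using c that unfolding has_fourier_expansion_def upper_half_plane_def by blast
    then show ?thesis unfolding eq .
  qed
  show "f \<tau> = eval_fps (Abs_fps c) (nome (\<tau> / of_nat n))" if "Im \<tau> > 0" for \<tau>
    using s[OF that] by (simp add: eval_fps_def sums_iff)
  show "fps_conv_radius (Abs_fps c) \<ge> 1"
    unfolding fps_conv_radius_def
  proof (rule conv_radius_geI_ex)
    fix r :: real assume r: "0 < r" "ereal r < 1"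
    define \<tau> where "\<tau> = of_real (- (of_nat n * ln r / pi)) * \<i>"
    have "Im \<tau> > 0" using r n by (simp add: \<tau>_def divide_neg_pos mult_pos_neg)
    moreover have "norm (nome (\<tau> / of_nat n)) = r"
      using r n by (simp add: norm_nome \<tau>_def)
    ultimately show "\<exists>z. norm z = r \<and> summable (\<lambda>m. fps_nth (Abs_fps c) m * z ^ m)"
      using s sums_summable by (intro exI[of _ "nome (\<tau> / of_nat n)"]) auto
  qed
qed

section \<open>Integrality of the q-expansions\<close>

definition int_unit_fps :: "complex fps \<Rightarrow> bool" where
  "int_unit_fps f \<longleftrightarrow> (\<forall>m. fps_nth f m \<in> \<int>) \<and> fps_nth f 0 = 1"

lemma int_unit_fpsD: "int_unit_fps f \<Longrightarrow> fps_nth f m \<in> \<int>" "int_unit_fps f \<Longrightarrow> fps_nth f 0 = 1"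
  by (auto simp: int_unit_fps_def)

lemma int_unit_fps_1: "int_unit_fps 1"
  by (auto simp: int_unit_fps_def)

lemma int_unit_fps_mult: "int_unit_fps f \<Longrightarrow> int_unit_fps g \<Longrightarrow> int_unit_fps (f * g)"
  unfolding int_unit_fps_def by (auto simp: fps_mult_nth)

lemma int_unit_fps_power: "int_unit_fps f \<Longrightarrow> int_unit_fps (f ^ k)"
  by (induction k) (auto intro: int_unit_fps_1 int_unit_fps_mult)

lemma int_unit_fps_inverse:
  assumes "int_unit_fps f"
  shows "int_unit_fps (inverse f)"
proof -
  have f0: "fps_nth f 0 = 1" and fI: "\<And>m. fps_nth f m \<in> \<int>"
    using assms by (auto simp: int_unit_fps_def)
  have "fps_nth (inverse f) m \<in> \<int>" for m
    by (rule fps_inverse_nth_closed[OF f0 fI]) (auto intro: Ints_sum)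
  then show ?thesis using f0 by (auto simp: int_unit_fps_def)
qed

lemma fps_nth_compose_X_power:
  "k > 0 \<Longrightarrow> fps_nth (f oo fps_X ^ k) m = (if k dvd m then fps_nth f (m div k) else (0 :: complex))"
proof -
  assume k: "k > 0"
  have "fps_nth (f oo fps_X ^ k) m = (\<Sum>i=0..m. if m = k * i then fps_nth f i else 0)"
    by (simp add: fps_compose_nth fps_X_power_nth flip: power_mult) (auto intro!: sum.cong)
  also have "\<dots> = (if k dvd m then fps_nth f (m div k) else 0)"
  proof (cases "k dvd m")
    case True
    then obtain l where l: "m = k * l" by (auto elim: dvdE)
    have "l \<le> m" using k l by simp
    then show ?thesis using k l by (simp add: sum.delta)
  next
    case False
    then show ?thesis by (auto intro!: sum.neutral)
  qed
  finally show ?thesis .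
qed

lemma int_unit_fps_compose: "k > 0 \<Longrightarrow> int_unit_fps f \<Longrightarrow> int_unit_fps (f oo fps_X ^ k)"
  by (auto simp: int_unit_fps_def fps_nth_compose_X_power)

lemma has_fps_expansion_compose_power:
  fixes f :: "complex \<Rightarrow> complex"
  assumes "f has_fps_expansion F" "k > 0"
  shows "(\<lambda>x. f (x ^ k)) has_fps_expansion (F oo fps_X ^ k)"
  using has_fps_expansion_compose[OF assms(1) has_fps_expansion_fps_X_power[of k]] assms(2)
  by (simp add: o_def fps_X_power_nth)

lemma fps_nth_1_power:
  assumes "fps_nth f 0 = (1 :: complex)"
  shows "fps_nth (f ^ k) 1 = of_nat k * fps_nth f 1"
proof (induction k)
  case (Suc k)
  have "fps_nth (f ^ k) 0 = 1" using assms by (simp add: fps_power_zeroth)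
  then show ?case using Suc assms by (simp add: fps_mult_nth algebra_simps)
qed simp

definition odd_prod24_fps :: "complex fps" where
  "odd_prod24_fps = (euler_fps * inverse (euler_fps oo fps_X ^ 2)) ^ 24"

definition theta_a_fps :: "complex fps" where
  "theta_a_fps = (euler_fps oo fps_X ^ 4) ^ 8 * inverse ((euler_fps oo fps_X ^ 2) ^ 4)"

definition theta_b_fps :: "complex fps" where
  "theta_b_fps = euler_fps ^ 8 * inverse ((euler_fps oo fps_X ^ 2) ^ 4)"

lemma int_unit_euler_fps: "int_unit_fps euler_fps"
  by (simp add: int_unit_fps_def euler_fps_nth_Ints euler_fps_nth_0)

lemma int_unit_odd_prod24_fps: "int_unit_fps odd_prod24_fps"
  and int_unit_theta_a_fps: "int_unit_fps theta_a_fps"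
  and int_unit_theta_b_fps: "int_unit_fps theta_b_fps"
  unfolding odd_prod24_fps_def theta_a_fps_def theta_b_fps_def
  by (intro int_unit_fps_power int_unit_fps_mult int_unit_fps_inverse int_unit_fps_compose int_unit_euler_fps; simp)+

lemma odd_prod24_has_fps_expansion: "odd_prod24 has_fps_expansion odd_prod24_fps"
  and theta_a_has_fps_expansion: "theta_a has_fps_expansion theta_a_fps"
  and theta_b_has_fps_expansion: "theta_b has_fps_expansion theta_b_fps"
proof -
  note e = euler_prod_has_fps_expansion
  note c = has_fps_expansion_compose_power[OF e]
  have c0: "fps_nth (euler_fps oo fps_X ^ 2) 0 = 1" "fps_nth ((euler_fps oo fps_X ^ 2) ^ 4) 0 = 1"
    using int_unit_fpsD(2)[OF int_unit_fps_compose[OF _ int_unit_euler_fps, of 2]] by (simp_all add: fps_power_zeroth)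
  show "odd_prod24 has_fps_expansion odd_prod24_fps"
    unfolding odd_prod24_def[abs_def] odd_prod24_fps_def divide_inverse
    by (intro has_fps_expansion_power has_fps_expansion_mult has_fps_expansion_inverse e c) (simp_all add: c0 euler_fps_nth_0)
  show "theta_a has_fps_expansion theta_a_fps" "theta_b has_fps_expansion theta_b_fps"
    unfolding theta_a_def[abs_def] theta_a_fps_def theta_b_def[abs_def] theta_b_fps_def divide_inverse
    by ((intro has_fps_expansion_power has_fps_expansion_mult has_fps_expansion_inverse e c; simp add: c0 euler_fps_nth_0)+)
qed

text \<open>The denominator is a series in X^2 and has no linear term, so only the -1 of Euler's
  product counts, 24 times.\<close>

lemma odd_prod24_fps_nth_1: "fps_nth odd_prod24_fps 1 = - 24"
proof -
  let ?G = "euler_fps oo fps_X ^ 2"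
  have G: "int_unit_fps ?G" by (intro int_unit_fps_compose int_unit_euler_fps) simp
  have 0: "fps_nth (euler_fps * inverse ?G) 0 = 1"
    by (intro int_unit_fpsD(2) int_unit_fps_mult int_unit_fps_inverse G int_unit_euler_fps)
  have G1: "fps_nth ?G 1 = 0" by (simp add: fps_nth_compose_X_power)
  have "fps_nth (?G * inverse ?G) 1 = 0"
    using int_unit_fpsD(2)[OF G] by (simp add: inverse_mult_eq_1')
  then have "fps_nth (inverse ?G) 1 = 0"
    using int_unit_fpsD(2)[OF G] G1 by (simp add: fps_mult_nth)
  then have "fps_nth (euler_fps * inverse ?G) 1 = - 1"
    using int_unit_fpsD(2)[OF G] euler_fps_nth_1 by (simp add: fps_mult_nth)
  then show ?thesis
    unfolding odd_prod24_fps_def fps_nth_1_power[OF 0] by simp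
qed

lemma fps_eq_1_plus:
  assumes "fps_nth f 0 = (1 :: complex)"
  obtains g where "f = 1 + fps_X * g" "fps_nth g 0 = fps_nth f 1"
proof
  show "f = 1 + fps_X * fps_shift 1 f"
    by (rule fps_ext) (auto simp: assms fps_X_mult_nth)
qed simp

text \<open>A nome is never 0, so identities carried over from the half plane hold only for x
  \<noteq> 0; continuity supplies the missing point.\<close>

lemma has_fps_expansion_unique_punctured:
  assumes "f has_fps_expansion F" "g has_fps_expansion G"
    and "\<And>x. x \<noteq> 0 \<Longrightarrow> norm x < 1 \<Longrightarrow> f x = (g x :: complex)"
  shows "F = G"
proof -
  have ev: "eventually (\<lambda>x. f x = g x) (at 0)"
    unfolding eventually_at by (rule exI[of _ 1]) (use assms(3) in auto)
  have "f \<midarrow>0\<rightarrow> f 0" "g \<midarrow>0\<rightarrow> g 0"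
    using assms(1,2)[THEN has_fps_expansion_imp_continuous, of UNIV] by (simp_all add: isCont_def)
  then have "f 0 = g 0"
    using ev by (metis Lim_transform_eventually LIM_unique)
  with ev have "eventually (\<lambda>x. f x = g x) (nhds 0)"
    by (simp add: eventually_nhds_conv_at)
  then have "f has_fps_expansion G"
    using assms(2) has_fps_expansion_cong by blast
  then show ?thesis using assms(1) fps_expansion_unique_complex by blast
qed

definition diff1 :: "complex \<Rightarrow> complex" where
  "diff1 y = - theta_b (- y) - theta_b y"

definition diff3 :: "complex \<Rightarrow> complex" where
  "diff3 y = 16 * y * theta_a y + theta_b (- y)"

lemma theta4_diff_eq: "theta4_diff 1 \<tau> = diff1 (nome \<tau>)" "theta4_diff 3 \<tau> = diff3 (nome \<tau>)"
  by (simp_all add: theta4_diff_def theta4_def diff1_def diff3_def)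

lemma theta_b_minus_holomorphic: "(\<lambda>y. theta_b (- y)) holomorphic_on ball 0 1"
proof -
  have "(\<lambda>y::complex. - y) holomorphic_on ball 0 1" by (intro holomorphic_intros)
  moreover have "(\<lambda>y::complex. - y) ` ball 0 1 \<subseteq> ball 0 1" by auto
  ultimately show ?thesis
    using holomorphic_on_compose_gen[OF _ theta_b_holomorphic] unfolding o_def by blast
qed

lemma diff1_holomorphic: "diff1 holomorphic_on ball 0 1"
  and diff3_holomorphic: "diff3 holomorphic_on ball 0 1"
  unfolding diff1_def diff3_def
  by (intro holomorphic_intros theta_a_holomorphic theta_b_holomorphic theta_b_minus_holomorphic)+

lemma theta_a_nonzero: "norm y < 1 \<Longrightarrow> theta_a y \<noteq> 0"
  and theta_b_nonzero: "norm y < 1 \<Longrightarrow> theta_b y \<noteq> 0"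
  using euler_prod_power_nonzero[of y 4] euler_prod_power_nonzero[of y 2] euler_prod_nonzero[of y]
  by (simp_all add: theta_a_def theta_b_def)

lemma holomorphic_on_ball_power:
  assumes "f holomorphic_on ball 0 1" "k > 0"
  shows "(\<lambda>x::complex. f (x ^ k)) holomorphic_on ball 0 1"
proof -
  have "(\<lambda>x::complex. x ^ k) ` ball 0 1 \<subseteq> ball 0 1"
    using assms(2) norm_power_less_1 by auto
  moreover have "(\<lambda>x::complex. x ^ k) holomorphic_on ball 0 1"
    by (intro holomorphic_intros)
  ultimately show ?thesis
    using holomorphic_on_compose_gen[OF _ assms(1)] unfolding o_def by blast
qed

lemma power_int_minus_diff_nat:
  "z \<noteq> (0 :: complex) \<Longrightarrow> z powi (int b - int a) = z ^ b / z ^ a"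
  by (simp add: power_int_diff)

text \<open>Dividing by the r-th power of the Hauptmodul removes \<zeta>, because 2 pi i r is a
  logarithm of it. The constants 1, exp(-r a) and exp(-r a) \<zeta> normalise the components so that
  the shifts a and -a under S and the remaining factors \<zeta> cancel too; only \<epsilon> is
  left.\<close>

lemma perm_form_F_over_log:
  fixes F :: "complex \<Rightarrow> complex^3" and \<epsilon> :: real
  assumes F: "F \<in> vv_modular_forms n k \<rho>"
    and rho_S: "\<rho> (to_PSL2Z matS) =
      \<epsilon> *\<^sub>R vector [vector [0, 0, \<zeta>], vector [0, 1, 0], vector [cnj \<zeta>, 0, 0]]"
    and rho_T: "\<rho> (to_PSL2Z matT) =
      \<epsilon> *\<^sub>R vector [vector [\<zeta>, 0, 0], vector [0, 0, 1], vector [0, cnj \<zeta>, 0]]"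
    and \<zeta>: "exp (r * (2 * of_real pi * \<i>)) = \<zeta>" "\<zeta> * cnj \<zeta> = 1"
    and L: "\<And>\<tau>. Im \<tau> > 0 \<Longrightarrow> L 1 (\<tau> + 1) = L 1 \<tau> + 2 * of_real pi * \<i>"
      "\<And>\<tau>. Im \<tau> > 0 \<Longrightarrow> L 2 (\<tau> + 1) = L 3 \<tau> - 2 * of_real pi * \<i>"
      "\<And>\<tau>. Im \<tau> > 0 \<Longrightarrow> L 3 (\<tau> + 1) = L 2 \<tau>"
      "\<And>\<tau>. Im \<tau> > 0 \<Longrightarrow> L 1 (- 1 / \<tau>) = L 3 \<tau> + a"
      "\<And>\<tau>. Im \<tau> > 0 \<Longrightarrow> L 2 (- 1 / \<tau>) = L 2 \<tau>"
      "\<And>\<tau>. Im \<tau> > 0 \<Longrightarrow> L 3 (- 1 / \<tau>) = L 1 \<tau> - a"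
  shows "perm_form k (of_real \<epsilon>) (\<lambda>i \<tau>. (if i = 1 then 1 else if i = 2 then exp (- r * a) else exp (- r * a) * \<zeta>)
    * F \<tau> $ i * exp (- r * L (i :: 3) \<tau>))"
  unfolding perm_form_def forall_3
proof (intro conjI allI impI)
  have e: "exp (- r * (z + 2 * of_real pi * \<i>)) = exp (- r * z) * cnj \<zeta>"
    "exp (- r * (z - 2 * of_real pi * \<i>)) = exp (- r * z) * \<zeta>" for z
  proof -
    have "exp (- r * (2 * of_real pi * \<i>)) = inverse \<zeta>"
      using \<zeta>(1) by (simp add: exp_minus)
    also have "\<dots> = cnj \<zeta>" using \<zeta>(2) by (rule inverse_unique)
    finally have "exp (- r * (2 * of_real pi * \<i>)) = cnj \<zeta>" .
    then show "exp (- r * (z + 2 * of_real pi * \<i>)) = exp (- r * z) * cnj \<zeta>"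
      by (simp only: distrib_left exp_add)
    have "- r * (z - 2 * of_real pi * \<i>) = - r * z + r * (2 * of_real pi * \<i>)"
      by (simp add: algebra_simps)
    then show "exp (- r * (z - 2 * of_real pi * \<i>)) = exp (- r * z) * \<zeta>"
      by (simp only: exp_add \<zeta>(1))
  qed
  have ea: "exp (- r * (z + a)) = exp (- r * z) * exp (- r * a)"
    "exp (- r * a) * exp (- r * (z - a)) = exp (- r * z)" for z
    by (simp_all add: algebra_simps flip: exp_add)
  fix \<tau> :: complex assume \<tau>: "Im \<tau> > 0"
  note t = F_transformation[OF F rho_S rho_T \<tau>] L[OF \<tau>]
  have z1: "\<zeta> * (cnj \<zeta> * w) = w" for w
    using \<zeta>(2) by (simp add: mult.assoc[symmetric])
  let ?Y = "\<lambda>i \<tau>. (if i = 1 then 1 else if i = 2 then exp (- r * a) else exp (- r * a) * \<zeta>) * F \<tau> $ i * exp (- r * L (i :: 3) \<tau>)"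
  have n: "(2::3) \<noteq> 1" "(3::3) \<noteq> 1" "(3::3) \<noteq> 2" by simp_all
  have "?Y 1 (\<tau> + 1) = (\<zeta> * cnj \<zeta>) * (of_real \<epsilon> * (F \<tau> $ 1 * exp (- r * L 1 \<tau>)))"
    unfolding t e by (simp add: ac_simps)
  then show "?Y 1 (\<tau> + 1) = of_real \<epsilon> * ?Y (permT 1) \<tau>"
    unfolding \<zeta>(2) by (simp add: permT_def)
  show "?Y 2 (\<tau> + 1) = of_real \<epsilon> * ?Y (permT 2) \<tau>"
    unfolding t e by (simp add: permT_def)
  have "?Y 3 (\<tau> + 1) = (\<zeta> * cnj \<zeta>) * (of_real \<epsilon> * (exp (- r * a) * F \<tau> $ 2 * exp (- r * L 2 \<tau>)))"
    unfolding t using n by (simp add: ac_simps)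
  then show "?Y 3 (\<tau> + 1) = of_real \<epsilon> * ?Y (permT 3) \<tau>"
    unfolding \<zeta>(2) by (simp add: permT_def)
  show "?Y 1 (- 1 / \<tau>) = of_real \<epsilon> * \<tau> powi k * ?Y (permS 1) \<tau>"
    unfolding t ea by (simp add: permS_def)
  show "?Y 2 (- 1 / \<tau>) = of_real \<epsilon> * \<tau> powi k * ?Y (permS 2) \<tau>"
    unfolding t by (simp add: permS_def)
  have "?Y 3 (- 1 / \<tau>) = (\<zeta> * cnj \<zeta>) * (of_real \<epsilon> * \<tau> powi k * (F \<tau> $ 1 * (exp (- r * a) * exp (- r * (L 1 \<tau> - a)))))"
    unfolding t using n by (simp add: ac_simps)
  then show "?Y 3 (- 1 / \<tau>) = of_real \<epsilon> * \<tau> powi k * ?Y (permS 3) \<tau>"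
    unfolding \<zeta>(2) ea by (simp add: permS_def)
qed

text \<open>The shape of the components of a form at the two cusps of \<open>\<Gamma>\<^sub>0(2)\<close>, with
  \<open>x = exp (\<pi> i \<tau> / n)\<close>: a power of the Hauptmodul with exponent \<open>j / n\<close> (the exponential factor)
  times a polynomial in the Hauptmodul, up to integral series.\<close>

definition expansion_at_infinity where
  "expansion_at_infinity n j l f d N m2 C m1 Q \<longleftrightarrow> (\<forall>x. x \<noteq> 0 \<and> norm x < 1 \<longrightarrow>
      eval_fps f x * diff1 (x ^ n) ^ d * (- 256 * x ^ (2 * n) / odd_prod24 (x ^ (2 * n))) ^ N * (16 * x ^ n * theta_a (x ^ n)) ^ m2
      = C * x ^ (2 * j) * exp (- (of_nat j / of_nat n) * l (x ^ (2 * n))) * (16 * x ^ n * theta_a (x ^ n)) ^ m1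
        * poly Q (- 256 * x ^ (2 * n) / odd_prod24 (x ^ (2 * n))))"

definition expansion_at_zero where
  "expansion_at_zero n j l f d N m2 C m1 Q \<longleftrightarrow> (\<forall>x. x \<noteq> 0 \<and> norm x < 1 \<longrightarrow>
      x ^ j * eval_fps f x * diff3 (x ^ n) ^ d * (- 1 / 16 * odd_prod24 (x ^ n) / x ^ n) ^ N * theta_b (x ^ n) ^ m2
      = C * exp (of_nat j / of_nat n * l (x ^ n)) * theta_b (x ^ n) ^ m1
        * poly Q (- 1 / 16 * odd_prod24 (x ^ n) / x ^ n))"

text \<open>The triple \<open>G\<close> has weight 0, sign 1 and no pole at infinity, so it is given
  by one polynomial \<open>Q\<close>. Undoing the multiplications yields an identity at each cusp,
  and both share \<open>Q\<close> and the exponents.\<close>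

lemma vvmf_hauptmodul_poly:
  fixes F :: "complex \<Rightarrow> complex^3" and \<epsilon> :: real and c :: "3 \<Rightarrow> nat \<Rightarrow> complex"
  assumes F: "F \<in> vv_modular_forms n k \<rho>" and n: "n > 0"
    and rho_S: "\<rho> (to_PSL2Z matS) =
      \<epsilon> *\<^sub>R vector [vector [0, 0, \<zeta>], vector [0, 1, 0], vector [cnj \<zeta>, 0, 0]]"
    and rho_T: "\<rho> (to_PSL2Z matT) =
      \<epsilon> *\<^sub>R vector [vector [\<zeta>, 0, 0], vector [0, 0, 1], vector [0, cnj \<zeta>, 0]]"
    and \<zeta>: "\<zeta> = nome (2 * of_nat j / of_nat n)"
    and \<epsilon>: "\<epsilon> \<in> {1, -1}" and k: "even k"
    and c: "\<And>i. has_fourier_expansion (2 * n) (\<lambda>\<tau>. F \<tau> $ i) (c i)"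
    and l: "l holomorphic_on ball 0 1" "\<forall>z. norm z < 1 \<longrightarrow> exp (l z) = odd_prod24 z"
  obtains Q :: "complex poly" and d N m1 m2 :: nat and C1 C3 :: complex
  where "expansion_at_infinity n j l (Abs_fps (c 1)) d N m2 C1 m1 Q"
    and "expansion_at_zero n j l (Abs_fps (c 3)) d N m2 C3 m1 Q"
proof -
  let ?x = "\<lambda>\<tau>. nome (\<tau> / of_nat n)"
  define r :: complex where "r = of_nat j / of_nat n"
  obtain L :: "3 \<Rightarrow> complex \<Rightarrow> complex" and c1 c3 a where L_all: "\<forall>\<tau>. Im \<tau> > 0 \<longrightarrow>
    L 1 \<tau> = c1 + 2 * of_real pi * \<i> * \<tau> - l (nome \<tau> ^ 2) \<and>
    L 3 \<tau> = c3 - of_real pi * \<i> * \<tau> + l (nome \<tau>) \<and>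
    L 1 (\<tau> + 1) = L 1 \<tau> + 2 * of_real pi * \<i> \<and>
    L 2 (\<tau> + 1) = L 3 \<tau> - 2 * of_real pi * \<i> \<and>
    L 3 (\<tau> + 1) = L 2 \<tau> \<and>
    L 1 (- 1 / \<tau>) = L 3 \<tau> + a \<and>
    L 2 (- 1 / \<tau>) = L 2 \<tau> \<and>
    L 3 (- 1 / \<tau>) = L 1 \<tau> - a"
    using hauptmodul_log[OF l] by (elim exE)
  have L1: "L 1 \<tau> = c1 + 2 * of_real pi * \<i> * \<tau> - l (nome \<tau> ^ 2)"
    and L3: "L 3 \<tau> = c3 - of_real pi * \<i> * \<tau> + l (nome \<tau>)"
    and L: "L 1 (\<tau> + 1) = L 1 \<tau> + 2 * of_real pi * \<i>"
      "L 2 (\<tau> + 1) = L 3 \<tau> - 2 * of_real pi * \<i>"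
      "L 3 (\<tau> + 1) = L 2 \<tau>"
      "L 1 (- 1 / \<tau>) = L 3 \<tau> + a"
      "L 2 (- 1 / \<tau>) = L 2 \<tau>"
      "L 3 (- 1 / \<tau>) = L 1 \<tau> - a" if "Im \<tau> > 0" for \<tau>
    using L_all[rule_format, OF that] by blast+
  define K where "K = (\<lambda>i :: 3. if i = 1 then 1 else if i = 2 then exp (- r * a) else exp (- r * a) * \<zeta>)"
  define Y where "Y = (\<lambda>i \<tau>. K i * F \<tau> $ i * exp (- r * L i \<tau>))"
  have e\<zeta>: "exp (r * (2 * of_real pi * \<i>)) = \<zeta>"
    by (simp add: \<zeta> nome_def r_def mult_ac)
  have "norm \<zeta> = 1" by (simp add: \<zeta> norm_nome)
  then have \<zeta>1: "\<zeta> * cnj \<zeta> = 1" using complex_norm_square[of \<zeta>] by simp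
  have Y: "perm_form k (of_real \<epsilon>) Y"
    unfolding Y_def K_def by (rule perm_form_F_over_log[OF F rho_S rho_T e\<zeta> \<zeta>1 L])
  obtain k' where k': "k = 2 * k'" using k by (auto elim: evenE)
  \<comment> \<open>The sign \<epsilon> (-1)^(k' + d) must be 1. One further factor
    \<open>theta4_diff\<close> is balanced in weight by one further division by
    \<open>theta4\<close>, which flips the sign, so \<open>d\<close> is 0 or 1.\<close>
  obtain d :: nat where d: "of_real \<epsilon> * (- 1 :: complex) powi (k' + int d) = 1"
  proof -
    have "of_real \<epsilon> * (- 1 :: complex) powi (k' + int 0) = 1 \<or> of_real \<epsilon> * (- 1 :: complex) powi (k' + int 1) = 1"
      using \<epsilon> by (cases "even k'") (auto simp: power_int_minus_left)
    then show ?thesis using that by blast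
  qed
  \<comment> \<open>Division by \<open>theta4\<close> to the power \<open>m\<close> cancels the
    weight 2 k' + 2 d, and it is harmless because \<open>theta4\<close> has no zeros. As
    \<open>m\<close> may have either sign, it is split into natural numbers.\<close>
  define m where "m = k' + int d"
  define m1 where "m1 = nat m"
  define m2 where "m2 = nat (- m)"
  have m: "- m = int m2 - int m1" by (simp add: m1_def m2_def)
  \<comment> \<open>At infinity, in the local parameter, exp(-r L 1) has a pole of order 2 j and the
    power of \<open>theta4\<close> one of order at most n m1, while each factor
    \<open>hauptmodul 1\<close> has a zero of order 2 n.\<close>
  define N where "N = j + m1"
  define G where "G = (\<lambda>i \<tau>. Y i \<tau> * theta4 i \<tau> powi (- m) * theta4_diff i \<tau> ^ d * hauptmodul i \<tau> ^ N)"
  have "perm_form (k + 2 * (- m) + 2 * int d + 0 * int N) (of_real \<epsilon> * (- 1) powi (- m) * 1 ^ d * 1 ^ N) G"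
    unfolding G_def
    by (rule perm_form_mult[OF perm_form_mult[OF perm_form_mult[OF Y perm_form_powi[OF perm_form_theta4]]
          perm_form_power[OF perm_form_theta4_diff]] perm_form_power[OF perm_form_hauptmodul]])
  moreover have "(- 1 :: complex) powi (- m) = (- 1) powi m"
    by (simp add: power_int_minus_left)
  ultimately have G: "perm_form 0 1 G"
    using d by (simp add: k' m_def)
  define f1 where "f1 = eval_fps (Abs_fps (c 1))"
  define f3 where "f3 = eval_fps (Abs_fps (c 3))"
  have f_hol: "eval_fps (Abs_fps (c i)) holomorphic_on ball 0 1" for i
  proof (rule holomorphic_on_subset[OF holomorphic_on_eval_fps[OF subset_refl]])
    show "ball 0 1 \<subseteq> eball 0 (fps_conv_radius (Abs_fps (c i)))"
      using has_fourier_expansion_eval_fps(1)[OF c n, of i] ball_eball_mono[of 1] by (simp add: one_ereal_def)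
  qed
  have F1: "F \<tau> $ 1 = f1 (?x \<tau>)" and F3: "F \<tau> $ 3 = f3 (?x \<tau>)" if "Im \<tau> > 0" for \<tau>
    using has_fourier_expansion_eval_fps(2)[OF c n that] by (simp_all add: f1_def f3_def)
  have xn: "?x \<tau> ^ n = nome \<tau>" for \<tau> using n by (simp add: nome_power)
  have x2n: "?x \<tau> ^ (2 * n) = nome \<tau> ^ 2" for \<tau>
    by (simp only: mult.commute[of 2] power_mult xn)
  define B1 where "B1 = exp (- r * c1)"
  define B3 where "B3 = exp (- r * a) * \<zeta> * exp (- r * c3)"
  have B: "B1 \<noteq> 0" "B3 \<noteq> 0" using \<zeta> by (simp_all add: B1_def B3_def)
  have Y1: "Y 1 \<tau> * ?x \<tau> ^ (2 * j) = B1 * f1 (?x \<tau>) * exp (r * l (?x \<tau> ^ (2 * n)))"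
    and Y3: "Y 3 \<tau> = B3 * ?x \<tau> ^ j * f3 (?x \<tau>) * exp (- r * l (?x \<tau> ^ n))"
    if \<tau>: "Im \<tau> > 0" for \<tau>
  proof -
    have "exp (- r * L 1 \<tau>) * ?x \<tau> ^ (2 * j) = exp (- r * L 1 \<tau> + r * (2 * of_real pi * \<i> * \<tau>))"
      unfolding exp_add nome_power by (simp add: nome_def r_def mult_ac)
    also have "- r * L 1 \<tau> + r * (2 * of_real pi * \<i> * \<tau>) = - r * c1 + r * l (nome \<tau> ^ 2)"
      unfolding L1[OF \<tau>] by (simp add: algebra_simps)
    finally show "Y 1 \<tau> * ?x \<tau> ^ (2 * j) = B1 * f1 (?x \<tau>) * exp (r * l (?x \<tau> ^ (2 * n)))"
      unfolding Y_def K_def B1_def x2n F1[OF \<tau>] exp_add by (simp add: mult_ac)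
    have "exp (- r * L 3 \<tau>) = exp (- r * c3) * exp (r * (of_real pi * \<i> * \<tau>)) * exp (- r * l (nome \<tau>))"
      unfolding L3[OF \<tau>] exp_add[symmetric] by (simp add: algebra_simps)
    moreover have "exp (r * (of_real pi * \<i> * \<tau>)) = ?x \<tau> ^ j"
      unfolding nome_power by (simp add: nome_def r_def mult_ac)
    ultimately show "Y 3 \<tau> = B3 * ?x \<tau> ^ j * f3 (?x \<tau>) * exp (- r * l (?x \<tau> ^ n))"
      unfolding Y_def K_def B3_def xn F3[OF \<tau>] by (simp add: mult_ac)
  qed
  have th: "theta4 1 \<tau> = 16 * ?x \<tau> ^ n * theta_a (?x \<tau> ^ n)"
    "theta4 3 \<tau> = theta_b (?x \<tau> ^ n)"
    "theta4_diff 1 \<tau> = diff1 (?x \<tau> ^ n)" "theta4_diff 3 \<tau> = diff3 (?x \<tau> ^ n)" for \<tau>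
    unfolding xn theta4_diff_eq by (simp_all add: theta4_def)
  have J: "hauptmodul 1 \<tau> = - 256 * ?x \<tau> ^ (2 * n) / odd_prod24 (?x \<tau> ^ (2 * n))"
    "hauptmodul 3 \<tau> = - 1 / 16 * odd_prod24 (?x \<tau> ^ n) / ?x \<tau> ^ n" if "Im \<tau> > 0" for \<tau>
    unfolding xn x2n by (rule hauptmodul_eq[OF that])+
  have Gpow: "G i \<tau> * theta4 i \<tau> ^ m1 = Y i \<tau> * theta4 i \<tau> ^ m2 * theta4_diff i \<tau> ^ d * hauptmodul i \<tau> ^ N" if "Im \<tau> > 0" for i \<tau>
    using theta4_nonzero[OF that, of i] unfolding G_def m by (simp add: power_int_minus_diff_nat)
  define e1 where "e1 = n * m2 + 2 * n * N - (2 * j + n * m1)"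
  have e1: "n * m2 + 2 * n * N = e1 + (2 * j + n * m1)"
  proof -
    have "2 * j \<le> 2 * n * j" "n * m1 \<le> 2 * n * m1" using n by simp_all
    then have "2 * j + n * m1 \<le> 2 * n * N"
      unfolding N_def distrib_left by (rule add_mono)
    then show ?thesis by (simp add: e1_def)
  qed
  define g1 where "g1 = (\<lambda>x. B1 * f1 x * exp (r * l (x ^ (2 * n))) * (16 * theta_a (x ^ n)) ^ m2 * diff1 (x ^ n) ^ d
     * (- 256 / odd_prod24 (x ^ (2 * n))) ^ N * x ^ e1 / (16 * theta_a (x ^ n)) ^ m1)"
  define g3 where "g3 = (\<lambda>x. B3 * x ^ j * f3 x * exp (- r * l (x ^ n)) * theta_b (x ^ n) ^ m2 * diff3 (x ^ n) ^ d
     * (- 1 / 16 * odd_prod24 (x ^ n)) ^ N / theta_b (x ^ n) ^ m1)"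
  have n2: "2 * n > 0" using n by simp
  have nb: "norm x < 1 \<Longrightarrow> norm (x ^ n) < 1" "norm x < 1 \<Longrightarrow> norm (x ^ (2 * n)) < 1" for x :: complex
    using norm_power_less_1 n n2 by blast+
  have "g1 holomorphic_on ball 0 1"
    unfolding g1_def f1_def
    by (intro holomorphic_intros f_hol holomorphic_on_ball_power[OF l(1) n2] holomorphic_on_ball_power[OF theta_a_holomorphic n]
          holomorphic_on_ball_power[OF diff1_holomorphic n] holomorphic_on_ball_power[OF odd_prod24_holomorphic n2])
       (use nb odd_prod24_nonzero theta_a_nonzero in auto)
  moreover have "g3 holomorphic_on ball 0 1"
    unfolding g3_def f3_def
    by (intro holomorphic_intros f_hol holomorphic_on_ball_power[OF l(1) n] holomorphic_on_ball_power[OF theta_b_holomorphic n]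
          holomorphic_on_ball_power[OF diff3_holomorphic n] holomorphic_on_ball_power[OF odd_prod24_holomorphic n])
       (use nb theta_b_nonzero in auto)
  moreover have "G 1 \<tau> = g1 (?x \<tau>)" if \<tau>: "Im \<tau> > 0" for \<tau>
  proof -
    define x where "x = ?x \<tau>"
    have x: "norm x < 1" "x \<noteq> 0"
      using norm_nome_less_1[of "\<tau> / of_nat n"] \<tau> n by (simp_all add: x_def Im_divide_of_nat)
    have ta: "theta_a (x ^ n) \<noteq> 0" by (intro theta_a_nonzero nb x)
    have pa: "(16 * x ^ n * theta_a (x ^ n)) ^ b = (16 * theta_a (x ^ n)) ^ b * x ^ (n * b)" for b
      by (simp add: power_mult_distrib power_mult)
    have "- 256 * x ^ (2 * n) / odd_prod24 (x ^ (2 * n)) = (- 256 / odd_prod24 (x ^ (2 * n))) * x ^ (2 * n)"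
      by simp
    then have pJ: "(- 256 * x ^ (2 * n) / odd_prod24 (x ^ (2 * n))) ^ N = (- 256 / odd_prod24 (x ^ (2 * n))) ^ N * x ^ (2 * n * N)"
      by (simp only: power_mult_distrib power_mult[of x "2 * n" N])
    have "G 1 \<tau> * (16 * x ^ n * theta_a (x ^ n)) ^ m1 * x ^ (2 * j)
      = (Y 1 \<tau> * x ^ (2 * j)) * (16 * x ^ n * theta_a (x ^ n)) ^ m2 * diff1 (x ^ n) ^ d * (- 256 * x ^ (2 * n) / odd_prod24 (x ^ (2 * n))) ^ N"
      using Gpow[OF \<tau>, of 1] unfolding th J[OF \<tau>] x_def by (simp only: ac_simps)
    also have "\<dots> = B1 * f1 x * exp (r * l (x ^ (2 * n))) * (16 * theta_a (x ^ n)) ^ m2 * diff1 (x ^ n) ^ d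
     * (- 256 / odd_prod24 (x ^ (2 * n))) ^ N * x ^ (n * m2 + 2 * n * N)"
      unfolding Y1[OF \<tau>, folded x_def] pa pJ power_add by (simp only: ac_simps)
    also have "\<dots> = g1 x * (16 * theta_a (x ^ n)) ^ m1 * x ^ (2 * j + n * m1)"
      unfolding e1 g1_def using ta by (simp add: power_add)
    also have "\<dots> = g1 x * (16 * x ^ n * theta_a (x ^ n)) ^ m1 * x ^ (2 * j)"
      unfolding pa power_add by (simp only: ac_simps)
    finally show ?thesis
      using x ta unfolding x_def[symmetric] by simp
  qed
  moreover have "G 3 \<tau> * ?x \<tau> ^ (n * N) = g3 (?x \<tau>)" if \<tau>: "Im \<tau> > 0" for \<tau>
  proof -
    define x where "x = ?x \<tau>"
    have x: "norm x < 1" "x \<noteq> 0"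
      using norm_nome_less_1[of "\<tau> / of_nat n"] \<tau> n by (simp_all add: x_def Im_divide_of_nat)
    have tb: "theta_b (x ^ n) \<noteq> 0" by (intro theta_b_nonzero nb x)
    have "(- 1 / 16 * odd_prod24 (x ^ n) / x ^ n) ^ N * x ^ (n * N) = (- 1 / 16 * odd_prod24 (x ^ n)) ^ N"
      unfolding power_mult power_mult_distrib[symmetric] using x by simp
    then have "G 3 \<tau> * theta_b (x ^ n) ^ m1 * x ^ (n * N) = Y 3 \<tau> * theta_b (x ^ n) ^ m2 * diff3 (x ^ n) ^ d * (- 1 / 16 * odd_prod24 (x ^ n)) ^ N"
      using Gpow[OF \<tau>, of 3] unfolding th J[OF \<tau>] x_def by (simp only: mult.assoc)
    also have "\<dots> = g3 x * theta_b (x ^ n) ^ m1"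
      unfolding g3_def Y3[OF \<tau>] using tb by (simp add: x_def)
    finally have "(G 3 \<tau> * x ^ (n * N)) * theta_b (x ^ n) ^ m1 = g3 x * theta_b (x ^ n) ^ m1"
      by (simp only: ac_simps)
    then show ?thesis using tb unfolding x_def[symmetric] by simp
  qed
  ultimately obtain Q where Q: "\<And>i \<tau>. Im \<tau> > 0 \<Longrightarrow> G i \<tau> = poly Q (hauptmodul i \<tau>)"
    using perm_form_hauptmodul_poly[OF G n] by blast
  have "(eval_fps (Abs_fps (c 1)) x * diff1 (x ^ n) ^ d * (- 256 * x ^ (2 * n) / odd_prod24 (x ^ (2 * n))) ^ N * (16 * x ^ n * theta_a (x ^ n)) ^ m2
      = 1 / B1 * x ^ (2 * j) * exp (- (of_nat j / of_nat n) * l (x ^ (2 * n))) * (16 * x ^ n * theta_a (x ^ n)) ^ m1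
        * poly Q (- 256 * x ^ (2 * n) / odd_prod24 (x ^ (2 * n)))) \<and>
    (x ^ j * eval_fps (Abs_fps (c 3)) x * diff3 (x ^ n) ^ d * (- 1 / 16 * odd_prod24 (x ^ n) / x ^ n) ^ N * theta_b (x ^ n) ^ m2
      = 1 / B3 * exp (of_nat j / of_nat n * l (x ^ n)) * theta_b (x ^ n) ^ m1
        * poly Q (- 1 / 16 * odd_prod24 (x ^ n) / x ^ n))"
    (is "?id1 \<and> ?id3") if x: "x \<noteq> 0" "norm x < 1" for x
  proof -
    obtain \<tau> where \<tau>: "Im \<tau> > 0" "?x \<tau> = x"
      using nome_surj_disc[OF x n] by blast
    note p1 = Gpow[OF \<tau>(1), of 1, unfolded Q[OF \<tau>(1)] th J[OF \<tau>(1)] \<tau>(2)]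
    note p3 = Gpow[OF \<tau>(1), of 3, unfolded Q[OF \<tau>(1)] th J[OF \<tau>(1)] \<tau>(2)]
    have ee: "exp (r * z) * exp (- r * z) = 1" "exp (- r * z) * exp (r * z) = 1" for z
      by (simp_all flip: exp_add)
    define E1 where "E1 = exp (- r * l (x ^ (2 * n)))"
    define E3 where "E3 = exp (r * l (x ^ n))"
    have y1: "f1 x = 1 / B1 * (Y 1 \<tau> * x ^ (2 * j)) * E1"
      using Y1[OF \<tau>(1)] B(1) ee(1)[of "l (x ^ (2 * n))"] unfolding \<tau>(2) E1_def by simp
    have y3: "x ^ j * f3 x = 1 / B3 * Y 3 \<tau> * E3"
      using Y3[OF \<tau>(1)] B(2) ee(2)[of "l (x ^ n)"] unfolding \<tau>(2) E3_def by simp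
    show ?thesis
    proof
      show ?id1
      proof -
        have "f1 x * diff1 (x ^ n) ^ d * (- 256 * x ^ (2 * n) / odd_prod24 (x ^ (2 * n))) ^ N * (16 * x ^ n * theta_a (x ^ n)) ^ m2
          = 1 / B1 * x ^ (2 * j) * E1 * (Y 1 \<tau> * (16 * x ^ n * theta_a (x ^ n)) ^ m2 * diff1 (x ^ n) ^ d * (- 256 * x ^ (2 * n) / odd_prod24 (x ^ (2 * n))) ^ N)"
          unfolding y1 by (simp only: ac_simps)
        then show ?thesis
          unfolding p1[symmetric] f1_def r_def[symmetric] E1_def[symmetric] by (simp only: ac_simps)
      qed
      show ?id3
      proof -
        have "x ^ j * f3 x * diff3 (x ^ n) ^ d * (- 1 / 16 * odd_prod24 (x ^ n) / x ^ n) ^ N * theta_b (x ^ n) ^ m2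
          = 1 / B3 * E3 * (Y 3 \<tau> * theta_b (x ^ n) ^ m2 * diff3 (x ^ n) ^ d * (- 1 / 16 * odd_prod24 (x ^ n) / x ^ n) ^ N)"
          unfolding y3 by (simp only: ac_simps)
        then show ?thesis
          unfolding p3[symmetric] f3_def r_def[symmetric] E3_def[symmetric] by (simp only: ac_simps)
      qed
    qed
  qed
  then show ?thesis
    using that[of d N m2 "1 / B1" m1 Q "1 / B3"]
    by (auto simp: expansion_at_infinity_def expansion_at_zero_def)
qed

section \<open>Integral expansions of the theta constants and their differences\<close>

definition int_fps :: "complex fps \<Rightarrow> bool" where
  "int_fps f \<longleftrightarrow> (\<forall>m. fps_nth f m \<in> \<int>)"

lemma int_fps_unit: "int_unit_fps f \<Longrightarrow> int_fps f"
  by (simp add: int_fps_def int_unit_fps_def)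

lemma int_fps_mult: "int_fps f \<Longrightarrow> int_fps g \<Longrightarrow> int_fps (f * g)"
  by (auto simp: int_fps_def intro: fps_nth_Ints_mult)

lemma int_fps_power: "int_fps f \<Longrightarrow> int_fps (f ^ k)"
  by (auto simp: int_fps_def intro: fps_nth_Ints_power)

lemma int_fps_X: "int_fps fps_X"
  by (simp add: int_fps_def fps_X_def)

lemma int_fps_add: "int_fps f \<Longrightarrow> int_fps g \<Longrightarrow> int_fps (f + g)"
  and int_fps_minus: "int_fps f \<Longrightarrow> int_fps (- f)"
  and int_fps_diff: "int_fps f \<Longrightarrow> int_fps g \<Longrightarrow> int_fps (f - g)"
  by (auto simp: int_fps_def)

lemma int_fps_const: "a \<in> \<int> \<Longrightarrow> int_fps (fps_const a)"
  by (simp add: int_fps_def)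

lemma int_fps_compose: "int_fps f \<Longrightarrow> int_fps g \<Longrightarrow> int_fps (f oo g)"
  using fps_nth_Ints_power[of g] by (auto simp: int_fps_def fps_compose_nth)

lemmas int_fps_intros = int_fps_mult int_fps_power int_fps_X int_fps_add int_fps_minus int_fps_diff
  int_fps_const int_fps_compose

definition theta_b_minus_fps :: "complex fps" where
  "theta_b_minus_fps = theta_b_fps oo (- fps_X)"

definition diff1_fps :: "complex fps" where
  "diff1_fps = - theta_b_minus_fps - theta_b_fps"

definition diff3_fps :: "complex fps" where
  "diff3_fps = fps_const 16 * fps_X * theta_a_fps + theta_b_minus_fps"

lemma theta_b_minus_has_fps_expansion: "(\<lambda>y. theta_b (- y)) has_fps_expansion theta_b_minus_fps"
  using has_fps_expansion_compose[OF theta_b_has_fps_expansion has_fps_expansion_minus[OF has_fps_expansion_fps_X]]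
  by (simp add: o_def theta_b_minus_fps_def)

lemma diff1_has_fps_expansion: "diff1 has_fps_expansion diff1_fps"
  and diff3_has_fps_expansion: "diff3 has_fps_expansion diff3_fps"
  unfolding diff1_def[abs_def] diff1_fps_def diff3_def[abs_def] diff3_fps_def
  by (intro has_fps_expansion_diff has_fps_expansion_minus has_fps_expansion_add has_fps_expansion_mult
      has_fps_expansion_const has_fps_expansion_fps_X
      theta_b_minus_has_fps_expansion theta_b_has_fps_expansion theta_a_has_fps_expansion)+

lemma int_fps_diff1: "int_fps diff1_fps" and int_fps_diff3: "int_fps diff3_fps"
  unfolding diff1_fps_def diff3_fps_def theta_b_minus_fps_def
  by (intro int_fps_intros int_fps_unit[OF int_unit_theta_a_fps] int_fps_unit[OF int_unit_theta_b_fps]; simp)+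

lemma diff1_fps_nth_0: "fps_nth diff1_fps 0 = - 2" and diff3_fps_nth_0: "fps_nth diff3_fps 0 = 1"
  using int_unit_fpsD(2)[OF int_unit_theta_b_fps]
  by (simp_all add: diff1_fps_def diff3_fps_def theta_b_minus_fps_def)

lemma compose_X_power_nonzero:
  "k > 0 \<Longrightarrow> fps_nth f 0 \<noteq> 0 \<Longrightarrow> (f oo fps_X ^ k) \<noteq> (0 :: complex fps)"
  by (metis fps_nth_compose_X_power dvd_0_right div_0 fps_zero_nth)

lemma int_unit_fps_compose_expansion:
  assumes U: "int_unit_fps U" "fps_nth U 1 = of_int c" and "k > 0"
  obtains g where "U oo fps_X ^ k = 1 + fps_X ^ k * g" "fps_nth g 0 = of_int c"
proof -
  obtain g where g: "U = 1 + fps_X * g" "fps_nth g 0 = fps_nth U 1"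
    by (rule fps_eq_1_plus[OF int_unit_fpsD(2)[OF U(1)]])
  have X0: "fps_nth (fps_X ^ k :: complex fps) 0 = 0" using \<open>k > 0\<close> by (simp add: fps_X_power_nth)
  have "U oo fps_X ^ k = 1 + fps_X ^ k * (g oo fps_X ^ k)"
    unfolding g(1) fps_compose_add_distrib fps_compose_mult_distrib[OF X0] by (simp only: fps_X_fps_compose_startby0[OF X0] fps_compose_1)
  moreover have "fps_nth (g oo fps_X ^ k) 0 = of_int c"
    using g(2) U(2) by simp
  ultimately show ?thesis using that by blast
qed

section \<open>The contradiction at the two cusps\<close>

context prime_over
begin

text \<open>The form of the argument common to both cusps: the identity of functions on the
  punctured disc becomes one of power series, and the summands start at distinct exponents t + e i,
  the triangular shape required.\<close>

lemma punctured_identity_contradiction: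
  fixes f AF HF u :: "complex fps" and A h w :: "complex \<Rightarrow> complex" and c \<alpha> \<kappa> :: int
  assumes f: "fps_conv_radius f \<ge> 1" "bounded_denominators f" "f \<noteq> 0"
    and A: "A has_fps_expansion AF" "int_fps AF" "AF \<noteq> 0"
    and h: "h holomorphic_on ball 0 1" "h 0 = 1" "\<And>x. norm x < 1 \<Longrightarrow> h x ^ n = w x"
    and n: "n > 0"
    and w: "w has_fps_expansion (U oo fps_X ^ s)" "int_unit_fps U" "fps_nth U 1 = of_int c" "s > 0"
    and v: "\<And>i. v i has_fps_expansion VF i" "\<And>i. int_unit_fps (VF i)" and e: "e > 0"
    and eq: "\<And>x. x \<noteq> 0 \<Longrightarrow> norm x < 1 \<Longrightarrow>
      eval_fps f x * A x = h x * (\<Sum>i\<le>D. a i * x ^ (t + e * i) * v i x)"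
    and c: "\<kappa> * c * int p = \<alpha> * int n" "\<not> int p dvd \<alpha>"
  shows False
proof -
  define HF where "HF = fps_expansion h 0"
  have HF: "h has_fps_expansion HF"
    unfolding HF_def by (rule has_fps_expansion_fps_expansion[OF _ _ h(1)]) auto
  have HF0: "fps_nth HF 0 = 1"
    using has_fps_expansion_imp_0_eq_fps_nth_0[OF HF] h(2) by simp
  have HFn: "HF ^ n = U oo fps_X ^ s"
    by (rule has_fps_expansion_unique_punctured[OF has_fps_expansion_power[OF HF] w(1)]) (use h(3) in auto)
  define B where "B = (\<Sum>i\<le>D. fps_const (a i) * fps_X ^ (t + e * i) * VF i)"
  have Bexp: "(\<lambda>x. \<Sum>i\<le>D. a i * x ^ (t + e * i) * v i x) has_fps_expansion B"
    unfolding B_def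
    by (intro has_fps_expansion_sum has_fps_expansion_mult has_fps_expansion_const has_fps_expansion_fps_X_power v)
  have "fps_conv_radius f > 0" by (rule less_le_trans[OF _ f(1)]) simp
  then have "eval_fps f has_fps_expansion f" by (rule eval_fps_has_fps_expansion)
  then have id: "f * AF = HF * B"
    by (rule has_fps_expansion_unique_punctured[OF has_fps_expansion_mult[OF _ A(1)] has_fps_expansion_mult[OF HF Bexp] eq])
  have "B \<noteq> 0" using id f(3) A(3) by auto
  obtain g where g: "U oo fps_X ^ s = 1 + fps_X ^ s * g" "fps_nth g 0 = of_int c"
    by (rule int_unit_fps_compose_expansion[OF w(2-4)])
  have uI: "fps_nth (U oo fps_X ^ s) m \<in> \<int>" for m
    by (rule int_unit_fpsD(1)[OF int_unit_fps_compose[OF w(4,2)]])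
  have AI: "fps_nth AF m \<in> \<int>" for m using A(2) by (simp add: int_fps_def)
  show False
    by (rule triangular_root_contradiction[OF f(2) AI id \<open>B \<noteq> 0\<close> B_def e int_unit_fpsD(1)[OF v(2)] int_unit_fpsD(2)[OF v(2)]
        HFn n HF0 uI g c])
qed

text \<open>At infinity the root is odd_prod24(x^(2n)) to the power -j/n; its n-th power is a series
  in x^(2n) with linear coefficient 24 j. The i-th power of the Hauptmodul starts at x^(2 n i),
  which separates the exponents.\<close>

lemma component_1_contradiction:
  fixes f :: "complex fps" and c \<alpha> \<kappa> :: int
  assumes f: "fps_conv_radius f \<ge> 1" "bounded_denominators f" "f \<noteq> 0" and n: "n > 0"
    and l: "l holomorphic_on ball 0 1" "\<forall>z. norm z < 1 \<longrightarrow> exp (l z) = odd_prod24 z" "l 0 = 0"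
    and eq: "expansion_at_infinity n j l f d N m2 C1 m1 Q"
    and c: "\<kappa> * (24 * int j) * int p = \<alpha> * int n" "\<not> int p dvd \<alpha>"
  shows False
proof -
  have n2: "2 * n > 0" using n by simp
  define W where "W = inverse odd_prod24_fps"
  have W: "int_unit_fps W" unfolding W_def by (intro int_unit_fps_inverse int_unit_odd_prod24_fps)
  have Wexp: "(\<lambda>y. inverse (odd_prod24 y)) has_fps_expansion W"
    unfolding W_def using int_unit_fpsD(2)[OF int_unit_odd_prod24_fps]
    by (intro has_fps_expansion_inverse odd_prod24_has_fps_expansion) simp
  have "fps_nth (odd_prod24_fps * W) 1 = 0"
    unfolding W_def using int_unit_fpsD(2)[OF int_unit_odd_prod24_fps] by (simp add: inverse_mult_eq_1')
  then have W1: "fps_nth W 1 = 24"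
    using int_unit_fpsD(2)[OF int_unit_odd_prod24_fps] int_unit_fpsD(2)[OF W] odd_prod24_fps_nth_1
    by (simp add: fps_mult_nth add_eq_0_iff)
  have Wj: "fps_nth (W ^ j) 1 = of_int (24 * int j)"
    unfolding fps_nth_1_power[OF int_unit_fpsD(2)[OF W]] W1 by simp
  have nb: "norm x < 1 \<Longrightarrow> norm (x ^ (2 * n)) < 1" for x :: complex
    using norm_power_less_1 n2 by blast
  define h where "h = (\<lambda>x. exp (- (of_nat j / of_nat n) * l (x ^ (2 * n))))"
  have h: "h holomorphic_on ball 0 1"
    unfolding h_def by (intro holomorphic_intros holomorphic_on_ball_power[OF l(1) n2])
  have h0: "h 0 = 1"
    using n by (simp add: h_def l(3) zero_power)
  have hn: "h x ^ n = inverse (odd_prod24 (x ^ (2 * n))) ^ j" if "norm x < 1" for x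
  proof -
    have "h x ^ n = exp (- (of_nat j * l (x ^ (2 * n))))"
      using n by (simp add: h_def flip: exp_of_nat_mult)
    also have "\<dots> = inverse (exp (l (x ^ (2 * n)))) ^ j"
      by (simp add: exp_minus exp_of_nat_mult power_inverse)
    finally show ?thesis using l(2) nb[OF that] by simp
  qed
  have wexp: "(\<lambda>x. inverse (odd_prod24 (x ^ (2 * n))) ^ j) has_fps_expansion (W ^ j oo fps_X ^ (2 * n))"
    using has_fps_expansion_compose_power[OF has_fps_expansion_power[OF Wexp] n2] .
  define AF where "AF = (diff1_fps oo fps_X ^ n) ^ d * (fps_const (- 256) * fps_X ^ (2 * n) * (W oo fps_X ^ (2 * n))) ^ N
    * (fps_const 16 * fps_X ^ n * (theta_a_fps oo fps_X ^ n)) ^ m2"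
  define A where "A = (\<lambda>x. diff1 (x ^ n) ^ d * (- 256 * x ^ (2 * n) * inverse (odd_prod24 (x ^ (2 * n)))) ^ N
    * (16 * x ^ n * theta_a (x ^ n)) ^ m2)"
  have A: "A has_fps_expansion AF"
    unfolding A_def AF_def
    by (intro has_fps_expansion_mult has_fps_expansion_power has_fps_expansion_const has_fps_expansion_fps_X_power
        has_fps_expansion_compose_power[OF diff1_has_fps_expansion n] has_fps_expansion_compose_power[OF Wexp n2]
        has_fps_expansion_compose_power[OF theta_a_has_fps_expansion n])
  have AI: "int_fps AF"
    unfolding AF_def
    by (intro int_fps_intros int_fps_diff1 int_fps_unit[OF W] int_fps_unit[OF int_unit_theta_a_fps]) simp_all
  have "(diff1_fps oo fps_X ^ n) \<noteq> 0" "(W oo fps_X ^ (2 * n)) \<noteq> 0" "(theta_a_fps oo fps_X ^ n) \<noteq> 0"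
    using n n2 diff1_fps_nth_0 int_unit_fpsD(2)[OF W] int_unit_fpsD(2)[OF int_unit_theta_a_fps]
    by (intro compose_X_power_nonzero; simp)+
  then have A0: "AF \<noteq> 0" unfolding AF_def by simp
  define v where "v = (\<lambda>i x. inverse (odd_prod24 (x ^ (2 * n))) ^ i * theta_a (x ^ n) ^ m1)"
  define VF where "VF = (\<lambda>i. (W oo fps_X ^ (2 * n)) ^ i * (theta_a_fps oo fps_X ^ n) ^ m1)"
  have v: "v i has_fps_expansion VF i" for i
    unfolding v_def VF_def
    by (intro has_fps_expansion_mult has_fps_expansion_power has_fps_expansion_compose_power[OF Wexp n2]
        has_fps_expansion_compose_power[OF theta_a_has_fps_expansion n])
  have VF: "int_unit_fps (VF i)" for i
    unfolding VF_def by (intro int_unit_fps_mult int_unit_fps_power int_unit_fps_compose W int_unit_theta_a_fps n n2)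
  define a where "a = (\<lambda>i. C1 * 16 ^ m1 * coeff Q i * (- 256) ^ i)"
  have id: "eval_fps f x * A x = h x * (\<Sum>i\<le>degree Q. a i * x ^ ((2 * j + n * m1) + (2 * n) * i) * v i x)"
    if "x \<noteq> 0" "norm x < 1" for x
  proof -
    have "(\<Sum>i\<le>degree Q. a i * x ^ ((2 * j + n * m1) + (2 * n) * i) * v i x)
      = C1 * x ^ (2 * j) * (16 * x ^ n * theta_a (x ^ n)) ^ m1 * poly Q (- 256 * x ^ (2 * n) * inverse (odd_prod24 (x ^ (2 * n))))"
      unfolding poly_altdef sum_distrib_left a_def v_def power_mult_distrib power_add power_mult
      by (simp only: ac_simps)
    then show ?thesis
      using eq[unfolded expansion_at_infinity_def, rule_format, OF conjI[OF that]] unfolding A_def h_def divide_inverse[of "- 256 * x ^ (2 * n)"] by (simp only: ac_simps)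
  qed
  show False
    by (rule punctured_identity_contradiction[OF f A AI A0 h h0 hn n wexp int_unit_fps_power[OF W] Wj n2 v VF n2 id c])
qed

text \<open>At the cusp 0 the root is odd_prod24(x^n) to the power j/n. The linear coefficient
  becomes -24 j, which is absorbed by changing the sign of \<alpha>.\<close>

lemma component_3_contradiction:
  fixes f :: "complex fps" and c \<alpha> \<kappa> :: int
  assumes f: "fps_conv_radius f \<ge> 1" "bounded_denominators f" "f \<noteq> 0" and n: "n > 0"
    and l: "l holomorphic_on ball 0 1" "\<forall>z. norm z < 1 \<longrightarrow> exp (l z) = odd_prod24 z" "l 0 = 0"
    and eq: "expansion_at_zero n j l f d N m2 C3 m1 Q"
    and c: "\<kappa> * (24 * int j) * int p = \<alpha> * int n" "\<not> int p dvd \<alpha>"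
  shows False
proof -
  note V = int_unit_odd_prod24_fps
  have Vj: "fps_nth (odd_prod24_fps ^ j) 1 = of_int (- 24 * int j)"
    unfolding fps_nth_1_power[OF int_unit_fpsD(2)[OF V]] odd_prod24_fps_nth_1 by simp
  have nb: "norm x < 1 \<Longrightarrow> norm (x ^ n) < 1" for x :: complex
    using norm_power_less_1 n by blast
  define h where "h = (\<lambda>x. exp (of_nat j / of_nat n * l (x ^ n)))"
  have h: "h holomorphic_on ball 0 1"
    unfolding h_def by (intro holomorphic_intros holomorphic_on_ball_power[OF l(1) n])
  have h0: "h 0 = 1"
    using n by (simp add: h_def l(3) zero_power)
  have hn: "h x ^ n = odd_prod24 (x ^ n) ^ j" if "norm x < 1" for x
  proof -
    have "h x ^ n = exp (of_nat j * l (x ^ n))"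
      using n by (simp add: h_def flip: exp_of_nat_mult)
    also have "\<dots> = exp (l (x ^ n)) ^ j"
      by (simp add: exp_of_nat_mult)
    finally show ?thesis using l(2) nb[OF that] by simp
  qed
  have wexp: "(\<lambda>x. odd_prod24 (x ^ n) ^ j) has_fps_expansion (odd_prod24_fps ^ j oo fps_X ^ n)"
    using has_fps_expansion_compose_power[OF has_fps_expansion_power[OF odd_prod24_has_fps_expansion] n] .
  define D where "D = degree Q"
  define AF where "AF = fps_X ^ j * (diff3_fps oo fps_X ^ n) ^ d * (odd_prod24_fps oo fps_X ^ n) ^ N
    * (theta_b_fps oo fps_X ^ n) ^ m2 * (fps_const (- 16) * fps_X ^ n) ^ D"
  define A where "A = (\<lambda>x. x ^ j * diff3 (x ^ n) ^ d * odd_prod24 (x ^ n) ^ N * theta_b (x ^ n) ^ m2 * (- 16 * x ^ n) ^ D)"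
  have A: "A has_fps_expansion AF"
    unfolding A_def AF_def
    by (intro has_fps_expansion_mult has_fps_expansion_power has_fps_expansion_const has_fps_expansion_fps_X_power
        has_fps_expansion_compose_power[OF diff3_has_fps_expansion n] has_fps_expansion_compose_power[OF odd_prod24_has_fps_expansion n]
        has_fps_expansion_compose_power[OF theta_b_has_fps_expansion n])
  have AI: "int_fps AF"
    unfolding AF_def
    by (intro int_fps_intros int_fps_diff3 int_fps_unit[OF V] int_fps_unit[OF int_unit_theta_b_fps]) simp_all
  have "(diff3_fps oo fps_X ^ n) \<noteq> 0" "(odd_prod24_fps oo fps_X ^ n) \<noteq> 0" "(theta_b_fps oo fps_X ^ n) \<noteq> 0"
    using n diff3_fps_nth_0 int_unit_fpsD(2)[OF V] int_unit_fpsD(2)[OF int_unit_theta_b_fps]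
    by (intro compose_X_power_nonzero; simp)+
  then have A0: "AF \<noteq> 0" unfolding AF_def by simp
  define v where "v = (\<lambda>i x. odd_prod24 (x ^ n) ^ (D - i) * theta_b (x ^ n) ^ m1)"
  define VF where "VF = (\<lambda>i. (odd_prod24_fps oo fps_X ^ n) ^ (D - i) * (theta_b_fps oo fps_X ^ n) ^ m1)"
  have v: "v i has_fps_expansion VF i" for i
    unfolding v_def VF_def
    by (intro has_fps_expansion_mult has_fps_expansion_power has_fps_expansion_compose_power[OF odd_prod24_has_fps_expansion n]
        has_fps_expansion_compose_power[OF theta_b_has_fps_expansion n])
  have VF: "int_unit_fps (VF i)" for i
    unfolding VF_def by (intro int_unit_fps_mult int_unit_fps_power int_unit_fps_compose V int_unit_theta_b_fps n)
  define a where "a = (\<lambda>i. C3 * (- 16) ^ (N + i) * coeff Q (D - i))"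
  have id: "eval_fps f x * A x = h x * (\<Sum>i\<le>D. a i * x ^ (n * N + n * i) * v i x)"
    if "x \<noteq> 0" "norm x < 1" for x
  proof -
    \<comment> \<open>Here the Hauptmodul is z / y and has a pole at x = 0. Multiplying by y^D
      reverses the coefficients of \<open>Q\<close>, so that the exponents increase from 0
      again.\<close>
    define y where "y = - 16 * x ^ n"
    define z where "z = odd_prod24 (x ^ n)"
    have y0: "y \<noteq> 0" using that by (simp add: y_def)
    have zy: "- 1 / 16 * odd_prod24 (x ^ n) / x ^ n = z / y" by (simp add: y_def z_def)
    have "eval_fps f x * A x = (x ^ j * eval_fps f x * diff3 (x ^ n) ^ d * (z / y) ^ N * theta_b (x ^ n) ^ m2) * y ^ N * y ^ D"
      using y0 unfolding A_def y_def[symmetric] z_def[symmetric] by (simp add: power_divide)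
    also have "\<dots> = C3 * h x * theta_b (x ^ n) ^ m1 * poly Q (z / y) * y ^ N * y ^ D"
      using eq[unfolded expansion_at_zero_def, rule_format, OF conjI[OF that]] unfolding zy h_def by (simp only: ac_simps)
    also have "\<dots> = C3 * h x * theta_b (x ^ n) ^ m1 * y ^ N * (poly Q (z / y) * y ^ D)"
      by (simp only: ac_simps)
    also have "poly Q (z / y) * y ^ D = (\<Sum>i\<le>D. coeff Q i * (z ^ i * y ^ (D - i)))"
      unfolding poly_altdef sum_distrib_right D_def[symmetric]
    proof (rule sum.cong[OF refl])
      fix i assume "i \<in> {..D}"
      then have "y ^ D = y ^ i * y ^ (D - i)" by (simp flip: power_add)
      then show "coeff Q i * (z / y) ^ i * y ^ D = coeff Q i * (z ^ i * y ^ (D - i))"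
        using y0 by (simp add: power_divide)
    qed
    also have "\<dots> = (\<Sum>i\<le>D. coeff Q (D - i) * (z ^ (D - i) * y ^ i))"
      by (rule sum.reindex_bij_witness[of _ "\<lambda>i. D - i" "\<lambda>i. D - i"]) auto
    also have "C3 * h x * theta_b (x ^ n) ^ m1 * y ^ N * \<dots> = h x * (\<Sum>i\<le>D. a i * x ^ (n * N + n * i) * v i x)"
      unfolding sum_distrib_left a_def v_def z_def y_def power_mult_distrib power_add power_mult
      by (simp only: ac_simps)
    finally show ?thesis .
  qed
  have c': "\<kappa> * (- 24 * int j) * int p = (- \<alpha>) * int n" "\<not> int p dvd - \<alpha>"
    using c by simp_all
  show False
    by (rule punctured_identity_contradiction[OF f A AI A0 h h0 hn n wexp int_unit_fps_power[OF V] Vj n v VF n id c'])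
qed

end

text \<open>A nonvanishing function on the disc has a logarithm; the normalisation at 0 gives the
  roots formed from it the constant term 1.\<close>

lemma odd_prod24_log:
  obtains l where "l holomorphic_on ball 0 1" "\<forall>z. norm z < 1 \<longrightarrow> exp (l z) = odd_prod24 z" "l 0 = 0"
proof (rule holomorphic_logarithm_exists[of "ball 0 1" odd_prod24 0])
  fix g assume g: "g holomorphic_on ball 0 1" "\<And>z. z \<in> ball 0 1 \<Longrightarrow> exp (g z) = odd_prod24 z"
  have "exp (g 0) = 1" using g(2)[of 0] by simp
  then have "\<forall>z. norm z < 1 \<longrightarrow> exp (g z - g 0) = odd_prod24 z"
    using g(2) by (simp add: exp_diff)
  moreover have "(\<lambda>z. g z - g 0) holomorphic_on ball 0 1"
    using g(1) by (intro holomorphic_intros)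
  ultimately show thesis using that[of "\<lambda>z. g z - g 0"] by simp
qed (use odd_prod24_nonzero odd_prod24_holomorphic in auto)

theorem theorem5p3:
  fixes n p :: nat and k :: int
    and \<zeta> :: complex and \<epsilon> :: real
    and \<rho> :: "(int^2^2) set \<Rightarrow> complex^3^3"
    and F :: "complex \<Rightarrow> complex^3"
    and c :: "3 \<Rightarrow> nat \<Rightarrow> complex"
  assumes lambda: "primitive_root_of_unity n \<zeta>"
    and epsilon: "\<epsilon> \<in> {1, -1}"
    and rho: "\<rho> \<in> hom PSL2Z GL3C"
    and rho_S: "\<rho> (to_PSL2Z matS) =
      \<epsilon> *\<^sub>R vector [vector [0, 0, \<zeta>], vector [0, 1, 0], vector [cnj \<zeta>, 0, 0]]"
    and rho_T: "\<rho> (to_PSL2Z matT) =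
      \<epsilon> *\<^sub>R vector [vector [\<zeta>, 0, 0], vector [0, 0, 1], vector [0, cnj \<zeta>, 0]]"
    and F: "F \<in> vv_modular_forms n k \<rho>"
    and F_nonzero: "\<exists>\<tau>\<in>upper_half_plane. F \<tau> \<noteq> 0"
    and c: "\<And>i. has_fourier_expansion (2 * n) (\<lambda>\<tau>. F \<tau> $ i) (c i)"
    and c_algebraic: "\<And>i m. algebraic (c i m)"
    and p: "prime p" "p dvd n"
    and p_cases: "p \<ge> 5 \<or> p = 3 \<and> 9 dvd n \<or> p = 2 \<and> 16 dvd n"
  shows "\<forall>i. unbounded_denominators p (c i)"
proof (rule allI, rule ccontr)
  fix i :: 3
  assume "\<not> unbounded_denominators p (c i)"
  then obtain N0 where N0: "\<And>m P. prime_above p P \<Longrightarrow> integral_at P (of_nat p ^ N0 * c i m)"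
    by (auto simp: unbounded_denominators_def)
  \<comment> \<open>The negated claim bounds the denominators at every prime above \<open>p\<close>,
    so a contradiction at a single one is enough.\<close>
  obtain P where P: "prime_above p P" using prime_above_exists[OF p(1)] by blast
  interpret prime_over p P by unfold_locales (use p(1) P in auto)
  have n: "n > 0" using lambda by (simp add: primitive_root_of_unity_def)
  obtain j where j: "\<zeta> = nome (2 * of_nat j / of_nat n)" "Rings.coprime j n"
    using primitive_root_of_unity_nome[OF lambda] by blast
  have "norm \<zeta> = 1" by (simp add: j(1) norm_nome)
  then have \<zeta>0: "\<zeta> \<noteq> 0" by auto
  obtain \<kappa> \<alpha> :: int where c0: "\<kappa> * (24 * int j) * int p = \<alpha> * int n" "\<not> int p dvd \<alpha>"
    using exponent_not_integral[OF p n p_cases j(2)] by blast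
  obtain \<tau>0 where \<tau>0: "Im \<tau>0 > 0" "F \<tau>0 \<noteq> 0"
    using F_nonzero by (auto simp: upper_half_plane_def)
  have even: "even k" by (rule vv_modular_forms_even_weight[OF F \<tau>0])
  obtain l where l: "l holomorphic_on ball 0 1" "\<forall>z. norm z < 1 \<longrightarrow> exp (l z) = odd_prod24 z" "l 0 = 0"
    by (rule odd_prod24_log)
  note t = F_transformation[OF F rho_S rho_T]
  have \<epsilon>0: "of_real \<epsilon> \<noteq> (0 :: complex)" using epsilon by auto
  have inv: "Im (- 1 / \<tau>) > 0" "- 1 / (- 1 / \<tau>) = \<tau>" if "Im \<tau> > 0" for \<tau>
    using Im_minus_inverse_pos[OF that] by simp_all
  \<comment> \<open>S exchanges components 1 and 3 up to nonzero factors, and T carries 2 to 3. If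
    component 1 or 3 had zero expansion, all of \<open>F\<close> would vanish.\<close>
  have zero: False if z: "Abs_fps (c i) = 0" and i: "i = 1 \<or> i = 3" for i
  proof -
    have Fi: "F \<tau> $ i = 0" if "Im \<tau> > 0" for \<tau>
      using has_fourier_expansion_eval_fps(2)[OF c n that, of i] z by simp
    have nz: "\<tau> powi k \<noteq> 0" if "Im \<tau> > 0" for \<tau>
      using that by (auto simp: power_int_eq_0_iff)
    have F13: "F \<tau> $ 1 = 0 \<and> F \<tau> $ 3 = 0" if \<tau>: "Im \<tau> > 0" for \<tau>
      using i Fi[OF \<tau>] Fi[OF inv(1)[OF \<tau>]] t(4)[OF \<tau>] t(6)[OF \<tau>] \<zeta>0 \<epsilon>0 nz[OF \<tau>] by auto
    have "F \<tau>0 $ 2 = 0"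
      using F13[of "\<tau>0 + 1"] t(3)[OF \<tau>0(1)] \<tau>0(1) \<zeta>0 \<epsilon>0 by simp
    then have "F \<tau>0 = 0"
      using F13[OF \<tau>0(1)] unfolding Finite_Cartesian_Product.vec_eq_iff forall_3 by simp
    then show False using \<tau>0(2) by simp
  qed
  have bounded: "bounded_denominators (Abs_fps (c i))"
    unfolding bounded_denominators_def using N0[OF P] by auto
  note radius = has_fourier_expansion_eval_fps(1)[OF c n]
  \<comment> \<open>The second conjunct is stated without reference to \<open>i\<close>, since it
    settles i = 3 and is needed again for i = 2.\<close>
  have i13: "i \<noteq> 1 \<and> \<not> bounded_denominators (Abs_fps (c 3))"
  proof (rule vvmf_hauptmodul_poly[OF F n rho_S rho_T j(1) epsilon even c l(1,2)], intro conjI notI)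
    fix Q :: "complex poly" and d N m1 m2 C1 C3
    assume eq1: "expansion_at_infinity n j l (Abs_fps (c 1)) d N m2 C1 m1 Q"
    assume eq3: "expansion_at_zero n j l (Abs_fps (c 3)) d N m2 C3 m1 Q"
    show False if i1: "i = 1"
      by (rule component_1_contradiction[OF radius bounded[unfolded i1] _ n l _ c0], use zero in blast, rule eq1)
    show False if b3: "bounded_denominators (Abs_fps (c 3))"
      by (rule component_3_contradiction[OF radius b3 _ n l _ c0], use zero in blast, rule eq3)
  qed
  then have i2: "i = 2" using exhaust_3[of i] bounded by auto
  \<comment> \<open>F(\<tau> + 1) has second component \<epsilon> times the third component of
    F(\<tau>). The coefficients of components 2 and 3 thus differ by \<epsilon> and powers of the
    root of unity \<open>\<xi>\<close>, which is integral, so bounded denominators pass from 2 to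
    3.\<close>
  define \<xi> where "\<xi> = nome (1 / of_nat n)"
  have \<xi>: "\<xi> ^ (2 * n) = 1" using n by (simp add: \<xi>_def nome_power)
  have "norm \<xi> = 1" by (simp add: \<xi>_def norm_nome)
  have "Abs_fps (c 3) = Abs_fps (\<lambda>m. of_real \<epsilon> * \<xi> ^ m * c 2 m)"
  proof (rule has_fps_expansion_unique_punctured)
    have pos: "fps_conv_radius (Abs_fps (c i)) > 0" for i
      by (rule less_le_trans[OF _ radius[of i]]) simp
    show "eval_fps (Abs_fps (c 3)) has_fps_expansion Abs_fps (c 3)"
      by (rule eval_fps_has_fps_expansion[OF pos])
    have "((\<lambda>x. eval_fps (Abs_fps (c 2)) (\<xi> * x))) has_fps_expansion (Abs_fps (c 2) oo (fps_const \<xi> * fps_X))"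
      using has_fps_expansion_compose[OF eval_fps_has_fps_expansion[OF pos[of 2]]
          has_fps_expansion_cmult_left[OF has_fps_expansion_fps_X, of \<xi>]] by (simp add: o_def)
    then have "(\<lambda>x. of_real \<epsilon> * eval_fps (Abs_fps (c 2)) (\<xi> * x)) has_fps_expansion
        fps_const (of_real \<epsilon>) * (Abs_fps (c 2) oo (fps_const \<xi> * fps_X))"
      by (rule has_fps_expansion_cmult_left)
    also have "fps_const (of_real \<epsilon>) * (Abs_fps (c 2) oo (fps_const \<xi> * fps_X)) = Abs_fps (\<lambda>m. of_real \<epsilon> * \<xi> ^ m * c 2 m)"
      by (rule fps_ext) (simp add: fps_compose_linear)
    finally show "(\<lambda>x. of_real \<epsilon> * eval_fps (Abs_fps (c 2)) (\<xi> * x)) has_fps_expansion Abs_fps (\<lambda>m. of_real \<epsilon> * \<xi> ^ m * c 2 m)" .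
    fix x :: complex assume x: "x \<noteq> 0" "norm x < 1"
    obtain \<tau> where \<tau>: "Im \<tau> > 0" "nome (\<tau> / of_nat n) = x"
      using nome_surj_disc[OF x n] by blast
    have \<epsilon>2: "of_real \<epsilon> * of_real \<epsilon> = (1 :: complex)" using epsilon by auto
    have "F (\<tau> + 1) $ 2 = eval_fps (Abs_fps (c 2)) (nome ((\<tau> + 1) / of_nat n))"
      by (rule has_fourier_expansion_eval_fps(2)[OF c n]) (use \<tau>(1) in simp)
    also have "nome ((\<tau> + 1) / of_nat n) = \<xi> * x"
      by (simp add: add_divide_distrib nome_add \<tau>(2) \<xi>_def)
    finally have "of_real \<epsilon> * (of_real \<epsilon> * F \<tau> $ 3) = of_real \<epsilon> * eval_fps (Abs_fps (c 2)) (\<xi> * x)"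
      unfolding t(2)[OF \<tau>(1)] by simp
    then show "eval_fps (Abs_fps (c 3)) x = of_real \<epsilon> * eval_fps (Abs_fps (c 2)) (\<xi> * x)"
      using has_fourier_expansion_eval_fps(2)[OF c n \<tau>(1), of 3] unfolding \<tau>(2)
      by (simp add: \<epsilon>2 flip: mult.assoc)
  qed
  moreover have "bounded_denominators (Abs_fps (\<lambda>m. of_real \<epsilon> * \<xi> ^ m * c 2 m))"
  proof -
    have \<xi>_int: "algebraic_int \<xi>"
      by (rule algebraic_int_root[of 1 "monom 1 (2 * n)"]) (use n \<xi> in \<open>auto simp: poly_monom degree_monom_eq coeff_monom\<close>)
    have "of_real \<epsilon> \<in> (\<int> :: complex set)" using epsilon by auto
    then have "p_integral ((of_real \<epsilon> * \<xi> ^ m) * (of_nat p ^ N0 * c 2 m))" for m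
      by (intro integral_mult[OF integral_mult[OF integral_Ints integral_power[OF integral_algebraic_int[OF \<xi>_int]]]
            N0[OF P, unfolded i2]])
    then show ?thesis
      unfolding bounded_denominators_def by (intro exI[of _ N0]) (auto simp: mult_ac)
  qed
  ultimately show False using i13 by simp
qed

end
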